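(* Let $\bm X^{(i)}=(X^{(i)}_1,\dots,X^{(i)}_d)^\top$, $i\in\mathbb{N}$, be independent random vectors with common distribution function $F$ on $\mathbb{R}^d$. Suppose that $F$ is continuous and that its copula $C_F$ satisfies, for some $\delta>0$ and some $D$-norm $\|\cdot\|_D$ on $\mathbb{R}^d$, $$C_F(\bm u)-\bigl(1-\|\bm u-\bm 1\|_D\bigr)=O\bigl(\|\bm u-\bm 1\|_D^{1+\delta}\bigr)\quad\text{as }\bm u\uparrow\bm 1 .$$ Fix $k\in\{2,3,\dots\}$. For each $n$ let $M(n)\subset\{1,\dots,n\}$ be an arbitrary subset of size $m_n=|M(n)|$, where $m_n\to\infty$ and $m_n\log(m_n)/n\to0$ as $n\to\infty$, and let $c_n\in(0,1)$ satisfy $c_n\to0$, $m_nc_n\to\infty$ and $m_nc_n^{1+2\delta}\to0$ as $n\to\infty$. Then $$\hat T_n(c_n)\to_D\sum_{i=1}^{k-1}\lambda_i\xi_i^2\quad\text{as }n\to\infty,$$ where $\xi_1,\dots,\xi_{k-1}$ are independent standard normal random variables and $\lambda_i=\frac1{4\sin^2\left(\frac ik\frac\pi2\right)}$, $1\le i\le k-1$.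
   Context: $\bm 1=(1,\dots,1)^\top\in\mathbb{R}^d$, and $\to_D$ denotes convergence in distribution. The limit $\bm u\uparrow\bm 1$ is over $\bm u\in[0,1]^d$, and the $O$ is uniform. $F_1,\dots,F_d$ are the univariate margins of $F$. For a univariate distribution function $H$, $H^{-1}(q):=\inf\{t\in\mathbb{R}: H(t)\ge q\}$, $q\in(0,1)$. The copula of $F$ is $C_F(\bm u)=F(F_1^{-1}(u_1),\dots,F_d^{-1}(u_d))$, $\bm u\in(0,1)^d$. A norm $\|\cdot\|_D$ on $\mathbb{R}^d$ is called a $D$-norm if there is a copula $C$ on $\mathbb{R}^d$ with $C(\bm u)=1-\|\bm u-\bm 1\|_D+o(\|\bm u-\bm 1\|_D)$ uniformly for $\bm u\in[0,1]^d$ as $\bm u\uparrow\bm 1$. The empirical margins are $\hat F_{n,r}(x):=n^{-1}\sum_{i=1}^n1_{(-\infty,x]}(X_r^{(i)})$, $x\in\mathbb{R}$, $1\le r\le d$. For $0<c<1$ and $1\le j\le k$ put $$\hat n_{j,M(n)}(c):=\sum_{i\in M(n)}1_{(0,\infty)}\left(\sum_{r=1}^d1_{\left(\hat F_{n,r}^{-1}\left(1-\frac cj\right),\infty\right)}\bigl(X_r^{(i)}\bigr)\right),$$ i.e. the number of $\bm X^{(i)}$, $i\in M(n)$, that exceed the vector $\bigl(\hat F_{n,r}^{-1}(1-\frac cj)\bigr)_{1\le r\le d}$ in at least one component. The test statistic is $$\hat T_n(c):=\frac{\sum_{j=1}^k\left(j\,\hat n_{j,M(n)}(c)-\frac1k\sum_{\ell=1}^k\ell\,\hat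 n_{\ell,M(n)}(c)\right)^2}{\frac1k\sum_{\ell=1}^k\ell\,\hat n_{\ell,M(n)}(c)} .$$ *)

theory Defs
  imports "HOL-Probability.Probability"
begin

section \<open>Multivariate distribution functions and copulas\<close>

(* The order on real^'d is componentwise, so {..x} is the product of the half-lines {..x $ r}. *)
definition mcdf :: "(real ^ 'd) measure \<Rightarrow> real ^ 'd \<Rightarrow> real" where
  "mcdf \<mu> x = measure \<mu> {..x}"

definition is_df :: "(real ^ 'd \<Rightarrow> real) \<Rightarrow> bool" where
  "is_df F \<longleftrightarrow> (\<exists>\<mu>. prob_space \<mu> \<and> sets \<mu> = sets borel \<and> F = mcdf \<mu>)"

(* The r-th univariate margin: all coordinates other than r tend to infinity (along the
   diagonal, which is enough since distribution functions are monotone). *)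
definition margin :: "(real ^ 'd \<Rightarrow> real) \<Rightarrow> 'd \<Rightarrow> real \<Rightarrow> real" where
  "margin F r t = Lim at_top (\<lambda>s. F (\<chi> i. if i = r then t else s))"

definition quantile :: "(real \<Rightarrow> real) \<Rightarrow> real \<Rightarrow> real" where
  "quantile H q = Inf {t. q \<le> H t}"

definition is_copula :: "(real ^ 'd \<Rightarrow> real) \<Rightarrow> bool" where
  "is_copula C \<longleftrightarrow> is_df C \<and> (\<forall>r. \<forall>t\<in>{0..1}. margin C r t = t)"

(* Meaningful only for u in the open unit cube box 0 1, where the quantiles are finite. *)
definition copula_of :: "(real ^ 'd \<Rightarrow> real) \<Rightarrow> real ^ 'd \<Rightarrow> real" where
  "copula_of F u = F (\<chi> r. quantile (margin F r) (u $ r))"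

section \<open>D-norms\<close>

definition is_norm :: "('v::real_vector \<Rightarrow> real) \<Rightarrow> bool" where
  "is_norm N \<longleftrightarrow>
     (\<forall>x. 0 \<le> N x) \<and> (\<forall>x. N x = 0 \<longleftrightarrow> x = 0) \<and>
     (\<forall>a x. N (a *\<^sub>R x) = \<bar>a\<bar> * N x) \<and> (\<forall>x y. N (x + y) \<le> N x + N y)"

(* On real^'d the constant 1 is the all-ones vector and cbox 0 1 is the closed unit cube. *)
definition D_norm :: "(real ^ 'd \<Rightarrow> real) \<Rightarrow> bool" where
  "D_norm N \<longleftrightarrow> is_norm N \<and>
     (\<exists>C. is_copula C \<and>
        (\<lambda>u. C u - (1 - N (u - 1))) \<in> o[at 1 within cbox 0 1](\<lambda>u. N (u - 1)))"

section \<open>The test statistic\<close>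

text \<open>A sample is a function \<open>x\<close> with observations \<open>x 1, x 2, \<dots>\<close>; the value \<open>x 0\<close> is not used.\<close>

definition emp_margin :: "(nat \<Rightarrow> real ^ 'd) \<Rightarrow> nat \<Rightarrow> 'd \<Rightarrow> real \<Rightarrow> real" where
  "emp_margin x n r t = (\<Sum>i=1..n. indicator {..t} (x i $ r)) / real n"

definition exceed_count :: "(nat \<Rightarrow> real ^ 'd) \<Rightarrow> nat \<Rightarrow> nat set \<Rightarrow> real \<Rightarrow> nat \<Rightarrow> real" where
  "exceed_count x n I c j =
     (\<Sum>i\<in>I. indicator {0<..}
        (\<Sum>r\<in>UNIV. indicator {quantile (emp_margin x n r) (1 - c / real j)<..} (x i $ r) :: real))"

(* If the denominator vanishes then so does the numerator (all counts are 0);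
   the statistic then has the value 0, by the convention 0 / 0 = 0. *)
definition test_stat :: "nat \<Rightarrow> (nat \<Rightarrow> real ^ 'd) \<Rightarrow> nat \<Rightarrow> nat set \<Rightarrow> real \<Rightarrow> real" where
  "test_stat k x n I c =
     (let avg = (\<Sum>l=1..k. real l * exceed_count x n I c l) / real k
      in (\<Sum>j=1..k. (real j * exceed_count x n I c j - avg)\<^sup>2) / avg)"

end

theory Submission
  imports Defs
begin

text \<open>
  With the true marginal quantiles in place of the empirical ones, the centred counts
  \<open>Z j = j (n\<^sub>j - m p\<^sub>j) / \<surd>(m c N(1))\<close> are normalised sums of independent bounded vectors. The exceedance
  events are nested with probabilities \<open>p\<^sub>j \<approx> c N(1) / j\<close>, so the limiting covariance is \<open>min j l\<close>, that of
  Brownian motion at times \<open>1, \<dots>, k\<close>; the bias \<open>j m p\<^sub>j - m c N(1)\<close> is negligible because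
  \<open>m c\<^bsup>1 + 2\<delta>\<^esup> \<rightarrow> 0\<close>. In the orthonormal cosine basis the sum of squared deviations of \<open>Z\<close> from its mean
  becomes \<open>\<Sum>i W\<^sub>i\<^sup>2\<close>, where the \<open>W\<^sub>i\<close> are asymptotically uncorrelated with variances
  \<open>1 / (4 sin\<^sup>2 (i \<pi> / (2 k)))\<close>.

  Convergence in law of \<open>\<Sum>i W\<^sub>i\<^sup>2\<close> follows from that of the characteristic functions of the linear
  forms \<open>\<Sum>i g\<^sub>i W\<^sub>i\<close>: averaging over Gaussian \<open>g\<close> yields the Laplace transform, and Laplace transforms
  determine weak limits on the half-line by Weierstrass approximation in the variable \<open>exp (- x)\<close>.

  Passing to empirical quantiles changes the counts by \<open>o(\<surd>(m c))\<close> in probability: by Chebyshev's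
  inequality the empirical quantile is within \<open>\<epsilon>\<close> of the true one on the probability scale for some
  \<open>\<epsilon>\<close> slightly larger than \<open>\<surd>(c / n)\<close>, and the expected number of observations in a slab of
  probability \<open>2 \<epsilon>\<close> is \<open>2 m \<epsilon>\<close>, which is small compared with \<open>\<surd>(m c)\<close> since \<open>m / n \<rightarrow> 0\<close>.
\<close>

section \<open>Weak convergence of sums of squares\<close>

text \<open>Weak convergence is tested on continuous steps. Under \<open>u = exp (- x)\<close> such
  a step becomes a continuous function on \<open>[0, 1]\<close>, hence a uniform limit of
  polynomials in \<open>u\<close>, and the integral of a polynomial in \<open>exp (- Y)\<close> is a
  finite combination of Laplace transforms at natural arguments.\<close>

lemma weak_conv_m_of_Laplace:
  fixes Y :: "nat \<Rightarrow> 'a \<Rightarrow> real" and Z :: "'b \<Rightarrow> real"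
  assumes P: "prob_space P" and Q: "prob_space Q"
    and Y[measurable]: "\<And>n. Y n \<in> borel_measurable P" and Z[measurable]: "Z \<in> borel_measurable Q"
    and Y0: "\<And>n \<omega>. Y n \<omega> \<ge> 0" and Z0: "\<And>\<omega>. Z \<omega> \<ge> 0"
    and lim: "\<And>s. s \<ge> 0 \<Longrightarrow> (\<lambda>n. \<integral>\<omega>. exp (- s * Y n \<omega>) \<partial>P) \<longlonglongrightarrow> (\<integral>\<omega>. exp (- s * Z \<omega>) \<partial>Q)"
  shows "weak_conv_m (\<lambda>n. distr P borel (Y n)) (distr Q borel Z)"
proof (rule integral_cts_step_conv_imp_weak_conv)
  interpret P: prob_space P by fact
  interpret Q: prob_space Q by fact
  show "real_distribution (distr P borel (Y n))" for n by simp
  show "real_distribution (distr Q borel Z)" by simp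
  fix a b :: real assume "a < b"
  define f where "f = cts_step a b"
  have fcont: "continuous_on UNIV f"
    using cts_step_uniformly_continuous[OF \<open>a < b\<close>] unfolding f_def
    by (rule uniformly_continuous_imp_continuous)
  have fmeas[measurable]: "f \<in> borel_measurable borel"
    using fcont by (rule borel_measurable_continuous_onI)
  have f1: "\<bar>f x\<bar> \<le> 1" for x
    using \<open>a < b\<close> by (auto simp: f_def cts_step_def)
  \<comment> \<open>This is the step in the variable \<open>u = exp (- x)\<close>. The value 0 at
    \<open>u = 0\<close> is the limit of the step at infinity, since the step vanishes beyond
    \<open>b\<close>.\<close>
  define g where "g u = (if u \<le> 0 then 0 else f (- ln u))" for u :: real
  have gcont: "continuous_on {0..1} g"
  proof -
    have "isCont g u" if "u > 0" for u
    proof -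
      have "isCont (\<lambda>u. f (- ln u)) u"
        using fcont that by (intro continuous_intros continuous_within_compose3[where g=f and f="\<lambda>u. - ln u"])
            (auto simp: continuous_on_eq_continuous_at)
      moreover have "\<forall>\<^sub>F x in nhds u. g x = f (- ln x)"
        using eventually_nhds_in_open[of "{0<..}" u] that
        by (auto simp: g_def elim!: eventually_mono)
      ultimately show ?thesis by (simp cong: isCont_cong)
    qed
    moreover have "isCont g 0"
    proof -
      have "\<forall>\<^sub>F x in nhds 0. g x = (0::real)"
      proof (rule eventually_mono[OF eventually_nhds_in_open[of "{..<exp (- b)}"]])
        fix x :: real assume "x \<in> {..<exp (- b)}"
        then show "g x = 0"
          using \<open>a < b\<close> ln_less_cancel_iff[of x "exp (- b)"]
          by (cases "x \<le> 0") (auto simp: g_def f_def cts_step_def)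
      qed auto
      then show ?thesis by (simp cong: isCont_cong)
    qed
    ultimately show ?thesis
      by (metis atLeastAtMost_iff continuous_at_imp_continuous_on le_less)
  qed
  have fg: "f x = g (exp (- x))" for x by (simp add: g_def)
  have appr: "\<exists>L L'. (\<lambda>n. L n) \<longlonglongrightarrow> L' \<and> (\<forall>n. \<bar>(\<integral>\<omega>. f (Y n \<omega>) \<partial>P) - L n\<bar> \<le> e) \<and>
       \<bar>(\<integral>\<omega>. f (Z \<omega>) \<partial>Q) - L'\<bar> \<le> e" if "e > 0" for e :: real
  proof -
    obtain p where "real_polynomial_function p" and p: "\<And>x. x \<in> {0..1} \<Longrightarrow> \<bar>g x - p x\<bar> < e"
      using Stone_Weierstrass_real_polynomial_function[OF _ gcont \<open>e > 0\<close>] by auto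
    then obtain d m where pd: "p = (\<lambda>x. \<Sum>i\<le>m. d i * x ^ i)"
      unfolding real_polynomial_function_iff_sum by blast
    \<comment> \<open>Non-negativity of \<open>V\<close> keeps \<open>exp (- V)\<close> in
      \<open>[0, 1]\<close>, where the polynomial approximates \<open>g\<close>. The claim is made
      for an arbitrary probability space because it is used for both \<open>P\<close> and
      \<open>Q\<close>.\<close>
    have main: "\<bar>(\<integral>\<omega>. f (V \<omega>) \<partial>R) - (\<Sum>i\<le>m. d i * (\<integral>\<omega>. exp (- real i * V \<omega>) \<partial>R))\<bar> \<le> e"
      if R: "prob_space R" and [measurable]: "V \<in> borel_measurable R" and V0: "\<And>\<omega>. V \<omega> \<ge> 0"
      for R :: "'x measure" and V
    proof -
      interpret prob_space R by fact
      have i1: "integrable R (\<lambda>\<omega>. f (V \<omega>))"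
        by (rule integrable_const_bound[where B=1]) (auto simp: f1)
      have i2: "integrable R (\<lambda>\<omega>. exp (- real i * V \<omega>))" for i
        by (rule integrable_const_bound[where B=1]) (auto simp: V0)
      have "(\<Sum>i\<le>m. d i * (\<integral>\<omega>. exp (- real i * V \<omega>) \<partial>R)) = (\<integral>\<omega>. p (exp (- V \<omega>)) \<partial>R)"
        using i2 by (simp add: pd Bochner_Integration.integral_sum exp_of_nat_mult[symmetric])
      moreover have ip: "integrable R (\<lambda>\<omega>. p (exp (- V \<omega>)))"
        using i2 by (auto simp: pd exp_of_nat_mult[symmetric])
      moreover have "\<bar>\<integral>\<omega>. f (V \<omega>) - p (exp (- V \<omega>)) \<partial>R\<bar> \<le> (\<integral>\<omega>. e \<partial>R)"
        using i1 ip p V0 by (intro order.trans[OF integral_abs_bound] integral_mono)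
           (auto simp: fg intro!: less_imp_le)
      ultimately show ?thesis using i1 by (simp add: prob_space)
    qed
    show ?thesis
      using main[OF P Y Y0] main[OF Q Z Z0] lim
      by (intro exI[of _ "\<lambda>n. \<Sum>i\<le>m. d i * (\<integral>\<omega>. exp (- real i * Y n \<omega>) \<partial>P)"]
           exI[of _ "\<Sum>i\<le>m. d i * (\<integral>\<omega>. exp (- real i * Z \<omega>) \<partial>Q)"] conjI allI)
         (auto intro!: tendsto_intros)
  qed
  have "(\<lambda>n. \<integral>\<omega>. f (Y n \<omega>) \<partial>P) \<longlonglongrightarrow> (\<integral>\<omega>. f (Z \<omega>) \<partial>Q)"
  proof (rule LIMSEQ_I)
    fix e :: real assume "e > 0"
    then obtain L L' where L: "L \<longlonglongrightarrow> L'" "\<And>n. \<bar>(\<integral>\<omega>. f (Y n \<omega>) \<partial>P) - L n\<bar> \<le> e / 4"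
       "\<bar>(\<integral>\<omega>. f (Z \<omega>) \<partial>Q) - L'\<bar> \<le> e / 4" using appr[of "e / 4"] by auto
    obtain N where N: "\<And>n. n \<ge> N \<Longrightarrow> \<bar>L n - L'\<bar> < e / 4"
      using LIMSEQ_D[OF L(1), of "e / 4"] \<open>e > 0\<close> by auto
    show "\<exists>no. \<forall>n\<ge>no. norm ((\<integral>\<omega>. f (Y n \<omega>) \<partial>P) - (\<integral>\<omega>. f (Z \<omega>) \<partial>Q)) < e"
    proof (intro exI[of _ N] allI impI)
      fix n assume "n \<ge> N"
      then show "norm ((\<integral>\<omega>. f (Y n \<omega>) \<partial>P) - (\<integral>\<omega>. f (Z \<omega>) \<partial>Q)) < e"
        using L(2)[of n] L(3) N[of n] \<open>e > 0\<close> unfolding real_norm_def by linarith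
    qed
  qed
  then show "(\<lambda>n. integral\<^sup>L (distr P borel (Y n)) (cts_step a b)) \<longlonglongrightarrow> integral\<^sup>L (distr Q borel Z) (cts_step a b)"
    by (simp add: integral_distr f_def[symmetric])
qed

text \<open>Independence factorises the characteristic function at 1. The formula serves both to
  integrate out random Gaussian weights and to evaluate the characteristic function of the
  limit.\<close>

lemma integral_iexp_std_normal_combination:
  fixes \<xi> :: "nat \<Rightarrow> 'b \<Rightarrow> real"
  assumes Q: "prob_space Q" and J: "finite J"
    and ind: "prob_space.indep_vars Q (\<lambda>_. borel) \<xi> J"
    and \<xi>: "\<And>i. i \<in> J \<Longrightarrow> distributed Q lborel (\<xi> i) std_normal_density"
  shows "(CLINT \<omega>|Q. iexp (\<Sum>i\<in>J. w i * \<xi> i \<omega>)) = of_real (exp (- (\<Sum>i\<in>J. (w i)\<^sup>2) / 2))"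
proof -
  interpret prob_space Q by fact
  have [measurable]: "\<xi> i \<in> borel_measurable Q" if "i \<in> J" for i
    using ind that by (auto simp: indep_vars_def2)
  have char: "(CLINT \<omega>|Q. iexp (w i * \<xi> i \<omega>)) = of_real (exp (- (w i)\<^sup>2 / 2))" if "i \<in> J" for i
  proof -
    have "distr Q borel (\<xi> i) = std_normal_distribution"
      using \<xi>[OF that] by (auto simp: distributed_def cong: distr_cong)
    then have "char (distr Q borel (\<xi> i)) (w i) = of_real (exp (- (w i)\<^sup>2 / 2))"
      by (simp add: char_std_normal_distribution)
    then show ?thesis using that by (simp add: char_def integral_distr)
  qed
  have "indep_vars (\<lambda>_. borel) (\<lambda>i \<omega>. w i * \<xi> i \<omega>) J"
    by (rule indep_vars_compose2[OF ind]) auto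
  then have "char (distr Q borel (\<lambda>\<omega>. \<Sum>i\<in>J. w i * \<xi> i \<omega>)) 1
      = (\<Prod>i\<in>J. char (distr Q borel (\<lambda>\<omega>. w i * \<xi> i \<omega>)) 1)"
    by (rule char_distr_sum)
  then have "(CLINT \<omega>|Q. iexp (\<Sum>i\<in>J. w i * \<xi> i \<omega>)) = (\<Prod>i\<in>J. of_real (exp (- (w i)\<^sup>2 / 2)))"
    using char by (simp add: char_def integral_distr cong: prod.cong)
  also have "\<dots> = of_real (exp (- (\<Sum>i\<in>J. (w i)\<^sup>2) / 2))"
    by (simp add: sum_divide_distrib exp_sum[OF J, symmetric] sum_negf flip: of_real_prod)
  finally show ?thesis .
qed

text \<open>For standard normal \<open>\<xi>\<close>, averaging the characteristic function of \<open>\<Sum>i. \<xi> i * w i\<close> over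
  \<open>\<xi>\<close> turns it into the Laplace transform of \<open>\<Sum>i. (w i)\<^sup>2\<close>.\<close>
lemma Laplace_sum_squares:
  fixes \<xi> :: "nat \<Rightarrow> 'b \<Rightarrow> real" and W :: "nat \<Rightarrow> 'a \<Rightarrow> real"
  assumes P: "prob_space P" and Q: "prob_space Q" and J: "finite J"
    and ind: "prob_space.indep_vars Q (\<lambda>_. borel) \<xi> J"
    and \<xi>: "\<And>i. i \<in> J \<Longrightarrow> distributed Q lborel (\<xi> i) std_normal_density"
    and W[measurable]: "\<And>i. i \<in> J \<Longrightarrow> W i \<in> borel_measurable P"
    and s: "s \<ge> 0"
  shows "complex_of_real (\<integral>\<omega>. exp (- s * (\<Sum>i\<in>J. (W i \<omega>)\<^sup>2)) \<partial>P) =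
    (CLINT \<eta>|Q. CLINT \<omega>|P. iexp (\<Sum>i\<in>J. (sqrt (2 * s) * \<xi> i \<eta>) * W i \<omega>))"
proof -
  interpret P: prob_space P by fact
  interpret Q: prob_space Q by fact
  interpret PQ: pair_prob_space P Q ..
  have [measurable]: "\<xi> i \<in> borel_measurable Q" if "i \<in> J" for i
    using ind that by (auto simp: Q.indep_vars_def2)
  have "complex_of_real (\<integral>\<omega>. exp (- s * (\<Sum>i\<in>J. (W i \<omega>)\<^sup>2)) \<partial>P)
      = (CLINT \<omega>|P. of_real (exp (- s * (\<Sum>i\<in>J. (W i \<omega>)\<^sup>2))))"
    by (rule integral_complex_of_real[symmetric])
  \<comment> \<open>For fixed \<open>\<omega>\<close> the weight \<open>sqrt (2 * s) * W\<close>
    gives the exponent \<open>- (2 * s) * W^2 / 2 = - s * W^2\<close>.\<close>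
  also have "\<dots> = (CLINT \<omega>|P. CLINT \<eta>|Q. iexp (\<Sum>i\<in>J. (sqrt (2 * s) * W i \<omega>) * \<xi> i \<eta>))"
    using s by (simp only: integral_iexp_std_normal_combination[OF Q J ind \<xi>])
       (simp add: power_mult_distrib flip: sum_distrib_left)
  also have "\<dots> = (CLINT \<eta>|Q. CLINT \<omega>|P. iexp (\<Sum>i\<in>J. (sqrt (2 * s) * W i \<omega>) * \<xi> i \<eta>))"
    by (rule PQ.Fubini_integral[symmetric], rule PQ.P.integrable_const_bound[where B=1])
       (auto simp: norm_exp_i_times)
  finally show ?thesis by (simp add: ac_simps)
qed

text \<open>A Cramer-Wold device for the squared Euclidean norm.\<close>
lemma Laplace_sum_squares_tendsto:
  fixes \<xi> :: "nat \<Rightarrow> 'b \<Rightarrow> real" and W :: "nat \<Rightarrow> nat \<Rightarrow> 'a \<Rightarrow> real"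
  assumes P: "prob_space P" and Q: "prob_space Q" and J: "finite J"
    and ind: "prob_space.indep_vars Q (\<lambda>_. borel) \<xi> J"
    and \<xi>: "\<And>i. i \<in> J \<Longrightarrow> distributed Q lborel (\<xi> i) std_normal_density"
    and W[measurable]: "\<And>n i. i \<in> J \<Longrightarrow> W n i \<in> borel_measurable P"
    and lam0: "\<And>i. i \<in> J \<Longrightarrow> lam i \<ge> 0"
    and char: "\<And>g. (\<lambda>n. CLINT \<omega>|P. iexp (\<Sum>i\<in>J. g i * W n i \<omega>))
        \<longlonglongrightarrow> complex_of_real (exp (- (\<Sum>i\<in>J. lam i * (g i)\<^sup>2) / 2))"
    and s: "s \<ge> 0"
  shows "(\<lambda>n. \<integral>\<omega>. exp (- s * (\<Sum>i\<in>J. (W n i \<omega>)\<^sup>2)) \<partial>P)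
       \<longlonglongrightarrow> (\<integral>\<omega>. exp (- s * (\<Sum>i\<in>J. lam i * (\<xi> i \<omega>)\<^sup>2)) \<partial>Q)"
proof -
  interpret P: prob_space P by fact
  interpret Q: prob_space Q by fact
  interpret QP: pair_prob_space Q P ..
  have \<xi>m[measurable]: "\<xi> i \<in> borel_measurable Q" if "i \<in> J" for i
    using ind that by (auto simp: Q.indep_vars_def2)
  \<comment> \<open>Absorbing \<open>lam i\<close> into the square lets
    \<open>Laplace_sum_squares\<close> be applied with the limit variables in the role of
    \<open>W\<close>. The limit then has the same form as the sequence: a characteristic function
    averaged over Gaussian weights.\<close>
  have "(\<integral>\<omega>. exp (- s * (\<Sum>i\<in>J. lam i * (\<xi> i \<omega>)\<^sup>2)) \<partial>Q)
     = (\<integral>\<omega>. exp (- s * (\<Sum>i\<in>J. (sqrt (lam i) * \<xi> i \<omega>)\<^sup>2)) \<partial>Q)"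
    using lam0 by (simp add: power_mult_distrib)
  then have "complex_of_real (\<integral>\<omega>. exp (- s * (\<Sum>i\<in>J. lam i * (\<xi> i \<omega>)\<^sup>2)) \<partial>Q)
     = (CLINT \<eta>|Q. CLINT \<omega>|Q. iexp (\<Sum>i\<in>J. (sqrt (2 * s) * \<xi> i \<eta>) * (sqrt (lam i) * \<xi> i \<omega>)))"
    by (simp only: Laplace_sum_squares[OF Q Q J ind \<xi> _ s] measurable borel_measurable_times \<xi>m borel_measurable_const)
  also have "\<dots> = (CLINT \<eta>|Q. CLINT \<omega>|Q. iexp (\<Sum>i\<in>J. (sqrt (2 * s) * \<xi> i \<eta> * sqrt (lam i)) * \<xi> i \<omega>))"
    by (simp add: ac_simps)
  also have "\<dots> = (CLINT \<eta>|Q. complex_of_real (exp (- (\<Sum>i\<in>J. lam i * (sqrt (2 * s) * \<xi> i \<eta>)\<^sup>2) / 2)))"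
    using lam0 by (simp only: integral_iexp_std_normal_combination[OF Q J ind \<xi>])
      (simp add: power_mult_distrib mult_ac)
  finally have eq: "complex_of_real (\<integral>\<omega>. exp (- s * (\<Sum>i\<in>J. lam i * (\<xi> i \<omega>)\<^sup>2)) \<partial>Q) = \<dots>" .
  \<comment> \<open>For each fixed value of the weights, \<open>char\<close> gives convergence.
    Characteristic functions are bounded by 1, so dominated convergence carries it through the
    average.\<close>
  have "(\<lambda>n. CLINT \<eta>|Q. CLINT \<omega>|P. iexp (\<Sum>i\<in>J. (sqrt (2 * s) * \<xi> i \<eta>) * W n i \<omega>))
     \<longlonglongrightarrow> (CLINT \<eta>|Q. complex_of_real (exp (- (\<Sum>i\<in>J. lam i * (sqrt (2 * s) * \<xi> i \<eta>)\<^sup>2) / 2)))"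
  proof (rule integral_dominated_convergence[where w="\<lambda>_. 1"])
    show "AE \<eta> in Q. norm (CLINT \<omega>|P. iexp (\<Sum>i\<in>J. (sqrt (2 * s) * \<xi> i \<eta>) * W n i \<omega>)) \<le> 1" for n
    proof (intro AE_I2 order.trans[OF integral_norm_bound])
      fix \<eta>
      show "(\<integral>\<omega>. norm (iexp (\<Sum>i\<in>J. (sqrt (2 * s) * \<xi> i \<eta>) * W n i \<omega>)) \<partial>P) \<le> 1"
        by (simp only: norm_exp_i_times) (simp add: P.prob_space)
    qed
    show "AE \<eta> in Q. (\<lambda>n. CLINT \<omega>|P. iexp (\<Sum>i\<in>J. (sqrt (2 * s) * \<xi> i \<eta>) * W n i \<omega>))
        \<longlonglongrightarrow> complex_of_real (exp (- (\<Sum>i\<in>J. lam i * (sqrt (2 * s) * \<xi> i \<eta>)\<^sup>2) / 2))"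
      by (intro AE_I2 char)
  qed (auto intro!: P.borel_measurable_lebesgue_integral)
  then have "(\<lambda>n. complex_of_real (\<integral>\<omega>. exp (- s * (\<Sum>i\<in>J. (W n i \<omega>)\<^sup>2)) \<partial>P))
     \<longlonglongrightarrow> complex_of_real (\<integral>\<omega>. exp (- s * (\<Sum>i\<in>J. lam i * (\<xi> i \<omega>)\<^sup>2)) \<partial>Q)"
    unfolding eq by (simp only: Laplace_sum_squares[OF P Q J ind \<xi> W s])
  then show ?thesis by (simp only: tendsto_of_real_iff)
qed

section \<open>The cosine basis\<close>

text \<open>The Dirichlet kernel: the factor \<open>2 * sin (t / 2)\<close> turns each cosine into a
  difference of sines at consecutive half-integers. Nothing is divided, so zeros of the sine are
  allowed.\<close>

lemma sum_cos_telescope: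
  fixes t :: real
  shows "2 * sin (t / 2) * (\<Sum>i=1..n. cos (real i * t)) = sin ((real n + 1 / 2) * t) - sin (t / 2)"
proof (induction n)
  case (Suc n)
  have "2 * sin (t / 2) * cos (real (Suc n) * t) = sin ((real (Suc n) + 1 / 2) * t) - sin ((real n + 1 / 2) * t)"
    by (simp add: sin_diff_sin distrib_right add_divide_distrib) (simp add: algebra_simps)
  with Suc show ?case by (simp add: distrib_left)
qed simp

text \<open>All orthogonality relations below come from this sum. At \<open>t = pi * a / k\<close>
  the upper end of the telescope is
  \<open>sin (pi * a - t / 2) = - cos (pi * a) * sin (t / 2)\<close>. Unless
  \<open>sin (t / 2) = 0\<close>, that is unless \<open>2 * k\<close> divides \<open>a\<close>, that
  sine cancels and the parity of \<open>a\<close> decides.\<close>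

lemma sum_cos_multiples:
  fixes a :: int and k :: nat
  assumes k: "k \<ge> 1"
  shows "(\<Sum>i=1..k - 1. cos (real i * (pi * a / k)))
    = (if 2 * int k dvd a then real k - 1 else if even a then - 1 else 0)"
proof (cases "2 * int k dvd a")
  case True
  then obtain b where b: "a = 2 * int k * b" by blast
  have "cos (real i * (pi * a / k)) = 1" for i
  proof -
    have "real i * (pi * a / k) = real_of_int (int i * b) * (2 * pi)" using k by (simp add: b)
    then show ?thesis using cos_int_2pin[of "int i * b"] by (simp only: mult_ac)
  qed
  then show ?thesis using True k by (simp add: of_nat_diff)
next
  case False
  let ?t = "pi * a / k"
  have s0: "sin (?t / 2) \<noteq> 0"
  proof
    assume "sin (?t / 2) = 0"
    then obtain b :: int where "?t / 2 = b * pi" by (auto simp: sin_zero_iff_int2)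
    then have "real_of_int a = real_of_int (2 * int k * b)" using k by (simp add: field_simps)
    then have "a = 2 * int k * b" by (simp only: of_int_eq_iff)
    with False show False by simp
  qed
  have e: "(real (k - 1) + 1 / 2) * ?t = pi * a - ?t / 2" using k by (simp add: of_nat_diff field_simps)
  have c: "cos (pi * a) = (if even a then 1 else - 1)"
    using cos_int_times_real[of a pi] by (simp add: mult.commute)
  have "sin (pi * a) = 0" by (simp add: sin_zero_iff_int2)
  then have "2 * sin (?t / 2) * (\<Sum>i=1..k - 1. cos (real i * ?t)) = - (cos (pi * a) + 1) * sin (?t / 2)"
    unfolding sum_cos_telescope e by (simp add: sin_diff algebra_simps)
  then have "sin (?t / 2) * (2 * (\<Sum>i=1..k - 1. cos (real i * ?t)) + (cos (pi * a) + 1)) = 0"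
    by (simp only: distrib_left) (simp only: mult_ac minus_mult_left[symmetric], simp)
  with s0 have "2 * (\<Sum>i=1..k - 1. cos (real i * ?t)) + (cos (pi * a) + 1) = 0"
    by (simp only: mult_eq_0_iff) simp
  then show ?thesis using False c by (cases "even a") simp_all
qed

lemma sqrt_mult_sqrt_mult:
  "c \<ge> 0 \<Longrightarrow> sqrt c * x * (sqrt c * y) = c * (x * y)"
  using real_sqrt_mult_self[of c] by (metis abs_of_nonneg mult.assoc mult.left_commute)

text \<open>The orthonormal discrete cosine transform of type II, with frequency \<open>i\<close>
  and half-integer node \<open>j\<close>. The scaling is that of frequencies
  \<open>1..k - 1\<close>; the constant vector is left out because centring removes it.\<close>

definition dct :: "nat \<Rightarrow> nat \<Rightarrow> nat \<Rightarrow> real" where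
  "dct k i j = sqrt (2 / k) * cos (pi * i * (2 * real j - 1) / (2 * real k))"

text \<open>Completeness of the basis; the subtracted \<open>1 / k\<close> is the projection onto
  constants. The product formula leaves cosine sums with multiples \<open>j - l\<close> and
  \<open>j + l - 1\<close>, which have opposite parity, so for \<open>j \<noteq> l\<close> exactly
  one of them contributes -1.\<close>

lemma sum_dct_dct:
  assumes k: "k \<ge> 1" and j: "j \<in> {1..k}" and l: "l \<in> {1..k}"
  shows "(\<Sum>i=1..k - 1. dct k i j * dct k i l) = (if j = l then 1 else 0) - 1 / k"
proof -
  have "dct k i j * dct k i l = (1 / k) * (cos (real i * (pi * real_of_int (int j - int l) / k)) + cos (real i * (pi * real_of_int (int j + int l - 1) / k)))" for i
  proof -
    have "dct k i j * dct k i l = 2 / k * (cos (pi * i * (2 * real j - 1) / (2 * real k)) * cos (pi * i * (2 * real l - 1) / (2 * real k)))"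
      unfolding dct_def by (rule sqrt_mult_sqrt_mult) simp
    also have "\<dots> = (1 / k) * (cos (pi * i * (2 * real j - 1) / (2 * real k) - pi * i * (2 * real l - 1) / (2 * real k)) +
        cos (pi * i * (2 * real j - 1) / (2 * real k) + pi * i * (2 * real l - 1) / (2 * real k)))"
      unfolding cos_times_cos by (simp add: add_divide_distrib)
    also have "pi * i * (2 * real j - 1) / (2 * real k) - pi * i * (2 * real l - 1) / (2 * real k) = real i * (pi * real_of_int (int j - int l) / k)"
      using k by (simp add: field_simps)
    also have "pi * i * (2 * real j - 1) / (2 * real k) + pi * i * (2 * real l - 1) / (2 * real k) = real i * (pi * real_of_int (int j + int l - 1) / k)"
      using k by (simp add: field_simps)
    finally show ?thesis .
  qed
  then have "(\<Sum>i=1..k - 1. dct k i j * dct k i l) =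
     (1 / k) * ((\<Sum>i=1..k - 1. cos (real i * (pi * real_of_int (int j - int l) / k))) + (\<Sum>i=1..k - 1. cos (real i * (pi * real_of_int (int j + int l - 1) / k))))"
    by (simp only: sum_distrib_left sum.distrib distrib_left)
  moreover have n1: "\<not> 2 * int k dvd int j + int l - 1"
    using j l by (auto dest!: zdvd_imp_le)
  moreover have n2: "\<not> 2 * int k dvd int j - int l" if "j \<noteq> l"
  proof
    assume "2 * int k dvd int j - int l"
    then have "2 * int k \<le> \<bar>int j - int l\<bar>" using that dvd_imp_le_int[of "int j - int l" "2 * int k"] by auto
    then show False using j l by auto
  qed
  ultimately show ?thesis
    using k unfolding sum_cos_multiples[OF k] by (auto simp: divide_simps split: if_splits)
qed

text \<open>The cosine vectors together with the constant vector form an orthonormal basis, so this is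
  Parseval's identity.\<close>
lemma sum_squares_dct:
  fixes z :: "nat \<Rightarrow> real"
  assumes k: "k \<ge> 1"
  shows "(\<Sum>j=1..k. (z j - (\<Sum>l=1..k. z l) / k)\<^sup>2) = (\<Sum>i=1..k - 1. (\<Sum>j=1..k. dct k i j * z j)\<^sup>2)"
proof -
  have "(\<Sum>i=1..k - 1. (\<Sum>j=1..k. dct k i j * z j)\<^sup>2)
     = (\<Sum>i=1..k - 1. \<Sum>j=1..k. \<Sum>l=1..k. z j * z l * (dct k i j * dct k i l))"
    by (simp add: power2_eq_square sum_product mult_ac)
  also have "\<dots> = (\<Sum>j=1..k. \<Sum>i=1..k - 1. \<Sum>l=1..k. z j * z l * (dct k i j * dct k i l))"
    by (rule sum.swap)
  also have "\<dots> = (\<Sum>j=1..k. \<Sum>l=1..k. z j * z l * (\<Sum>i=1..k - 1. dct k i j * dct k i l))"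
    unfolding sum_distrib_left by (intro sum.cong refl sum.swap)
  also have "\<dots> = (\<Sum>j=1..k. \<Sum>l=1..k. (if j = l then (z j)\<^sup>2 else 0) - z j * z l / k)"
    by (intro sum.cong refl) (simp only: sum_dct_dct[OF k], simp add: right_diff_distrib power2_eq_square)
  also have "\<dots> = (\<Sum>j=1..k. (z j)\<^sup>2) - (\<Sum>j=1..k. z j)\<^sup>2 / k"
    by (simp only: sum_subtractf sum_product power2_eq_square[of "sum z {1..k}"] sum_divide_distrib) simp
  also have "\<dots> = (\<Sum>j=1..k. (z j - (\<Sum>l=1..k. z l) / k)\<^sup>2)"
  proof -
    let ?s = "\<Sum>l=1..k. z l"
    have "(\<Sum>j=1..k. (z j - ?s / k)\<^sup>2) = (\<Sum>j=1..k. (z j)\<^sup>2 + (?s / k)\<^sup>2 - 2 * ?s / k * z j)"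
      by (intro sum.cong refl) (simp add: power2_diff)
    also have "\<dots> = (\<Sum>j=1..k. (z j)\<^sup>2) + k * (?s / k)\<^sup>2 - 2 * ?s / k * ?s"
      by (simp add: sum_subtractf sum.distrib sum_distrib_left)
    finally show ?thesis using k by (simp add: power2_eq_square)
  qed
  finally show ?thesis by simp
qed

text \<open>\<open>min j l\<close> counts the \<open>p \<ge> 1\<close> below both \<open>j\<close>
  and \<open>l\<close>. This is Brownian motion at integer times written as a sum of unit
  increments, and it turns the quadratic form into an inner product of tail sums.\<close>

lemma sum_min_eq_sum_tails:
  fixes a b :: "nat \<Rightarrow> real"
  shows "(\<Sum>j=1..k. \<Sum>l=1..k. a j * b l * real (min j l)) = (\<Sum>p=1..k. (\<Sum>j=p..k. a j) * (\<Sum>l=p..k. b l))"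
proof -
  have m: "real (min j l) = (\<Sum>p=1..k. (if p \<le> j then 1 else 0) * (if p \<le> l then 1 else 0))"
    if "j \<in> {1..k}" "l \<in> {1..k}" for j l
  proof -
    have "(\<Sum>p=1..k. (if p \<le> j then 1 else 0) * (if p \<le> l then 1 else 0 :: real)) = (\<Sum>p=1..k. if p \<in> {1..min j l} then 1 else 0)"
      by (intro sum.cong) auto
    also have "\<dots> = real (card ({1..k} \<inter> {1..min j l}))" by (subst sum.inter_restrict[symmetric]) auto
    also have "{1..k} \<inter> {1..min j l} = {1..min j l}" using that by auto
    finally show ?thesis by simp
  qed
  have t: "(\<Sum>j=1..k. a j * (if p \<le> j then 1 else 0)) = (\<Sum>j=p..k. a j)" if "p \<in> {1..k}" for a :: "nat \<Rightarrow> real" and p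
    using that by (intro sum.mono_neutral_cong_right) auto
  have "(\<Sum>j=1..k. \<Sum>l=1..k. a j * b l * real (min j l))
    = (\<Sum>j=1..k. \<Sum>l=1..k. \<Sum>p=1..k. (a j * (if p \<le> j then 1 else 0)) * (b l * (if p \<le> l then 1 else 0)))"
    by (intro sum.cong refl) (simp only: m sum_distrib_left mult_ac)
  also have "\<dots> = (\<Sum>j=1..k. \<Sum>p=1..k. \<Sum>l=1..k. (a j * (if p \<le> j then 1 else 0)) * (b l * (if p \<le> l then 1 else 0)))"
    by (intro sum.cong refl sum.swap)
  also have "\<dots> = (\<Sum>p=1..k. \<Sum>j=1..k. \<Sum>l=1..k. (a j * (if p \<le> j then 1 else 0)) * (b l * (if p \<le> l then 1 else 0)))"
    by (rule sum.swap)
  also have "\<dots> = (\<Sum>p=1..k. (\<Sum>j=1..k. a j * (if p \<le> j then 1 else 0)) * (\<Sum>l=1..k. b l * (if p \<le> l then 1 else 0)))"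
    by (simp only: sum_product)
  also have "\<dots> = (\<Sum>p=1..k. (\<Sum>j=p..k. a j) * (\<Sum>l=p..k. b l))"
    by (intro sum.cong refl) (simp only: t)
  finally show ?thesis .
qed

text \<open>With half-step \<open>h = pi * i / (2 * k)\<close>, the factor \<open>2 * sin h\<close>
  makes each cosine a difference of sines at consecutive nodes. The sum telescopes and its upper end
  contributes \<open>sin (pi * i) = 0\<close>.\<close>

lemma sum_tail_dct:
  assumes i: "i \<in> {1..k - 1}" and p: "p \<in> {1..k}"
  shows "(\<Sum>j=p..k. dct k i j) = - sqrt (2 / k) * sin (pi * i * (real p - 1) / k) / (2 * sin (pi * i / (2 * real k)))"
proof -
  let ?h = "pi * i / (2 * real k)"
  have h: "0 < ?h" "?h < pi" using i by (auto simp: field_simps)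
  then have s: "sin ?h > 0" by (intro sin_gt_zero)
  have "2 * sin ?h * dct k i j = sqrt (2 / k) * (sin (pi * i * j / k) - sin (pi * i * (real j - 1) / k))" for j
  proof -
    have a: "(pi * i * j / k - pi * i * (real j - 1) / k) / 2 = ?h"
      using i by (simp add: field_simps diff_divide_distrib)
    have b: "(pi * i * j / k + pi * i * (real j - 1) / k) / 2 = pi * i * (2 * real j - 1) / (2 * real k)"
      using i by (simp add: divide_simps) (simp add: algebra_simps)
    show ?thesis unfolding dct_def sin_diff_sin a b by simp
  qed
  then have "2 * sin ?h * (\<Sum>j=p..k. dct k i j) = (\<Sum>j=p..k. sqrt (2 / k) * (sin (pi * i * j / k) - sin (pi * i * (real j - 1) / k)))"
    by (simp only: sum_distrib_left)
  also have "\<dots> = sqrt (2 / k) * (\<Sum>j=p..k. sin (pi * i * (real (Suc j) - 1) / k) - sin (pi * i * (real j - 1) / k))"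
    by (simp add: sum_distrib_left)
  also have "(\<Sum>j=p..k. sin (pi * i * (real (Suc j) - 1) / k) - sin (pi * i * (real j - 1) / k))
     = sin (pi * i * (real (Suc k) - 1) / k) - sin (pi * i * (real p - 1) / k)"
    using p by (intro sum_Suc_diff) auto
  also have "sin (pi * i * (real (Suc k) - 1) / k) = 0"
    using i by (simp add: sin_npi2)
  finally show ?thesis using s p by (simp add: field_simps of_nat_diff)
qed

text \<open>Tail sums of cosine vectors are multiples of sine vectors, which are again orthogonal
  with squared length \<open>k / 2\<close>. This length cancels the \<open>2 / k\<close> of the
  scaling, and the factors \<open>1 / (2 * sin h)\<close> multiply to the weights of the limit
  law.\<close>

lemma sum_dct_min:
  assumes i: "i \<in> {1..k - 1}" and i': "i' \<in> {1..k - 1}"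
  shows "(\<Sum>j=1..k. \<Sum>l=1..k. dct k i j * dct k i' l * real (min j l))
    = (if i = i' then 1 / (4 * (sin (real i / real k * (pi / 2)))\<^sup>2) else 0)"
proof -
  have k: "k \<ge> 1" using i by auto
  let ?s = "\<lambda>i. sin (pi * real i / (2 * real k))"
  have sn: "?s i > 0" if "i \<in> {1..k - 1}" for i
    using that by (intro sin_gt_zero) (auto simp: field_simps)
  have "(\<Sum>j=1..k. \<Sum>l=1..k. dct k i j * dct k i' l * real (min j l))
     = (\<Sum>p=1..k. 2 / k / (4 * ?s i * ?s i') * (sin (pi * i * (real p - 1) / k) * sin (pi * i' * (real p - 1) / k)))"
    unfolding sum_min_eq_sum_tails
  proof (intro sum.cong refl)
    fix p assume p: "p \<in> {1..k}"
    show "(\<Sum>j=p..k. dct k i j) * (\<Sum>j=p..k. dct k i' j) = 2 / k / (4 * ?s i * ?s i') * (sin (pi * i * (real p - 1) / k) * sin (pi * i' * (real p - 1) / k))"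
      unfolding sum_tail_dct[OF i p] sum_tail_dct[OF i' p]
      by (simp only: times_divide_times_eq mult_minus_left mult_minus_right minus_minus minus_divide_left[symmetric]
          sqrt_mult_sqrt_mult[of "2 / real k", simplified]) (simp add: mult_ac)
  qed
  also have "\<dots> = 2 / k / (4 * ?s i * ?s i') * (\<Sum>p=1..k. sin (pi * i * (real p - 1) / k) * sin (pi * i' * (real p - 1) / k))"
    by (rule sum_distrib_left[symmetric])
  \<comment> \<open>After the shift by one, the term at 0 vanishes, which leaves the range
    \<open>1..k - 1\<close> of \<open>sum_cos_multiples\<close>.\<close>
  also have "(\<Sum>p=1..k. sin (pi * i * (real p - 1) / k) * sin (pi * i' * (real p - 1) / k)) = (\<Sum>p<k. sin (pi * i * p / k) * sin (pi * i' * p / k))"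
    by (rule sum.reindex_bij_witness[of _ Suc "\<lambda>p. p - 1"]) auto
  also have "\<dots> = (\<Sum>p=1..k - 1. sin (pi * i * p / k) * sin (pi * i' * p / k))"
    by (intro sum.mono_neutral_cong_right) (auto simp: Suc_le_eq)
  also have "\<dots> = (\<Sum>p=1..k - 1. (1 / 2) * (cos (real p * (pi * real_of_int (int i - int i') / k)) - cos (real p * (pi * real_of_int (int i + int i') / k))))"
  proof (intro sum.cong refl)
    fix p
    have a: "pi * i * p / k - pi * i' * p / k = real p * (pi * real_of_int (int i - int i') / k)"
      using k by (simp add: field_simps)
    have b: "pi * i * p / k + pi * i' * p / k = real p * (pi * real_of_int (int i + int i') / k)"
      using k by (simp add: field_simps)
    show "sin (pi * i * p / k) * sin (pi * i' * p / k) = (1 / 2) * (cos (real p * (pi * real_of_int (int i - int i') / k)) - cos (real p * (pi * real_of_int (int i + int i') / k)))"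
      unfolding sin_times_sin a b by simp
  qed
  also have "\<dots> = (1 / 2) * ((\<Sum>p=1..k - 1. cos (real p * (pi * real_of_int (int i - int i') / k))) - (\<Sum>p=1..k - 1. cos (real p * (pi * real_of_int (int i + int i') / k))))"
    by (simp only: sum_distrib_left sum_subtractf right_diff_distrib)
  also have "\<dots> = (if i = i' then k / 2 else 0)"
  proof -
    have "\<not> 2 * int k dvd int i + int i'" using i i' by (auto dest!: zdvd_imp_le)
    moreover have "\<not> 2 * int k dvd int i - int i'" if "i \<noteq> i'"
    proof
      assume "2 * int k dvd int i - int i'"
      then have "2 * int k \<le> \<bar>int i - int i'\<bar>" using that dvd_imp_le_int[of "int i - int i'" "2 * int k"] by auto
      then show False using i i' by auto
    qed
    ultimately show ?thesis unfolding sum_cos_multiples[OF k] by (auto split: if_splits)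
  qed
  finally show ?thesis using sn[OF i] k
    by (auto simp: power2_eq_square field_simps)
qed

section \<open>A central limit theorem for nested counts\<close>

lemma abs_one_minus_exp_minus_le:
  fixes x :: real
  assumes "x \<ge> 0"
  shows "\<bar>exp (- x) - (1 - x)\<bar> \<le> x\<^sup>2"
proof -
  have "exp (- x) \<le> 1 / (1 + x)"
    using assms exp_ge_add_one_self[of x] by (simp add: exp_minus field_simps)
  also have "\<dots> \<le> 1 - x + x\<^sup>2"
  proof -
    have "(1 - x + x\<^sup>2) * (1 + x) = 1 + x ^ 3" by (simp add: algebra_simps power2_eq_square power3_eq_cube)
    then show ?thesis using assms by (simp add: divide_le_eq)
  qed
  finally show ?thesis using exp_ge_add_one_self[of "- x"] by (simp add: abs_le_iff)
qed

text \<open>Lindeberg's replacement argument. Each factor of the characteristic function is compared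
  with the Gaussian factor \<open>exp (- V / (2 * b^2))\<close>. Since the summands are bounded, the
  relative error is of order \<open>1 / b\<close>, and the total stays small because the summed
  variance converges.\<close>

lemma (in prob_space) char_bounded_triangular_array_tendsto:
  fixes h :: "nat \<Rightarrow> 'i \<Rightarrow> 'a \<Rightarrow> real"
  assumes ind: "\<And>n. indep_vars (\<lambda>_. borel) (h n) (I n)" and fin: "\<And>n. finite (I n)"
    and bnd: "\<And>n i \<omega>. i \<in> I n \<Longrightarrow> \<omega> \<in> space M \<Longrightarrow> \<bar>h n i \<omega>\<bar> \<le> H"
    and mean: "\<And>n i. i \<in> I n \<Longrightarrow> expectation (h n i) = \<mu> n"
    and var: "\<And>n i. i \<in> I n \<Longrightarrow> variance (h n i) = V n"
    and b: "filterlim b at_top sequentially"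
    and lim: "(\<lambda>n. real (card (I n)) * V n / (b n)\<^sup>2) \<longlonglongrightarrow> v"
  shows "(\<lambda>n. CLINT \<omega>|M. iexp (\<Sum>i\<in>I n. (h n i \<omega> - \<mu> n) / b n)) \<longlonglongrightarrow> complex_of_real (exp (- v / 2))"
proof -
  have b0: "\<forall>\<^sub>F n in sequentially. b n > 0" using b by (simp add: filterlim_at_top_dense)
  define x where "x n = V n / (2 * (b n)\<^sup>2)" for n
  define m where "m n = real (card (I n))" for n
  \<comment> \<open>The first term is the third-order Taylor remainder of the characteristic
    function, the second the cost of replacing \<open>1 - x\<close> by \<open>exp (- x)\<close>.
    Both are summed over \<open>I n\<close>.\<close>
  define B where "B n = (\<bar>H\<bar> / 3 / b n + H\<^sup>2 / (4 * (b n)\<^sup>2)) * (m n * V n / (b n)\<^sup>2)" for n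
  have est: "norm ((CLINT \<omega>|M. iexp (\<Sum>i\<in>I n. (h n i \<omega> - \<mu> n) / b n)) - complex_of_real (exp (- (m n * V n / (b n)\<^sup>2) / 2)))
     \<le> B n" if bn: "b n > 0" for n
  \<comment> \<open>Without summands \<open>\<mu> n\<close> and \<open>V n\<close> are arbitrary,
    but the factor \<open>m n\<close> is 0 and both compared quantities are 1.\<close>
  proof (cases "I n = {}")
    case True
    then show ?thesis by (simp add: m_def B_def prob_space)
  next
    case False
    then obtain i0 where i0: "i0 \<in> I n" by auto
    have hm[measurable]: "h n i \<in> borel_measurable M" if "i \<in> I n" for i
      using ind[of n] that by (auto simp: indep_vars_def2)
    have H0: "H \<ge> 0" using bnd[OF i0] not_empty by force
    have hint: "integrable M (h n i)" "integrable M (\<lambda>\<omega>. (h n i \<omega>)\<^sup>2)" if "i \<in> I n" for i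
    proof -
      show "integrable M (h n i)"
        using that bnd[OF that] by (auto intro!: integrable_const_bound[where B=H])
      have "norm ((h n i \<omega>)\<^sup>2) \<le> H\<^sup>2" if "\<omega> \<in> space M" for \<omega>
        using bnd[OF \<open>i \<in> I n\<close> that] power_mono[of "\<bar>h n i \<omega>\<bar>" H 2] by simp
      then show "integrable M (\<lambda>\<omega>. (h n i \<omega>)\<^sup>2)"
        using that by (auto intro!: integrable_const_bound[where B="H\<^sup>2"])
    qed
    have V0: "V n \<ge> 0" using var[OF i0] by (metis variance_positive)
    have VH: "V n \<le> H\<^sup>2"
    proof -
      have "V n = expectation (\<lambda>\<omega>. (h n i0 \<omega>)\<^sup>2) - (expectation (h n i0))\<^sup>2"
        using var[OF i0] hint[OF i0] by (simp add: variance_eq)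
      also have "\<dots> \<le> expectation (\<lambda>\<omega>. (h n i0 \<omega>)\<^sup>2)" by simp
      also have "\<dots> \<le> expectation (\<lambda>\<omega>. H\<^sup>2)"
        using hint[OF i0] bnd[OF i0] H0 by (intro integral_mono) (auto simp: abs_le_square_iff[symmetric] simp del: power2_abs)
      finally show ?thesis by (simp add: prob_space)
    qed
    have \<mu>H: "\<bar>\<mu> n\<bar> \<le> H"
    proof -
      have "\<bar>expectation (h n i0)\<bar> \<le> expectation (\<lambda>\<omega>. \<bar>h n i0 \<omega>\<bar>)" by (rule integral_abs_bound)
      also have "\<dots> \<le> expectation (\<lambda>\<omega>. H)"
        using hint[OF i0] bnd[OF i0] by (intro integral_mono) auto
      finally show ?thesis using mean[OF i0] by (simp add: prob_space)
    qed
    define Y where "Y i \<omega> = (h n i \<omega> - \<mu> n) / b n" for i \<omega>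
    have Ym[measurable]: "Y i \<in> borel_measurable M" if "i \<in> I n" for i
      using that unfolding Y_def by measurable
    have Yb: "\<bar>Y i \<omega>\<bar> \<le> 2 * H / b n" if "i \<in> I n" "\<omega> \<in> space M" for i \<omega>
      using bnd[OF that] \<mu>H bn by (auto simp: Y_def abs_divide intro!: divide_right_mono)
    have Y2: "expectation (\<lambda>\<omega>. (Y i \<omega>)\<^sup>2) = V n / (b n)\<^sup>2" if "i \<in> I n" for i
      using var[OF that] mean[OF that] by (simp add: Y_def power_divide)
    have Yint: "integrable M (Y i)" "integrable M (\<lambda>\<omega>. (Y i \<omega>)\<^sup>2)" if "i \<in> I n" for i
    proof -
      show "integrable M (Y i)" using hint[OF that] by (auto simp: Y_def[abs_def])
      have "(\<lambda>\<omega>. (Y i \<omega>)\<^sup>2) = (\<lambda>\<omega>. ((h n i \<omega>)\<^sup>2 - 2 * \<mu> n * h n i \<omega> + (\<mu> n)\<^sup>2) / (b n)\<^sup>2)"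
        by (auto simp: Y_def power_divide power2_diff)
      then show "integrable M (\<lambda>\<omega>. (Y i \<omega>)\<^sup>2)" using hint[OF that] by auto
    qed
    have Y1: "expectation (Y i) = 0" if "i \<in> I n" for i
      using hint[OF that] mean[OF that] by (simp add: Y_def[abs_def] prob_space)
    let ?\<phi> = "\<lambda>i. char (distr M borel (Y i)) 1"
    have one: "norm (?\<phi> i - complex_of_real (exp (- x n))) \<le> (\<bar>H\<bar> / 3 / b n + H\<^sup>2 / (4 * (b n)\<^sup>2)) * (V n / (b n)\<^sup>2)"
      if i: "i \<in> I n" for i
    proof -
      have "norm (?\<phi> i - (1 - 1\<^sup>2 * (V n / (b n)\<^sup>2) / 2)) \<le> (1\<^sup>2 / 6) * expectation (\<lambda>\<omega>. min (6 * (Y i \<omega>)\<^sup>2) (\<bar>1\<bar> * \<bar>Y i \<omega>\<bar> ^ 3))"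
        using i by (intro char_approx3') (auto simp: Yint Y1 Y2)
      \<comment> \<open>Boundedness trades the cube for a square: one factor
        \<open>\<bar>Y\<bar>\<close> is at most \<open>2 * H / b\<close>.\<close>
      also have "expectation (\<lambda>\<omega>. min (6 * (Y i \<omega>)\<^sup>2) (\<bar>1\<bar> * \<bar>Y i \<omega>\<bar> ^ 3)) \<le> expectation (\<lambda>\<omega>. 2 * H / b n * (Y i \<omega>)\<^sup>2)"
      proof (rule integral_mono)
        show "integrable M (\<lambda>\<omega>. min (6 * (Y i \<omega>)\<^sup>2) (\<bar>1\<bar> * \<bar>Y i \<omega>\<bar> ^ 3))"
          using i by (intro Bochner_Integration.integrable_bound[OF integrable_mult_right[OF Yint(2)[OF i], of 6]])
             (auto simp: min_def)
        show "integrable M (\<lambda>\<omega>. 2 * H / b n * (Y i \<omega>)\<^sup>2)" using Yint(2)[OF i] by simp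
        fix \<omega> assume \<omega>: "\<omega> \<in> space M"
        have "\<bar>Y i \<omega>\<bar> * (Y i \<omega>)\<^sup>2 \<le> 2 * H / b n * (Y i \<omega>)\<^sup>2"
          by (intro mult_right_mono Yb i \<omega>) simp
        moreover have "\<bar>1\<bar> * \<bar>Y i \<omega>\<bar> ^ 3 = \<bar>Y i \<omega>\<bar> * (Y i \<omega>)\<^sup>2"
          by (simp add: power3_eq_cube power2_eq_square)
        ultimately show "min (6 * (Y i \<omega>)\<^sup>2) (\<bar>1\<bar> * \<bar>Y i \<omega>\<bar> ^ 3) \<le> 2 * H / b n * (Y i \<omega>)\<^sup>2"
          by (simp add: min.coboundedI2)
      qed
      also have "\<dots> = 2 * H / b n * (V n / (b n)\<^sup>2)" by (simp add: Y2[OF i])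
      finally have 1: "norm (?\<phi> i - complex_of_real (1 - x n)) \<le> \<bar>H\<bar> / 3 / b n * (V n / (b n)\<^sup>2)"
        using H0 by (simp add: x_def mult.commute)
      have "norm (complex_of_real (exp (- x n)) - complex_of_real (1 - x n)) = \<bar>exp (- x n) - (1 - x n)\<bar>"
        by (metis norm_of_real of_real_diff)
      also have "\<dots> \<le> (x n)\<^sup>2" using V0 by (intro abs_one_minus_exp_minus_le) (simp add: x_def)
      also have "\<dots> = V n / (4 * (b n)\<^sup>2) * (V n / (b n)\<^sup>2)" by (simp add: x_def power2_eq_square)
      also have "\<dots> \<le> H\<^sup>2 / (4 * (b n)\<^sup>2) * (V n / (b n)\<^sup>2)"
        using VH V0 bn by (intro mult_right_mono divide_right_mono) auto
      finally have 2: "norm (complex_of_real (exp (- x n)) - complex_of_real (1 - x n)) \<le> H\<^sup>2 / (4 * (b n)\<^sup>2) * (V n / (b n)\<^sup>2)" .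
      have "norm (?\<phi> i - complex_of_real (exp (- x n)))
          \<le> norm (?\<phi> i - complex_of_real (1 - x n)) + norm (complex_of_real (exp (- x n)) - complex_of_real (1 - x n))"
        using norm_triangle_ineq4[of "?\<phi> i - complex_of_real (1 - x n)" "complex_of_real (exp (- x n)) - complex_of_real (1 - x n)"] by simp
      with 1 2 show ?thesis unfolding distrib_right by linarith
    qed
    have "indep_vars (\<lambda>_. borel) Y (I n)"
      unfolding Y_def by (rule indep_vars_compose2[OF ind]) auto
    then have "char (distr M borel (\<lambda>\<omega>. \<Sum>i\<in>I n. Y i \<omega>)) 1 = (\<Prod>i\<in>I n. ?\<phi> i)"
      by (rule char_distr_sum)
    then have eq: "(CLINT \<omega>|M. iexp (\<Sum>i\<in>I n. (h n i \<omega> - \<mu> n) / b n)) = (\<Prod>i\<in>I n. ?\<phi> i)"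
      by (simp add: char_def integral_distr Y_def)
    have "complex_of_real (exp (- (m n * V n / (b n)\<^sup>2) / 2)) = (\<Prod>i\<in>I n. complex_of_real (exp (- x n)))"
      by (simp add: m_def x_def flip: of_real_power exp_of_nat_mult)
    \<comment> \<open>All factors lie in the closed unit disc, so the difference of the products is
      at most the sum of the differences of the factors.\<close>
    moreover have "norm ((\<Prod>i\<in>I n. ?\<phi> i) - (\<Prod>i\<in>I n. complex_of_real (exp (- x n)))) \<le> (\<Sum>i\<in>I n. norm (?\<phi> i - complex_of_real (exp (- x n))))"
    proof (rule norm_prod_diff)
      show "norm (?\<phi> i) \<le> 1" if "i \<in> I n" for i
        using that by (intro real_distribution.cmod_char_le_1) auto
      show "norm (complex_of_real (exp (- x n))) \<le> 1" using V0 by (simp add: x_def)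
    qed
    moreover have "\<dots> \<le> (\<Sum>i\<in>I n. (\<bar>H\<bar> / 3 / b n + H\<^sup>2 / (4 * (b n)\<^sup>2)) * (V n / (b n)\<^sup>2))"
      by (intro sum_mono one)
    moreover have "\<dots> = B n" by (simp add: B_def m_def)
    ultimately show ?thesis unfolding eq by simp
  qed
  have "(\<lambda>n. 1 / b n) \<longlonglongrightarrow> 0" by (rule real_tendsto_divide_at_top[OF tendsto_const b])
  then have "(\<lambda>n. (\<bar>H\<bar> / 3 * (1 / b n) + H\<^sup>2 / 4 * (1 / b n)\<^sup>2) * (m n * V n / (b n)\<^sup>2))
      \<longlonglongrightarrow> (\<bar>H\<bar> / 3 * 0 + H\<^sup>2 / 4 * 0\<^sup>2) * v"
    unfolding m_def by (intro tendsto_mult tendsto_add tendsto_const tendsto_power lim)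
  then have "B \<longlonglongrightarrow> 0" by (simp add: B_def[abs_def] power_divide)
  moreover have "\<forall>\<^sub>F n in sequentially. norm ((CLINT \<omega>|M. iexp (\<Sum>i\<in>I n. (h n i \<omega> - \<mu> n) / b n)) - complex_of_real (exp (- (m n * V n / (b n)\<^sup>2) / 2))) \<le> B n"
    using b0 by eventually_elim (rule est)
  ultimately have "(\<lambda>n. (CLINT \<omega>|M. iexp (\<Sum>i\<in>I n. (h n i \<omega> - \<mu> n) / b n)) - complex_of_real (exp (- (m n * V n / (b n)\<^sup>2) / 2))) \<longlonglongrightarrow> 0"
    by (rule Lim_null_comparison[rotated])
  moreover have "(\<lambda>n. complex_of_real (exp (- (m n * V n / (b n)\<^sup>2) / 2))) \<longlonglongrightarrow> complex_of_real (exp (- v / 2))"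
    unfolding m_def by (intro tendsto_intros lim) auto
  ultimately show ?thesis by (rule Lim_transform[rotated])
qed

text \<open>For nested sets a product of indicators is the indicator of the set with the larger
  index. Mixed second moments are therefore \<open>p n (max j l)\<close>, and the weights
  \<open>j * l\<close> turn the limit \<open>1 / max j l\<close> into
  \<open>min j l\<close>.\<close>

lemma (in prob_space) char_nested_counts_tendsto:
  fixes X :: "'i \<Rightarrow> 'a \<Rightarrow> 'x::topological_space" and A :: "nat \<Rightarrow> nat \<Rightarrow> 'x set"
    and p :: "nat \<Rightarrow> nat \<Rightarrow> real" and c :: "nat \<Rightarrow> real"
  assumes ind: "\<And>n. indep_vars (\<lambda>_. borel) X (I n)" and fin: "\<And>n. finite (I n)"
    and A[measurable]: "\<And>n j. A n j \<in> sets borel"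
    and nested: "\<And>n j l. 1 \<le> j \<Longrightarrow> j \<le> l \<Longrightarrow> l \<le> k \<Longrightarrow> A n l \<subseteq> A n j"
    and p: "\<And>n i j. i \<in> I n \<Longrightarrow> j \<in> {1..k} \<Longrightarrow> prob {\<omega> \<in> space M. X i \<omega> \<in> A n j} = p n j"
    and c0: "c \<longlonglongrightarrow> 0"
    and plim: "\<And>j. j \<in> {1..k} \<Longrightarrow> (\<lambda>n. p n j / c n) \<longlonglongrightarrow> 1 / j"
    and mc: "filterlim (\<lambda>n. real (card (I n)) * c n) at_top sequentially"
  shows "(\<lambda>n. CLINT \<omega>|M. iexp (\<Sum>j=1..k. a j * (j * ((\<Sum>i\<in>I n. indicator (A n j) (X i \<omega>)) - card (I n) * p n j)
        / sqrt (card (I n) * c n))))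
     \<longlonglongrightarrow> complex_of_real (exp (- (\<Sum>j=1..k. \<Sum>l=1..k. a j * a l * real (min j l)) / 2))"
proof -
  define h where "h n i \<omega> = (\<Sum>j=1..k. a j * j * indicator (A n j) (X i \<omega>))" for n i \<omega>
  define \<mu> where "\<mu> n = (\<Sum>j=1..k. a j * j * p n j)" for n
  define S where "S n = (\<Sum>j=1..k. \<Sum>l=1..k. a j * a l * (j * l) * p n (max j l))" for n
  define b where "b n = sqrt (card (I n) * c n)" for n
  have c00: "\<forall>\<^sub>F n in sequentially. c n > 0"
  proof -
    have "\<forall>\<^sub>F n in sequentially. real (card (I n)) * c n > 0"
      using mc by (simp add: filterlim_at_top_dense)
    then show ?thesis by eventually_elim (auto simp: zero_less_mult_iff)
  qed
  have X[measurable]: "X i \<in> borel_measurable M" if "i \<in> I n" for i n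
    using ind[of n] that by (auto simp: indep_vars_def2)
  have E1: "expectation (\<lambda>\<omega>. indicator (A n j) (X i \<omega>)) = p n j" if "i \<in> I n" "j \<in> {1..k}" for n i j
  proof -
    have "expectation (\<lambda>\<omega>. indicat_real (A n j) (X i \<omega>)) = expectation (indicat_real {\<omega> \<in> space M. X i \<omega> \<in> A n j})"
      by (intro Bochner_Integration.integral_cong) (auto split: split_indicator)
    then show ?thesis using p[OF that] that(1) by simp
  qed
  have ii: "integrable M (\<lambda>\<omega>. indicator (A n j) (X i \<omega>) :: real)" if "i \<in> I n" for n i j
    using that by (intro integrable_const_bound[where B=1]) auto
  have E2: "expectation (\<lambda>\<omega>. indicator (A n j) (X i \<omega>) * indicator (A n l) (X i \<omega>)) = p n (max j l)"
    if "i \<in> I n" "j \<in> {1..k}" "l \<in> {1..k}" for n i j l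
  proof -
    have "indicator (A n j) x * indicator (A n l) x = (indicator (A n (max j l)) x :: real)" for x
      using nested[of j l n] nested[of l j n] that by (cases "j \<le> l") (auto split: split_indicator)
    moreover have "max j l \<in> {1..k}" using that by auto
    ultimately show ?thesis using E1[OF that(1)] by simp
  qed
  have hh: "(h n i \<omega>)\<^sup>2 = (\<Sum>j=1..k. \<Sum>l=1..k. a j * a l * (j * l) * (indicator (A n j) (X i \<omega>) * indicator (A n l) (X i \<omega>)))" for n i \<omega>
    unfolding h_def power2_eq_square sum_product by (simp add: mult_ac)
  have i2: "integrable M (\<lambda>\<omega>. indicator (A n j) (X i \<omega>) * indicator (A n l) (X i \<omega>) :: real)" if "i \<in> I n" for n i j l
    using that by (intro integrable_const_bound[where B=1]) (auto split: split_indicator)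
  have hmean: "expectation (h n i) = \<mu> n" if "i \<in> I n" for n i
    unfolding h_def[abs_def] \<mu>_def using that by (subst Bochner_Integration.integral_sum) (auto simp: ii E1)
  have hvar: "variance (h n i) = S n - (\<mu> n)\<^sup>2" if i: "i \<in> I n" for n i
  proof -
    have "expectation (\<lambda>\<omega>. (h n i \<omega>)\<^sup>2) = S n"
      unfolding hh S_def using i by (simp add: Bochner_Integration.integral_sum i2 E2)
    moreover have "integrable M (h n i)"
      unfolding h_def[abs_def] using i by (intro Bochner_Integration.integrable_sum integrable_mult_right ii)
    moreover have "integrable M (\<lambda>\<omega>. (h n i \<omega>)\<^sup>2)"
      unfolding hh using i by (intro Bochner_Integration.integrable_sum integrable_mult_right i2)
    ultimately show ?thesis using hmean[OF i] variance_eq[of "h n i"] by simp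
  qed
  have lim: "(\<lambda>n. (S n - (\<mu> n)\<^sup>2) / c n) \<longlonglongrightarrow> (\<Sum>j=1..k. \<Sum>l=1..k. a j * a l * real (min j l))"
  proof -
    \<comment> \<open>The variance over \<open>c n\<close> is split into the scaled second moment
      and \<open>c n\<close> times the square of the scaled mean. The latter vanishes because
      \<open>c\<close> tends to 0.\<close>
    have "(\<lambda>n. (\<Sum>j=1..k. \<Sum>l=1..k. a j * a l * (j * l) * (p n (max j l) / c n)) - c n * (\<Sum>j=1..k. a j * j * (p n j / c n))\<^sup>2)
       \<longlonglongrightarrow> (\<Sum>j=1..k. \<Sum>l=1..k. a j * a l * (j * l) * (1 / real (max j l))) - 0 * (\<Sum>j=1..k. a j * j * (1 / j))\<^sup>2"
      by (intro tendsto_intros plim c0) auto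
    also have "(\<Sum>j=1..k. \<Sum>l=1..k. a j * a l * (j * l) * (1 / real (max j l))) - 0 * (\<Sum>j=1..k. a j * j * (1 / j))\<^sup>2
        = (\<Sum>j=1..k. \<Sum>l=1..k. a j * a l * real (min j l))"
      by simp (intro sum.cong refl, auto simp: min_def max_def)
    finally show ?thesis
    proof (rule Lim_transform_eventually)
      show "\<forall>\<^sub>F n in sequentially. (\<Sum>j=1..k. \<Sum>l=1..k. a j * a l * (j * l) * (p n (max j l) / c n)) - c n * (\<Sum>j=1..k. a j * j * (p n j / c n))\<^sup>2
         = (S n - (\<mu> n)\<^sup>2) / c n"
        using c00
      proof eventually_elim
        case (elim n)
        have "c n * (\<Sum>j=1..k. a j * j * (p n j / c n))\<^sup>2 = (\<mu> n)\<^sup>2 / c n"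
          using elim by (simp add: \<mu>_def power2_eq_square flip: sum_divide_distrib)
        moreover have "(\<Sum>j=1..k. \<Sum>l=1..k. a j * a l * (j * l) * (p n (max j l) / c n)) = S n / c n"
          by (simp add: S_def sum_divide_distrib)
        ultimately show ?case by (simp add: diff_divide_distrib)
      qed
    qed
  qed
  have "(\<lambda>n. CLINT \<omega>|M. iexp (\<Sum>i\<in>I n. (h n i \<omega> - \<mu> n) / b n)) \<longlonglongrightarrow>
    complex_of_real (exp (- (\<Sum>j=1..k. \<Sum>l=1..k. a j * a l * real (min j l)) / 2))"
  proof (rule char_bounded_triangular_array_tendsto[where H="\<Sum>j=1..k. \<bar>a j\<bar> * j" and V="\<lambda>n. S n - (\<mu> n)\<^sup>2"])
    show "indep_vars (\<lambda>_. borel) (h n) (I n)" for n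
      unfolding h_def[abs_def] by (rule indep_vars_compose2[OF ind]) measurable
    show "\<bar>h n i \<omega>\<bar> \<le> (\<Sum>j=1..k. \<bar>a j\<bar> * j)" for n i \<omega>
    proof -
      have "\<bar>a j * j * indicator (A n j) (X i \<omega>)\<bar> \<le> \<bar>a j\<bar> * j" for j
        by (auto simp: abs_mult split: split_indicator)
      then show ?thesis unfolding h_def by (intro order.trans[OF sum_abs] sum_mono)
    qed
    show "filterlim b at_top sequentially"
      unfolding b_def by (rule filterlim_compose[OF sqrt_at_top mc])
    show "(\<lambda>n. real (card (I n)) * (S n - (\<mu> n)\<^sup>2) / (b n)\<^sup>2) \<longlonglongrightarrow> (\<Sum>j=1..k. \<Sum>l=1..k. a j * a l * real (min j l))"
      using lim
    proof (rule Lim_transform_eventually)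
      have "\<forall>\<^sub>F n in sequentially. real (card (I n)) * c n > 0"
        using mc by (simp add: filterlim_at_top_dense)
      then show "\<forall>\<^sub>F n in sequentially. (S n - (\<mu> n)\<^sup>2) / c n = real (card (I n)) * (S n - (\<mu> n)\<^sup>2) / (b n)\<^sup>2"
        by eventually_elim (auto simp: b_def zero_less_mult_iff)
    qed
    show "variance (h n i) = S n - (\<mu> n)\<^sup>2" if "i \<in> I n" for n i using that by (rule hvar)
  qed (auto simp: fin hmean)
  moreover have "(\<Sum>i\<in>I n. (h n i \<omega> - \<mu> n) / b n) = (\<Sum>j=1..k. a j * (j * ((\<Sum>i\<in>I n. indicator (A n j) (X i \<omega>)) - card (I n) * p n j)
        / sqrt (card (I n) * c n)))" for n \<omega>
  proof -
    have "(\<Sum>i\<in>I n. h n i \<omega>) = (\<Sum>j=1..k. \<Sum>i\<in>I n. a j * j * indicator (A n j) (X i \<omega>))"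
      unfolding h_def by (rule sum.swap)
    then have "(\<Sum>i\<in>I n. (h n i \<omega> - \<mu> n) / b n)
       = ((\<Sum>j=1..k. a j * j * (\<Sum>i\<in>I n. indicator (A n j) (X i \<omega>))) - card (I n) * (\<Sum>j=1..k. a j * j * p n j)) / b n"
      by (simp add: sum_subtractf sum_distrib_left \<mu>_def flip: sum_divide_distrib)
    also have "\<dots> = (\<Sum>j=1..k. a j * (j * ((\<Sum>i\<in>I n. indicator (A n j) (X i \<omega>)) - card (I n) * p n j) / b n))"
      unfolding sum_distrib_left sum_subtractf[symmetric] sum_divide_distrib
      by (intro sum.cong refl) (simp add: algebra_simps sum_distrib_left)
    finally show ?thesis by (simp only: b_def)
  qed
  ultimately show ?thesis by simp
qed

section \<open>Deviations and convergence in probability\<close>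

text \<open>The square is expanded into products of centred indicators. These are pairwise
  uncorrelated by independence, so the diagonal terms \<open>p * (1 - p)\<close> remain.\<close>

lemma (in prob_space) binomial_variance:
  fixes X :: "'i \<Rightarrow> 'a \<Rightarrow> 'x::topological_space" and p :: real
  assumes ind: "indep_vars (\<lambda>_. borel) X J" and J: "finite J" and A[measurable]: "A \<in> sets borel"
    and p: "\<And>i. i \<in> J \<Longrightarrow> prob {\<omega> \<in> space M. X i \<omega> \<in> A} = p"
  shows "integrable M (\<lambda>\<omega>. ((\<Sum>i\<in>J. indicator A (X i \<omega>)) - card J * p)\<^sup>2)"
    and "expectation (\<lambda>\<omega>. ((\<Sum>i\<in>J. indicator A (X i \<omega>)) - card J * p)\<^sup>2) = card J * (p * (1 - p))"
proof -
  have X[measurable]: "X i \<in> borel_measurable M" if "i \<in> J" for i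
    using ind that by (auto simp: indep_vars_def2)
  define Y where "Y i \<omega> = indicator A (X i \<omega>) - p" for i \<omega>
  have ii: "integrable M (\<lambda>\<omega>. indicat_real A (X i \<omega>))" if "i \<in> J" for i
    using that by (intro integrable_const_bound[where B=1]) auto
  have Ei: "expectation (\<lambda>\<omega>. indicat_real A (X i \<omega>)) = p" if "i \<in> J" for i
  proof -
    have "expectation (\<lambda>\<omega>. indicat_real A (X i \<omega>)) = expectation (indicat_real {\<omega> \<in> space M. X i \<omega> \<in> A})"
      by (intro Bochner_Integration.integral_cong) (auto split: split_indicator)
    then show ?thesis using p[OF that] that by simp
  qed
  have EY: "expectation (Y i) = 0" if "i \<in> J" for i
    using ii[OF that] Ei[OF that] by (simp add: Y_def[abs_def] prob_space)
  have iY: "integrable M (Y i)" if "i \<in> J" for i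
    using ii[OF that] by (simp add: Y_def[abs_def])
  have Yind: "indep_vars (\<lambda>_. borel) Y J"
    unfolding Y_def by (rule indep_vars_compose2[OF ind]) measurable
  have Ysq: "(\<lambda>\<omega>. Y i \<omega> * Y i \<omega>) = (\<lambda>\<omega>. (1 - 2 * p) * indicat_real A (X i \<omega>) + p\<^sup>2)" for i
    by (auto simp: Y_def power2_eq_square algebra_simps split: split_indicator)
  have YY: "integrable M (\<lambda>\<omega>. Y i \<omega> * Y j \<omega>) \<and> expectation (\<lambda>\<omega>. Y i \<omega> * Y j \<omega>) = (if i = j then p * (1 - p) else 0)"
    if "i \<in> J" "j \<in> J" for i j
  proof (cases "i = j")
    case True
    then show ?thesis using that
      by (simp add: Ysq ii Ei prob_space) (simp add: power2_eq_square algebra_simps)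
  next
    case False
    have "indep_vars (\<lambda>_. borel) Y {i, j}"
      by (rule indep_vars_subset[OF Yind]) (use that in auto)
    then have "expectation (\<lambda>\<omega>. \<Prod>l\<in>{i, j}. Y l \<omega>) = (\<Prod>l\<in>{i, j}. expectation (Y l))"
      "integrable M (\<lambda>\<omega>. \<Prod>l\<in>{i, j}. Y l \<omega>)"
      using that iY by (auto intro!: indep_vars_lebesgue_integral indep_vars_integrable)
    then show ?thesis using False that EY by simp
  qed
  have sq: "((\<Sum>i\<in>J. indicator A (X i \<omega>)) - card J * p)\<^sup>2 = (\<Sum>i\<in>J. \<Sum>j\<in>J. Y i \<omega> * Y j \<omega>)" for \<omega>
  proof -
    have "(\<Sum>i\<in>J. indicator A (X i \<omega>)) - card J * p = (\<Sum>i\<in>J. Y i \<omega>)"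
      by (simp add: Y_def sum_subtractf)
    then show ?thesis by (simp only: power2_eq_square sum_product)
  qed
  show "integrable M (\<lambda>\<omega>. ((\<Sum>i\<in>J. indicator A (X i \<omega>)) - card J * p)\<^sup>2)"
    unfolding sq by (intro Bochner_Integration.integrable_sum) (simp add: YY)
  have "expectation (\<lambda>\<omega>. ((\<Sum>i\<in>J. indicator A (X i \<omega>)) - card J * p)\<^sup>2)
      = (\<Sum>i\<in>J. \<Sum>j\<in>J. if i = j then p * (1 - p) else 0)"
    unfolding sq using YY by (simp add: Bochner_Integration.integral_sum)
  also have "\<dots> = card J * (p * (1 - p))" using J by simp
  finally show "expectation (\<lambda>\<omega>. ((\<Sum>i\<in>J. indicator A (X i \<omega>)) - card J * p)\<^sup>2) = card J * (p * (1 - p))" .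
qed

lemma (in prob_space) binomial_deviation:
  fixes X :: "'i \<Rightarrow> 'a \<Rightarrow> 'x::topological_space" and p :: real
  assumes ind: "indep_vars (\<lambda>_. borel) X J" and J: "finite J" and A[measurable]: "A \<in> sets borel"
    and p: "\<And>i. i \<in> J \<Longrightarrow> prob {\<omega> \<in> space M. X i \<omega> \<in> A} = p" and a: "a > 0"
  shows "prob {\<omega> \<in> space M. \<bar>(\<Sum>i\<in>J. indicator A (X i \<omega>)) - card J * p\<bar> \<ge> a} \<le> card J * (p * (1 - p)) / a\<^sup>2"
proof -
  have [measurable]: "X i \<in> borel_measurable M" if "i \<in> J" for i
    using ind that by (auto simp: indep_vars_def2)
  show ?thesis
    using second_moment_method[OF _ binomial_variance(1)[OF ind J A p] a]
    by (simp add: binomial_variance(2)[OF ind J A p])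
qed

section \<open>Calculus of stochastic orders \<open>o_P(1)\<close> and \<open>O_P(1)\<close>\<close>

definition (in prob_space) vanishes_in_prob :: "(nat \<Rightarrow> 'a \<Rightarrow> real) \<Rightarrow> bool" where
  "vanishes_in_prob f \<longleftrightarrow> (\<forall>n. f n \<in> borel_measurable M) \<and>
     (\<forall>\<epsilon>>0. (\<lambda>n. prob {\<omega> \<in> space M. \<bar>f n \<omega>\<bar> > \<epsilon>}) \<longlonglongrightarrow> 0)"

text \<open>Stochastic boundedness, with the bound asked for at large \<open>n\<close>.
  Measurability is built in so that the probabilities are those of events.\<close>

definition (in prob_space) tight_seq :: "(nat \<Rightarrow> 'a \<Rightarrow> real) \<Rightarrow> bool" where
  "tight_seq f \<longleftrightarrow> (\<forall>n. f n \<in> borel_measurable M) \<and>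
     (\<forall>\<epsilon>>0. \<exists>K. \<forall>\<^sub>F n in sequentially. prob {\<omega> \<in> space M. \<bar>f n \<omega>\<bar> > K} \<le> \<epsilon>)"

context prob_space
begin

lemma vanishes_in_prob_measurable: "vanishes_in_prob f \<Longrightarrow> f n \<in> borel_measurable M"
  and tight_seq_measurable: "tight_seq f \<Longrightarrow> f n \<in> borel_measurable M"
  by (auto simp: vanishes_in_prob_def tight_seq_def)

lemma vanishes_in_probI:
  assumes "\<And>n. f n \<in> borel_measurable M"
    and "\<And>\<epsilon>. \<epsilon> > 0 \<Longrightarrow> \<exists>g. g \<longlonglongrightarrow> 0 \<and> (\<forall>\<^sub>F n in sequentially. prob {\<omega> \<in> space M. \<bar>f n \<omega>\<bar> > \<epsilon>} \<le> g n)"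
  shows "vanishes_in_prob f"
  unfolding vanishes_in_prob_def
proof (intro conjI allI impI assms)
  fix \<epsilon> :: real assume "\<epsilon> > 0"
  from assms(2)[OF this] obtain g where g: "g \<longlonglongrightarrow> 0" "\<forall>\<^sub>F n in sequentially. prob {\<omega> \<in> space M. \<bar>f n \<omega>\<bar> > \<epsilon>} \<le> g n"
    by auto
  show "(\<lambda>n. prob {\<omega> \<in> space M. \<bar>f n \<omega>\<bar> > \<epsilon>}) \<longlonglongrightarrow> 0"
    by (rule tendsto_sandwich[OF _ g(2) tendsto_const g(1)]) simp
qed

text \<open>The comparison is required where \<open>h\<close> is small, an event whose probability
  tends to 1. It is meant for quotients whose denominator is bounded away from 0 on such an
  event.\<close>

lemma vanishes_in_prob_dominated:
  assumes g: "vanishes_in_prob g" and h: "vanishes_in_prob h" and f[measurable]: "\<And>n. f n \<in> borel_measurable M"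
    and a: "a > 0"
    and le: "\<And>n \<omega>. \<omega> \<in> space M \<Longrightarrow> \<bar>h n \<omega>\<bar> \<le> a \<Longrightarrow> \<bar>f n \<omega>\<bar> \<le> \<bar>g n \<omega>\<bar>"
  shows "vanishes_in_prob f"
proof (rule vanishes_in_probI[OF f])
  fix \<epsilon> :: real assume e: "\<epsilon> > 0"
  have [measurable]: "g n \<in> borel_measurable M" "h n \<in> borel_measurable M" for n
    using g h by (auto simp: vanishes_in_prob_measurable)
  have "(\<lambda>n. prob {\<omega> \<in> space M. \<bar>g n \<omega>\<bar> > \<epsilon>} + prob {\<omega> \<in> space M. \<bar>h n \<omega>\<bar> > a}) \<longlonglongrightarrow> 0 + 0"
    using g h e a by (intro tendsto_add) (auto simp: vanishes_in_prob_def)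
  moreover have "prob {\<omega> \<in> space M. \<bar>f n \<omega>\<bar> > \<epsilon>} \<le> prob {\<omega> \<in> space M. \<bar>g n \<omega>\<bar> > \<epsilon>} + prob {\<omega> \<in> space M. \<bar>h n \<omega>\<bar> > a}" for n
  proof -
    have "prob {\<omega> \<in> space M. \<bar>f n \<omega>\<bar> > \<epsilon>} \<le> prob ({\<omega> \<in> space M. \<bar>g n \<omega>\<bar> > \<epsilon>} \<union> {\<omega> \<in> space M. \<bar>h n \<omega>\<bar> > a})"
    proof (intro finite_measure_mono subsetI)
      fix \<omega> assume "\<omega> \<in> {\<omega> \<in> space M. \<bar>f n \<omega>\<bar> > \<epsilon>}"
      then show "\<omega> \<in> {\<omega> \<in> space M. \<bar>g n \<omega>\<bar> > \<epsilon>} \<union> {\<omega> \<in> space M. \<bar>h n \<omega>\<bar> > a}"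
        using le[of \<omega> n] by (cases "\<bar>h n \<omega>\<bar> \<le> a") auto
    qed measurable
    also have "\<dots> \<le> prob {\<omega> \<in> space M. \<bar>g n \<omega>\<bar> > \<epsilon>} + prob {\<omega> \<in> space M. \<bar>h n \<omega>\<bar> > a}"
      by (intro measure_Un_le) measurable
    finally show ?thesis .
  qed
  ultimately show "\<exists>g'. g' \<longlonglongrightarrow> 0 \<and> (\<forall>\<^sub>F n in sequentially. prob {\<omega> \<in> space M. \<bar>f n \<omega>\<bar> > \<epsilon>} \<le> g' n)"
    by (intro exI[of _ "\<lambda>n. prob {\<omega> \<in> space M. \<bar>g n \<omega>\<bar> > \<epsilon>} + prob {\<omega> \<in> space M. \<bar>h n \<omega>\<bar> > a}"]) auto
qed

lemma vanishes_in_prob_add: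
  assumes f: "vanishes_in_prob f" and g: "vanishes_in_prob g"
  shows "vanishes_in_prob (\<lambda>n \<omega>. f n \<omega> + g n \<omega>)"
proof (rule vanishes_in_probI)
  have [measurable]: "g n \<in> borel_measurable M" "f n \<in> borel_measurable M" for n
    using g f by (auto simp: vanishes_in_prob_measurable)
  show "(\<lambda>\<omega>. f n \<omega> + g n \<omega>) \<in> borel_measurable M" for n by measurable
  fix \<epsilon> :: real assume e: "\<epsilon> > 0"
  let ?B = "\<lambda>n. prob {\<omega> \<in> space M. \<bar>f n \<omega>\<bar> > \<epsilon> / 2} + prob {\<omega> \<in> space M. \<bar>g n \<omega>\<bar> > \<epsilon> / 2}"
  have "?B \<longlonglongrightarrow> 0 + 0"
    using f g half_gt_zero[OF e] unfolding vanishes_in_prob_def by (intro tendsto_add) blast+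
  moreover have "prob {\<omega> \<in> space M. \<bar>f n \<omega> + g n \<omega>\<bar> > \<epsilon>} \<le> ?B n" for n
  proof -
    have "prob {\<omega> \<in> space M. \<bar>f n \<omega> + g n \<omega>\<bar> > \<epsilon>} \<le> prob ({\<omega> \<in> space M. \<bar>f n \<omega>\<bar> > \<epsilon> / 2} \<union> {\<omega> \<in> space M. \<bar>g n \<omega>\<bar> > \<epsilon> / 2})"
      by (intro finite_measure_mono) auto
    also have "\<dots> \<le> ?B n" by (intro measure_Un_le) measurable
    finally show ?thesis .
  qed
  ultimately show "\<exists>h. h \<longlonglongrightarrow> 0 \<and> (\<forall>\<^sub>F n in sequentially. prob {\<omega> \<in> space M. \<bar>f n \<omega> + g n \<omega>\<bar> > \<epsilon>} \<le> h n)"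
    by (intro exI[of _ ?B]) auto
qed

lemma vanishes_in_prob_const:
  assumes "x \<longlonglongrightarrow> 0"
  shows "vanishes_in_prob (\<lambda>n \<omega>. x n)"
proof (rule vanishes_in_probI)
  fix \<epsilon> :: real assume "\<epsilon> > 0"
  then have "\<forall>\<^sub>F n in sequentially. \<bar>x n\<bar> < \<epsilon>"
    using assms by (auto simp: tendsto_iff dist_real_def)
  then have "\<forall>\<^sub>F n in sequentially. prob {\<omega> \<in> space M. \<bar>x n\<bar> > \<epsilon>} \<le> 0"
    by eventually_elim simp
  then show "\<exists>g. g \<longlonglongrightarrow> 0 \<and> (\<forall>\<^sub>F n in sequentially. prob {\<omega> \<in> space M. \<bar>x n\<bar> > \<epsilon>} \<le> g n)"
    by (intro exI[of _ "\<lambda>_. 0"]) auto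
qed simp

lemma vanishes_in_prob_sum:
  assumes "\<And>j. j \<in> J \<Longrightarrow> vanishes_in_prob (f j)"
  shows "vanishes_in_prob (\<lambda>n \<omega>. \<Sum>j\<in>J. f j n \<omega>)"
  using assms by (induction J rule: infinite_finite_induct) (auto intro: vanishes_in_prob_add vanishes_in_prob_const)

text \<open>The rule \<open>O_P(1) * o_P(1) = o_P(1)\<close>: for the product to exceed
  \<open>\<epsilon>\<close>, either the tight factor exceeds \<open>K\<close> or the other one
  exceeds \<open>\<epsilon> / K\<close>.\<close>

lemma tight_seq_mult_vanishes:
  assumes f: "tight_seq f" and g: "vanishes_in_prob g"
  shows "vanishes_in_prob (\<lambda>n \<omega>. f n \<omega> * g n \<omega>)"
  unfolding vanishes_in_prob_def
proof (intro conjI allI impI)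
  have [measurable]: "g n \<in> borel_measurable M" "f n \<in> borel_measurable M" for n
    using g f by (auto simp: vanishes_in_prob_measurable tight_seq_measurable)
  show "(\<lambda>\<omega>. f n \<omega> * g n \<omega>) \<in> borel_measurable M" for n by measurable
  fix \<epsilon> :: real assume e: "\<epsilon> > 0"
  show "(\<lambda>n. prob {\<omega> \<in> space M. \<bar>f n \<omega> * g n \<omega>\<bar> > \<epsilon>}) \<longlonglongrightarrow> 0"
    unfolding tendsto_iff
  proof (intro allI impI)
    fix \<eta> :: real assume \<eta>: "\<eta> > 0"
    then obtain K0 where K0: "\<forall>\<^sub>F n in sequentially. prob {\<omega> \<in> space M. \<bar>f n \<omega>\<bar> > K0} \<le> \<eta> / 2"
      using f unfolding tight_seq_def by (meson half_gt_zero)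
    \<comment> \<open>The maximum with 1 keeps \<open>K\<close> positive, so that
      \<open>\<epsilon> / K\<close> is a valid threshold.\<close>
    define K where "K = max K0 1"
    have "(\<lambda>n. prob {\<omega> \<in> space M. \<bar>g n \<omega>\<bar> > \<epsilon> / K}) \<longlonglongrightarrow> 0"
      using g e by (auto simp: vanishes_in_prob_def K_def)
    then have "\<forall>\<^sub>F n in sequentially. prob {\<omega> \<in> space M. \<bar>g n \<omega>\<bar> > \<epsilon> / K} < \<eta> / 2"
      using \<eta> by (intro order_tendstoD) auto
    with K0 show "\<forall>\<^sub>F n in sequentially. dist (prob {\<omega> \<in> space M. \<bar>f n \<omega> * g n \<omega>\<bar> > \<epsilon>}) 0 < \<eta>"
    proof eventually_elim
      case (elim n)
      have "prob {\<omega> \<in> space M. \<bar>f n \<omega> * g n \<omega>\<bar> > \<epsilon>} \<le> prob ({\<omega> \<in> space M. \<bar>f n \<omega>\<bar> > K0} \<union> {\<omega> \<in> space M. \<bar>g n \<omega>\<bar> > \<epsilon> / K})"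
      proof (intro finite_measure_mono subsetI)
        fix \<omega> assume \<omega>: "\<omega> \<in> {\<omega> \<in> space M. \<bar>f n \<omega> * g n \<omega>\<bar> > \<epsilon>}"
        have "\<bar>f n \<omega> * g n \<omega>\<bar> \<le> K * (\<epsilon> / K)" if "\<bar>f n \<omega>\<bar> \<le> K0" "\<bar>g n \<omega>\<bar> \<le> \<epsilon> / K"
          unfolding abs_mult using that by (intro mult_mono) (auto simp: K_def)
        moreover have "K * (\<epsilon> / K) = \<epsilon>" by (simp add: K_def)
        ultimately show "\<omega> \<in> {\<omega> \<in> space M. \<bar>f n \<omega>\<bar> > K0} \<union> {\<omega> \<in> space M. \<bar>g n \<omega>\<bar> > \<epsilon> / K}"
          using \<omega> by force
      qed measurable
      also have "\<dots> \<le> prob {\<omega> \<in> space M. \<bar>f n \<omega>\<bar> > K0} + prob {\<omega> \<in> space M. \<bar>g n \<omega>\<bar> > \<epsilon> / K}"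
        by (intro measure_Un_le) measurable
      finally show ?case using elim by simp
    qed
  qed
qed

lemma tight_seq_const: "tight_seq (\<lambda>n \<omega>. x)"
  unfolding tight_seq_def by (intro conjI allI impI exI[of _ "\<bar>x\<bar>"]) auto

lemma vanishes_in_prob_cmult: "vanishes_in_prob f \<Longrightarrow> vanishes_in_prob (\<lambda>n \<omega>. x * f n \<omega>)"
  using tight_seq_mult_vanishes[OF tight_seq_const] .

lemma vanishes_in_prob_imp_tight_seq:
  assumes "vanishes_in_prob f"
  shows "tight_seq f"
  unfolding tight_seq_def
proof (intro conjI allI impI vanishes_in_prob_measurable[OF assms] exI[of _ 1])
  fix \<epsilon> :: real assume "\<epsilon> > 0"
  moreover have "(\<lambda>n. prob {\<omega> \<in> space M. \<bar>f n \<omega>\<bar> > 1}) \<longlonglongrightarrow> 0" using assms by (auto simp: vanishes_in_prob_def)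
  ultimately have "\<forall>\<^sub>F n in sequentially. prob {\<omega> \<in> space M. \<bar>f n \<omega>\<bar> > 1} < \<epsilon>"
    by (intro order_tendstoD)
  then show "\<forall>\<^sub>F n in sequentially. prob {\<omega> \<in> space M. \<bar>f n \<omega>\<bar> > 1} \<le> \<epsilon>"
    by eventually_elim simp
qed

lemma tight_seq_add:
  assumes f: "tight_seq f" and g: "tight_seq g"
  shows "tight_seq (\<lambda>n \<omega>. f n \<omega> + g n \<omega>)"
  unfolding tight_seq_def
proof (intro conjI allI impI)
  have [measurable]: "g n \<in> borel_measurable M" "f n \<in> borel_measurable M" for n
    using g f by (auto simp: tight_seq_measurable)
  show "(\<lambda>\<omega>. f n \<omega> + g n \<omega>) \<in> borel_measurable M" for n by measurable
  fix \<epsilon> :: real assume e: "\<epsilon> > 0"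
  then have e2: "\<epsilon> / 2 > 0" by simp
  from f e2 obtain K where "\<forall>\<^sub>F n in sequentially. prob {\<omega> \<in> space M. \<bar>f n \<omega>\<bar> > K} \<le> \<epsilon> / 2"
    unfolding tight_seq_def by blast
  moreover from g e2 obtain L where "\<forall>\<^sub>F n in sequentially. prob {\<omega> \<in> space M. \<bar>g n \<omega>\<bar> > L} \<le> \<epsilon> / 2"
    unfolding tight_seq_def by blast
  ultimately have "\<forall>\<^sub>F n in sequentially. prob {\<omega> \<in> space M. \<bar>f n \<omega> + g n \<omega>\<bar> > K + L} \<le> \<epsilon>"
  proof eventually_elim
    case (elim n)
    have "prob {\<omega> \<in> space M. \<bar>f n \<omega> + g n \<omega>\<bar> > K + L} \<le> prob ({\<omega> \<in> space M. \<bar>f n \<omega>\<bar> > K} \<union> {\<omega> \<in> space M. \<bar>g n \<omega>\<bar> > L})"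
      by (intro finite_measure_mono) auto
    also have "\<dots> \<le> prob {\<omega> \<in> space M. \<bar>f n \<omega>\<bar> > K} + prob {\<omega> \<in> space M. \<bar>g n \<omega>\<bar> > L}"
      by (intro measure_Un_le) measurable
    finally show ?case using elim by simp
  qed
  then show "\<exists>K. \<forall>\<^sub>F n in sequentially. prob {\<omega> \<in> space M. \<bar>f n \<omega> + g n \<omega>\<bar> > K} \<le> \<epsilon>" by blast
qed

lemma tight_seq_mult:
  assumes f: "tight_seq f" and g: "tight_seq g"
  shows "tight_seq (\<lambda>n \<omega>. f n \<omega> * g n \<omega>)"
  unfolding tight_seq_def
proof (intro conjI allI impI)
  have [measurable]: "g n \<in> borel_measurable M" "f n \<in> borel_measurable M" for n
    using g f by (auto simp: tight_seq_measurable)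
  show "(\<lambda>\<omega>. f n \<omega> * g n \<omega>) \<in> borel_measurable M" for n by measurable
  fix \<epsilon> :: real assume e: "\<epsilon> > 0"
  then have e2: "\<epsilon> / 2 > 0" by simp
  from f e2 obtain K where "\<forall>\<^sub>F n in sequentially. prob {\<omega> \<in> space M. \<bar>f n \<omega>\<bar> > K} \<le> \<epsilon> / 2"
    unfolding tight_seq_def by blast
  moreover from g e2 obtain L where "\<forall>\<^sub>F n in sequentially. prob {\<omega> \<in> space M. \<bar>g n \<omega>\<bar> > L} \<le> \<epsilon> / 2"
    unfolding tight_seq_def by blast
  ultimately have "\<forall>\<^sub>F n in sequentially. prob {\<omega> \<in> space M. \<bar>f n \<omega> * g n \<omega>\<bar> > K * L} \<le> \<epsilon>"
  proof eventually_elim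
    case (elim n)
    have "prob {\<omega> \<in> space M. \<bar>f n \<omega> * g n \<omega>\<bar> > K * L} \<le> prob ({\<omega> \<in> space M. \<bar>f n \<omega>\<bar> > K} \<union> {\<omega> \<in> space M. \<bar>g n \<omega>\<bar> > L})"
    proof (intro finite_measure_mono subsetI)
      fix \<omega> assume \<omega>: "\<omega> \<in> {\<omega> \<in> space M. \<bar>f n \<omega> * g n \<omega>\<bar> > K * L}"
      have "\<bar>f n \<omega> * g n \<omega>\<bar> \<le> K * L" if "\<bar>f n \<omega>\<bar> \<le> K" "\<bar>g n \<omega>\<bar> \<le> L"
        unfolding abs_mult using that by (intro mult_mono) auto
      then show "\<omega> \<in> {\<omega> \<in> space M. \<bar>f n \<omega>\<bar> > K} \<union> {\<omega> \<in> space M. \<bar>g n \<omega>\<bar> > L}"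
        using \<omega> by force
    qed measurable
    also have "\<dots> \<le> prob {\<omega> \<in> space M. \<bar>f n \<omega>\<bar> > K} + prob {\<omega> \<in> space M. \<bar>g n \<omega>\<bar> > L}"
      by (intro measure_Un_le) measurable
    finally show ?case using elim by simp
  qed
  then show "\<exists>K. \<forall>\<^sub>F n in sequentially. prob {\<omega> \<in> space M. \<bar>f n \<omega> * g n \<omega>\<bar> > K} \<le> \<epsilon>" by blast
qed

lemma tight_seq_sum:
  assumes "\<And>j. j \<in> J \<Longrightarrow> tight_seq (f j)"
  shows "tight_seq (\<lambda>n \<omega>. \<Sum>j\<in>J. f j n \<omega>)"
  using assms by (induction J rule: infinite_finite_induct) (auto intro: tight_seq_add tight_seq_const)

text \<open>Slutsky's lemma for Laplace transforms. On the half-line \<open>exp (- s * x)\<close>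
  has values in \<open>[0, 1]\<close> and Lipschitz constant \<open>s\<close>, so the expectations
  differ by at most \<open>s * \<epsilon>\<close> plus the probability of a difference above
  \<open>\<epsilon>\<close>.\<close>

lemma Laplace_tendsto_of_vanishes:
  assumes v: "vanishes_in_prob (\<lambda>n \<omega>. T n \<omega> - S n \<omega>)"
    and [measurable]: "\<And>n. T n \<in> borel_measurable M" "\<And>n. S n \<in> borel_measurable M"
    and nn: "\<And>n \<omega>. T n \<omega> \<ge> 0" "\<And>n \<omega>. S n \<omega> \<ge> 0" and s: "s \<ge> (0::real)"
    and lim: "(\<lambda>n. expectation (\<lambda>\<omega>. exp (- s * S n \<omega>))) \<longlonglongrightarrow> L"
  shows "(\<lambda>n. expectation (\<lambda>\<omega>. exp (- s * T n \<omega>))) \<longlonglongrightarrow> L"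
proof -
  have int: "integrable M (\<lambda>\<omega>. exp (- s * T n \<omega>))" "integrable M (\<lambda>\<omega>. exp (- s * S n \<omega>))" for n
    using nn s by (auto intro!: integrable_const_bound[where B=1])
  have lip: "\<bar>exp (- s * x) - exp (- s * y)\<bar> \<le> s * \<bar>x - y\<bar>" if "x \<ge> 0" "y \<ge> 0" for x y
  proof -
    have *: "exp (- s * x) - exp (- s * y) \<le> s * (y - x)" if "0 \<le> x" "x \<le> y" for x y
    proof -
      have "exp (- s * x) - exp (- s * y) = exp (- s * x) * (1 - exp (- s * (y - x)))"
        by (simp add: algebra_simps flip: exp_add)
      also have "\<dots> \<le> 1 * (s * (y - x))"
        using that s exp_ge_add_one_self[of "- s * (y - x)"] by (intro mult_mono) auto
      finally show ?thesis by simp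
    qed
    have "exp (- s * max x y) \<le> exp (- s * min x y)" using s by (auto intro: mult_left_mono)
    then show ?thesis using *[of x y] *[of y x] that s
      by (cases "x \<le> y") (auto simp: abs_if max_def min_def split: if_splits)
  qed
  have "(\<lambda>n. expectation (\<lambda>\<omega>. exp (- s * T n \<omega>)) - expectation (\<lambda>\<omega>. exp (- s * S n \<omega>))) \<longlonglongrightarrow> 0"
    unfolding tendsto_iff
  proof (intro allI impI)
    fix e :: real assume e: "e > 0"
    \<comment> \<open>The denominator \<open>s + 1\<close> makes \<open>s * \<epsilon>\<close> at
      most \<open>e / 2\<close> and also covers \<open>s = 0\<close>.\<close>
    define \<epsilon> where "\<epsilon> = e / (2 * (s + 1))"
    have \<epsilon>: "\<epsilon> > 0" "s * \<epsilon> \<le> e / 2" using e s by (auto simp: \<epsilon>_def field_simps)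
    have "(\<lambda>n. prob {\<omega> \<in> space M. \<bar>T n \<omega> - S n \<omega>\<bar> > \<epsilon>}) \<longlonglongrightarrow> 0" using v \<epsilon> by (auto simp: vanishes_in_prob_def)
    then have "\<forall>\<^sub>F n in sequentially. prob {\<omega> \<in> space M. \<bar>T n \<omega> - S n \<omega>\<bar> > \<epsilon>} < e / 2"
      using e by (intro order_tendstoD) auto
    then show "\<forall>\<^sub>F n in sequentially. dist (expectation (\<lambda>\<omega>. exp (- s * T n \<omega>)) - expectation (\<lambda>\<omega>. exp (- s * S n \<omega>))) 0 < e"
    proof eventually_elim
      case (elim n)
      define A where "A = {\<omega> \<in> space M. \<bar>T n \<omega> - S n \<omega>\<bar> > \<epsilon>}"
      have A[measurable]: "A \<in> events" unfolding A_def by measurable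
      have iA: "integrable M (indicat_real A)"
        by (intro integrable_real_indicator) (auto simp: emeasure_eq_measure)
      have "expectation (\<lambda>\<omega>. exp (- s * T n \<omega>)) - expectation (\<lambda>\<omega>. exp (- s * S n \<omega>))
         = expectation (\<lambda>\<omega>. exp (- s * T n \<omega>) - exp (- s * S n \<omega>))"
        by (rule Bochner_Integration.integral_diff[OF int, symmetric])
      then have "\<bar>expectation (\<lambda>\<omega>. exp (- s * T n \<omega>)) - expectation (\<lambda>\<omega>. exp (- s * S n \<omega>))\<bar>
         \<le> expectation (\<lambda>\<omega>. \<bar>exp (- s * T n \<omega>) - exp (- s * S n \<omega>)\<bar>)"
        by (simp only: integral_abs_bound)
      also have "\<dots> \<le> expectation (\<lambda>\<omega>. s * \<epsilon> + indicator A \<omega>)"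
      proof (rule integral_mono)
        show "integrable M (\<lambda>\<omega>. s * \<epsilon> + indicator A \<omega>)"
          by (intro Bochner_Integration.integrable_add integrable_const iA)
        fix \<omega> assume \<omega>: "\<omega> \<in> space M"
        have "0 < exp (- s * T n \<omega>)" "exp (- s * T n \<omega>) \<le> 1" "0 < exp (- s * S n \<omega>)" "exp (- s * S n \<omega>) \<le> 1"
          using nn s by auto
        then have "\<bar>exp (- s * T n \<omega>) - exp (- s * S n \<omega>)\<bar> \<le> 1" by linarith
        moreover have "s * \<bar>T n \<omega> - S n \<omega>\<bar> \<le> s * \<epsilon>" if "\<omega> \<notin> A"
          using that \<omega> s unfolding A_def by (intro mult_left_mono) auto
        moreover have "0 \<le> s * \<epsilon>" using s \<epsilon> by simp
        ultimately show "\<bar>exp (- s * T n \<omega>) - exp (- s * S n \<omega>)\<bar> \<le> s * \<epsilon> + indicator A \<omega>"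
          using lip[OF nn(1)[of n \<omega>] nn(2)[of n \<omega>]] by (cases "\<omega> \<in> A") auto
      qed (use int in auto)
      also have "\<dots> = s * \<epsilon> + prob A"
        using iA A by (simp add: prob_space)
      finally show ?case using elim \<epsilon> by (simp add: A_def)
    qed
  qed
  from tendsto_add[OF this lim] show ?thesis by simp
qed

end

section \<open>Empirical quantiles\<close>

lemma emp_margin_mono: "s \<le> t \<Longrightarrow> emp_margin x n r s \<le> emp_margin x n r t"
  unfolding emp_margin_def by (intro divide_right_mono sum_mono) (auto split: split_indicator)

text \<open>The strict inequality is what an infimum decides directly. For \<open>0 < q < 1\<close>
  the infimum is genuine: the sample maximum belongs to the set and the sample minimum bounds it
  below.\<close>

lemma quantile_emp_margin_less_iff:
  assumes n: "n \<ge> 1" and q: "0 < q" "q < 1"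
  shows "quantile (emp_margin x n r) q < a \<longleftrightarrow> (\<exists>t<a. q \<le> emp_margin x n r t)"
proof -
  let ?S = "{t. q \<le> emp_margin x n r t}"
  have "emp_margin x n r (Max ((\<lambda>i. x i $ r) ` {1..n})) = 1"
  proof -
    have "(\<Sum>i=1..n. indicat_real {..Max ((\<lambda>i. x i $ r) ` {1..n})} (x i $ r)) = (\<Sum>i=1..n. 1)"
      by (intro sum.cong) auto
    then show ?thesis using n by (simp add: emp_margin_def)
  qed
  then have "Max ((\<lambda>i. x i $ r) ` {1..n}) \<in> ?S" using q by simp
  then have ne: "?S \<noteq> {}" by blast
  have "Min ((\<lambda>i. x i $ r) ` {1..n}) \<le> t" if "q \<le> emp_margin x n r t" for t
  proof -
    have "\<exists>i\<in>{1..n}. x i $ r \<le> t"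
    proof (rule ccontr)
      assume "\<not> ?thesis"
      then have "(\<Sum>i=1..n. indicat_real {..t} (x i $ r)) = 0" by (intro sum.neutral) auto
      then show False using that q by (simp add: emp_margin_def)
    qed
    then show ?thesis by (auto intro: Min.coboundedI order.trans)
  qed
  then have "bdd_below ?S" by (intro bdd_belowI) auto
  then show ?thesis unfolding quantile_def using ne by (subst cInf_less_iff) auto
qed

lemma exceed_count_eq:
  "exceed_count x n J c j = (\<Sum>i\<in>J. if \<exists>r. quantile (emp_margin x n r) (1 - c / j) < x i $ r then 1 else 0)"
  unfolding exceed_count_def
proof (intro sum.cong refl)
  fix i
  let ?q = "\<lambda>r. quantile (emp_margin x n r) (1 - c / j)"
  let ?s = "\<Sum>r\<in>UNIV. indicat_real {?q r<..} (x i $ r)"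
  have "?s = 0 \<longleftrightarrow> (\<forall>r. indicat_real {?q r<..} (x i $ r) = 0)"
    by (subst sum_nonneg_eq_0_iff) auto
  moreover have "?s \<ge> 0" by (intro sum_nonneg) auto
  ultimately have "?s > 0 \<longleftrightarrow> (\<exists>r. ?q r < x i $ r)"
    by (auto simp: less_le indicator_def split: if_splits)
  then show "indicator {0<..} ?s = (if \<exists>r. ?q r < x i $ r then 1 else 0)"
    by (simp add: indicator_def)
qed

lemma exceed_count_nonneg: "exceed_count x n J c j \<ge> 0"
  unfolding exceed_count_def by (intro sum_nonneg) auto

section \<open>Margins and quantiles of a continuous distribution function\<close>

locale df_sample = prob_space P for P :: "'a measure" +
  fixes X :: "nat \<Rightarrow> 'a \<Rightarrow> real ^ 'd" and F :: "real ^ 'd \<Rightarrow> real"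
  assumes ind: "indep_vars (\<lambda>_. borel) X {1..}"
    and df: "\<And>i. i \<ge> 1 \<Longrightarrow> mcdf (distr P borel (X i)) = F"
    and cont: "continuous_on UNIV F"
begin

lemma X_meas: "i \<ge> 1 \<Longrightarrow> X i \<in> borel_measurable P"
  using ind by (auto simp: indep_vars_def2)

lemma X_meas_nth: "i \<ge> 1 \<Longrightarrow> (\<lambda>\<omega>. X i \<omega> $ r) \<in> borel_measurable P"
  using X_meas borel_measurable_continuous_onI[of "\<lambda>x::real^'d. x $ r"]
  by (auto intro!: continuous_intros measurable_compose[of "X i" P borel "\<lambda>x. x $ r"])

lemma prob_le: "i \<ge> 1 \<Longrightarrow> prob {\<omega> \<in> space P. X i \<omega> \<le> x} = F x"
  using df[of i] X_meas[of i] closed_eucl_atMost[of x]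
  by (auto simp: mcdf_def fun_eq_iff measure_distr vimage_def Int_def conj_commute dest!: spec[of _ x])

text \<open>The limit in \<open>margin\<close> is computed by dominated convergence: for a fixed
  outcome, once \<open>s\<close> exceeds every coordinate, the box condition reduces to the one on
  coordinate \<open>r\<close>.\<close>

lemma margin_eq:
  assumes i: "i \<ge> 1"
  shows "margin F r t = prob {\<omega> \<in> space P. X i \<omega> $ r \<le> t}"
proof -
  note [measurable] = X_meas[OF i] X_meas_nth[OF i]
  let ?x = "\<lambda>s. \<chi> l. if l = r then t else s"
  have le_ev: "{\<omega> \<in> space P. X i \<omega> \<le> ?x s} \<in> events" for s
    using measurable_sets[OF X_meas[OF i], of "{..?x s}"] closed_eucl_atMost[of "?x s"]
    by (simp add: vimage_def Int_def conj_commute)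
  have F_eq: "F (?x s) = (\<integral>\<omega>. indicator {\<omega> \<in> space P. X i \<omega> \<le> ?x s} \<omega> \<partial>P)" for s
    using le_ev[of s] by (simp add: prob_le[OF i])
  have "((\<lambda>s. \<integral>\<omega>. indicat_real {\<omega> \<in> space P. X i \<omega> \<le> ?x s} \<omega> \<partial>P) \<longlongrightarrow>
        (\<integral>\<omega>. indicator {\<omega> \<in> space P. X i \<omega> $ r \<le> t} \<omega> \<partial>P)) at_top"
  proof (rule integral_dominated_convergence_at_top[where w="\<lambda>_. 1"])
    note [measurable] = le_ev
    show "(\<lambda>\<omega>. indicat_real {\<omega> \<in> space P. X i \<omega> \<le> ?x s} \<omega>) \<in> borel_measurable P" for s
      by measurable
    show "AE \<omega> in P. ((\<lambda>s. indicat_real {\<omega> \<in> space P. X i \<omega> \<le> ?x s} \<omega>) \<longlongrightarrow> indicator {\<omega> \<in> space P. X i \<omega> $ r \<le> t} \<omega>) at_top"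
    proof (intro AE_I2 tendsto_eventually)
      fix \<omega> assume "\<omega> \<in> space P"
      have "\<forall>\<^sub>F s in at_top. \<forall>l\<in>UNIV. X i \<omega> $ l \<le> s"
        by (intro eventually_ball_finite) (auto intro: eventually_ge_at_top)
      then show "\<forall>\<^sub>F s in at_top. indicat_real {\<omega> \<in> space P. X i \<omega> \<le> ?x s} \<omega> = indicator {\<omega> \<in> space P. X i \<omega> $ r \<le> t} \<omega>"
        by eventually_elim (auto simp: less_eq_vec_def split: split_indicator)
    qed
  qed (auto intro!: always_eventually AE_I2 split: split_indicator)
  then have "((\<lambda>s. F (?x s)) \<longlongrightarrow> prob {\<omega> \<in> space P. X i \<omega> $ r \<le> t}) at_top"
    unfolding F_eq using le_ev by simp
  then show ?thesis unfolding margin_def by (intro tendsto_Lim) auto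
qed

text \<open>Continuity of the joint distribution function passes to the margins. The part of
  \<open>X $ r = t\<close> lying in a box has probability at most the increment of \<open>F\<close>
  from \<open>t - h\<close> to \<open>t\<close> in direction \<open>r\<close>, which tends to 0 with
  \<open>h\<close>; countably many boxes exhaust the event.\<close>

lemma prob_nth_eq_0:
  assumes i: "i \<ge> 1"
  shows "prob {\<omega> \<in> space P. X i \<omega> $ r = t} = 0"
proof -
  note [measurable] = X_meas[OF i] X_meas_nth[OF i]
  let ?x = "\<lambda>t s. \<chi> l. if l = r then t else s"
  have le_ev[measurable]: "{\<omega> \<in> space P. X i \<omega> \<le> x} \<in> events" for x
    using measurable_sets[OF X_meas[OF i], of "{..x}"] closed_eucl_atMost[of x]
    by (simp add: vimage_def Int_def conj_commute)
  let ?A = "\<lambda>s. {\<omega> \<in> space P. X i \<omega> \<le> ?x t s \<and> X i \<omega> $ r = t}"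
  have Aev[measurable]: "?A s \<in> events" for s
  proof -
    have "?A s = {\<omega> \<in> space P. X i \<omega> \<le> ?x t s} \<inter> {\<omega> \<in> space P. X i \<omega> $ r = t}" by auto
    then show ?thesis by simp
  qed
  have "prob (?A s) = 0" for s
  proof -
    have "prob (?A s) \<le> F (?x t s) - F (?x (t - h) s)" if "h > 0" for h
    proof -
      have sub: "{\<omega> \<in> space P. X i \<omega> \<le> ?x (t - h) s} \<subseteq> {\<omega> \<in> space P. X i \<omega> \<le> ?x t s}"
        using that by (auto simp: less_eq_vec_def split: if_splits)
      have "prob (?A s) \<le> prob ({\<omega> \<in> space P. X i \<omega> \<le> ?x t s} - {\<omega> \<in> space P. X i \<omega> \<le> ?x (t - h) s})"
      proof (intro finite_measure_mono subsetI)
        fix \<omega> assume \<omega>: "\<omega> \<in> ?A s"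
        have "\<not> X i \<omega> \<le> ?x (t - h) s"
        proof
          assume "X i \<omega> \<le> ?x (t - h) s"
          then have "X i \<omega> $ r \<le> ?x (t - h) s $ r" unfolding less_eq_vec_def by blast
          then show False using \<omega> that by simp
        qed
        then show "\<omega> \<in> {\<omega> \<in> space P. X i \<omega> \<le> ?x t s} - {\<omega> \<in> space P. X i \<omega> \<le> ?x (t - h) s}"
          using \<omega> by simp
      qed measurable
      also have "\<dots> = F (?x t s) - F (?x (t - h) s)"
        using sub by (subst finite_measure_Diff) (auto simp: prob_le[OF i])
      finally show ?thesis .
    qed
    then have "\<forall>\<^sub>F h in at_right 0. prob (?A s) \<le> F (?x t s) - F (?x (t - h) s)"
      using eventually_at_right_less[of "0::real"] by (rule eventually_mono[rotated])
    moreover have "((\<lambda>h. F (?x t s) - F (?x (t - h) s)) \<longlongrightarrow> F (?x t s) - F (?x (t - 0) s)) (at_right 0)"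
    proof (intro tendsto_intros)
      have "((\<lambda>h. ?x (t - h) s) \<longlongrightarrow> ?x (t - 0) s) (at_right 0)"
        by (intro vec_tendstoI) (auto intro!: tendsto_eq_intros)
      then show "((\<lambda>h. F (?x (t - h) s)) \<longlongrightarrow> F (?x (t - 0) s)) (at_right 0)"
        by (rule continuous_on_tendsto_compose[OF cont]) auto
    qed
    ultimately have "prob (?A s) \<le> F (?x t s) - F (?x (t - 0) s)"
      by (intro tendsto_lowerbound[where F="at_right (0::real)"]) auto
    then have "prob (?A s) \<le> 0" unfolding diff_0_right by simp
    then show ?thesis by (simp add: measure_le_0_iff)
  qed
  then have "?A s \<in> null_sets P" for s by (simp add: null_sets_def emeasure_eq_measure)
  then have "(\<Union>n. ?A (real n)) \<in> null_sets P" by (intro null_sets_UN)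
  moreover have "(\<Union>n. ?A (real n)) = {\<omega> \<in> space P. X i \<omega> $ r = t}"
  proof (intro equalityI subsetI)
    fix \<omega> assume \<omega>: "\<omega> \<in> {\<omega> \<in> space P. X i \<omega> $ r = t}"
    obtain n where n: "(MAX l. X i \<omega> $ l) \<le> real n" using real_arch_simple by blast
    have "X i \<omega> $ l \<le> real n" for l using n by (meson Max_ge finite finite_imageI order.trans rangeI)
    then show "\<omega> \<in> (\<Union>n. ?A (real n))" using \<omega> by (auto simp: less_eq_vec_def)
  qed auto
  ultimately show ?thesis by (simp add: null_sets_def emeasure_eq_measure)
qed

lemma margin_eq_cdf:
  assumes i: "i \<ge> 1"
  shows "margin F r = cdf (distr P borel (\<lambda>\<omega>. X i \<omega> $ r))"
  using X_meas_nth[OF i]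
  by (auto simp: fun_eq_iff cdf_def measure_distr margin_eq[OF i] vimage_def Int_def conj_commute)

lemma margin_mono: "s \<le> t \<Longrightarrow> margin F r s \<le> margin F r t"
  using X_meas_nth[of 1 r] by (auto simp: margin_eq[of 1] intro!: finite_measure_mono)

lemma margin_continuous: "continuous_on UNIV (margin F r)"
proof -
  interpret D: real_distribution "distr P borel (\<lambda>\<omega>. X 1 \<omega> $ r)"
    using X_meas_nth[of 1 r] by simp
  have "measure (distr P borel (\<lambda>\<omega>. X 1 \<omega> $ r)) {t} = 0" for t
    using prob_nth_eq_0[of 1 r t] X_meas_nth[of 1 r]
    by (simp add: measure_distr vimage_def Int_def conj_commute)
  moreover have "margin F r = cdf (distr P borel (\<lambda>\<omega>. X 1 \<omega> $ r))" by (rule margin_eq_cdf) simp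
  ultimately show ?thesis
    by (intro continuous_at_imp_continuous_on ballI) (simp only: D.isCont_cdf)
qed

lemma margin_surj:
  assumes "0 < q" "q < 1"
  obtains t where "margin F r t = q"
proof -
  interpret D: real_distribution "distr P borel (\<lambda>\<omega>. X 1 \<omega> $ r)"
    using X_meas_nth[of 1 r] by simp
  have "\<forall>\<^sub>F t in at_bot. margin F r t < q" "\<forall>\<^sub>F t in at_top. margin F r t > q"
    using assms D.cdf_lim_at_bot D.cdf_lim_at_top_prob by (auto simp: margin_eq_cdf[of 1] intro: order_tendstoD)
  then obtain a b where ab: "margin F r a < q" "margin F r b > q"
    by (auto simp: eventually_at_bot_linorder eventually_at_top_linorder)
  then have "a \<le> b" using margin_mono[of b a r] by linarith
  then show ?thesis
    using IVT'[of "margin F r" a q b] ab margin_continuous continuous_on_subset that by (metis less_imp_le subset_UNIV)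
qed

text \<open>Continuity makes the superlevel set closed, so its infimum is attained; since the level
  \<open>q\<close> is a value of the margin, monotonicity excludes overshooting.\<close>

lemma margin_quantile:
  assumes q: "0 < q" "q < 1"
  shows "margin F r (quantile (margin F r) q) = q"
proof -
  let ?S = "{t. q \<le> margin F r t}"
  obtain t where t: "margin F r t = q" using margin_surj[OF q] .
  obtain t0 where t0: "margin F r t0 = q / 2" using margin_surj[of "q / 2"] q by auto
  have bdd: "bdd_below ?S"
  proof (rule bdd_belowI)
    fix s assume "s \<in> ?S"
    then show "t0 \<le> s" using margin_mono[of s t0 r] t0 q by (cases "t0 \<le> s") auto
  qed
  have "closed ?S" by (intro closed_Collect_le continuous_intros margin_continuous)
  then have "Inf ?S \<in> ?S" using t bdd by (intro closed_contains_Inf) auto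
  moreover have "Inf ?S \<le> t" using bdd t by (intro cInf_lower) auto
  ultimately show ?thesis using margin_mono[of "Inf ?S" t r] t by (auto simp: quantile_def)
qed

text \<open>This is where the copula enters: exceeding the vector of marginal quantiles in some
  coordinate is the complement of the lower orthant.\<close>

lemma prob_not_le_quantiles:
  assumes i: "i \<ge> 1"
  shows "prob {\<omega> \<in> space P. X i \<omega> \<in> - {..\<chi> r. quantile (margin F r) (u $ r)}} = 1 - copula_of F u"
proof -
  let ?g = "\<chi> r. quantile (margin F r) (u $ r)"
  have ev: "{\<omega> \<in> space P. X i \<omega> \<le> ?g} \<in> events"
    using measurable_sets[OF X_meas[OF i], of "{..?g}"] closed_eucl_atMost[of ?g]
    by (simp add: vimage_def Int_def conj_commute)
  have "{\<omega> \<in> space P. X i \<omega> \<in> - {..?g}} = space P - {\<omega> \<in> space P. X i \<omega> \<le> ?g}" by auto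
  then show ?thesis using prob_compl[OF ev] by (simp add: prob_le[OF i] copula_of_def)
qed

section \<open>Measurability and deviations of empirical quantiles and counts\<close>

lemma emp_margin_measurable: "(\<lambda>\<omega>. emp_margin (\<lambda>i. X i \<omega>) n r t) \<in> borel_measurable P"
proof -
  have "(\<lambda>\<omega>. indicat_real {..t} (X i \<omega> $ r)) \<in> borel_measurable P" if "i \<in> {1..n}" for i
  proof -
    have [measurable]: "(\<lambda>\<omega>. X i \<omega> $ r) \<in> borel_measurable P" using that by (intro X_meas_nth) auto
    show ?thesis by measurable
  qed
  then show ?thesis unfolding emp_margin_def by (intro borel_measurable_divide borel_measurable_sum) auto
qed

lemma quantile_emp_margin_measurable:
  assumes n: "n \<ge> 1" and q: "0 < q" "q < 1"
  shows "(\<lambda>\<omega>. quantile (emp_margin (\<lambda>i. X i \<omega>) n r) q) \<in> borel_measurable P"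
proof (subst borel_measurable_iff_less, intro allI)
  fix a :: real
  note [measurable] = emp_margin_measurable
  \<comment> \<open>Monotonicity of the empirical margin allows rational witnesses, which makes the
    union countable and the event measurable.\<close>
  have rat: "(\<exists>t<a. q \<le> emp_margin x n r t) \<longleftrightarrow> (\<exists>t\<in>{t\<in>\<rat>. t < a}. q \<le> emp_margin x n r t)" for x
  proof
    assume "\<exists>t<a. q \<le> emp_margin x n r t"
    then obtain t where t: "t < a" "q \<le> emp_margin x n r t" by auto
    obtain u where "u \<in> \<rat>" "t < u" "u < a" using Rats_dense_in_real[OF t(1)] by auto
    then show "\<exists>t\<in>{t\<in>\<rat>. t < a}. q \<le> emp_margin x n r t"
      using t(2) emp_margin_mono[of t u x n r] by (intro bexI[of _ u]) auto
  qed auto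
  have "countable {t\<in>\<rat>. t < a}" using countable_rat by (rule countable_subset[rotated]) auto
  then show "{\<omega> \<in> space P. quantile (emp_margin (\<lambda>i. X i \<omega>) n r) q < a} \<in> events"
    unfolding quantile_emp_margin_less_iff[OF n q] rat by measurable
qed

lemma exceed_count_measurable:
  assumes n: "n \<ge> 1" and q: "0 < 1 - c / j" "1 - c / j < 1" and J: "J \<subseteq> {1..n}"
  shows "(\<lambda>\<omega>. exceed_count (\<lambda>i. X i \<omega>) n J c j) \<in> borel_measurable P"
  unfolding exceed_count_eq
proof (intro borel_measurable_sum)
  fix i assume "i \<in> J"
  then have "i \<ge> 1" using J by auto
  note [measurable] = quantile_emp_margin_measurable[OF n q] X_meas_nth[OF this]
  show "(\<lambda>\<omega>. if \<exists>r. quantile (emp_margin (\<lambda>i. X i \<omega>) n r) (1 - c / j) < X i \<omega> $ r then 1 else 0::real)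
      \<in> borel_measurable P"
    by measurable
qed

text \<open>Chebyshev's inequality with the tail mass \<open>1 - margin F r t\<close> kept in the
  variance. At levels near \<open>1 - c / j\<close> it is of order \<open>c\<close>, which yields
  the fluctuation scale \<open>sqrt (c / n)\<close> instead of \<open>sqrt (1 / n)\<close>.\<close>

lemma emp_margin_deviation:
  fixes \<epsilon> :: real
  assumes n: "n \<ge> 1" and \<epsilon>: "\<epsilon> > 0"
  shows "prob {\<omega> \<in> space P. \<bar>emp_margin (\<lambda>i. X i \<omega>) n r t - margin F r t\<bar> \<ge> \<epsilon>} \<le> (1 - margin F r t) / (n * \<epsilon>\<^sup>2)"
proof -
  let ?p = "margin F r t"
  have A: "{x::real^'d. x $ r \<le> t} \<in> sets borel"
    by (intro borel_closed closed_Collect_le continuous_intros)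
  have "prob {\<omega> \<in> space P. \<bar>(\<Sum>i=1..n. indicator {x. x $ r \<le> t} (X i \<omega>)) - card {1..n} * ?p\<bar> \<ge> n * \<epsilon>}
     \<le> card {1..n} * (?p * (1 - ?p)) / (n * \<epsilon>)\<^sup>2"
    using n \<epsilon> by (intro binomial_deviation indep_vars_subset[OF ind] A) (auto simp: margin_eq)
  also have "\<dots> = ?p * (1 - ?p) / (n * \<epsilon>\<^sup>2)" using n by (simp add: power2_eq_square)
  also have "\<dots> \<le> 1 * (1 - ?p) / (n * \<epsilon>\<^sup>2)"
    using n \<epsilon> by (intro divide_right_mono mult_right_mono) (auto simp: margin_eq[of 1])
  also have "{\<omega> \<in> space P. \<bar>(\<Sum>i=1..n. indicator {x. x $ r \<le> t} (X i \<omega>)) - card {1..n} * ?p\<bar> \<ge> n * \<epsilon>}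
    = {\<omega> \<in> space P. \<bar>emp_margin (\<lambda>i. X i \<omega>) n r t - ?p\<bar> \<ge> \<epsilon>}"
  proof -
    have "(\<Sum>i=1..n. indicat_real {x. x $ r \<le> t} (X i \<omega>)) = n * emp_margin (\<lambda>i. X i \<omega>) n r t" for \<omega>
      using n by (simp add: emp_margin_def indicator_def)
    then have "\<bar>(\<Sum>i=1..n. indicat_real {x. x $ r \<le> t} (X i \<omega>)) - card {1..n} * ?p\<bar> = n * \<bar>emp_margin (\<lambda>i. X i \<omega>) n r t - ?p\<bar>" for \<omega>
      by (simp add: abs_mult flip: right_diff_distrib)
    then show ?thesis using n by simp
  qed
  finally show ?thesis by simp
qed

text \<open>The empirical quantile lies between the true quantiles of levels \<open>q \<plusminus> \<epsilon>\<close>, so the two counts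
  differ at most by the number of observations in a deterministic slab of probability \<open>2 \<epsilon>\<close> per
  coordinate; the dependence between the quantile and the counted observations plays no role.\<close>
lemma exceed_count_deviation:
  fixes \<epsilon> :: real
  assumes n: "n \<ge> 1" and J: "J \<subseteq> {1..n}" and j: "j \<ge> 1" and c: "0 < c" "c < 1"
    and \<epsilon>: "\<epsilon> > 0" "\<epsilon> < c / j" "\<epsilon> < 1 - c / j" and a: "a > 0"
  shows "prob {\<omega> \<in> space P. \<bar>exceed_count (\<lambda>i. X i \<omega>) n J c j -
      (\<Sum>i\<in>J. indicator (- {..\<chi> r. quantile (margin F r) (1 - c / j)}) (X i \<omega>))\<bar> > a}
    \<le> real CARD('d) * (4 * c / (n * \<epsilon>\<^sup>2)) + real CARD('d) * (card J * (2 * \<epsilon>)) / a"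
proof -
  define q where "q = 1 - c / j"
  have q: "0 < q" "q < 1" "1 - q \<le> c" using j c by (auto simp: q_def field_simps)
  \<comment> \<open>The bounds \<open>\<epsilon> < 1 - c / j\<close> and
    \<open>\<epsilon> < c / j\<close> say that \<open>q - \<epsilon>\<close> and
    \<open>q + \<epsilon>\<close> lie in the open unit interval.\<close>
  have "\<exists>t. margin F r t = q - \<epsilon>" for r
    by (rule margin_surj[of "q - \<epsilon>" r]) (use \<epsilon> q in \<open>auto simp: q_def\<close>)
  then obtain lo where lo: "\<And>r. margin F r (lo r) = q - \<epsilon>" by metis
  have "\<exists>t. margin F r t = q + \<epsilon>" for r
    by (rule margin_surj[of "q + \<epsilon>" r]) (use \<epsilon> q in \<open>auto simp: q_def\<close>)
  then obtain hi where hi: "\<And>r. margin F r (hi r) = q + \<epsilon>" by metis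
  define g where "g r = quantile (margin F r) q" for r
  have g: "margin F r (g r) = q" for r unfolding g_def using q by (intro margin_quantile) auto
  have log: "lo r \<le> g r" and ghi: "g r \<le> hi r" for r
    using margin_mono[of "g r" "lo r" r] margin_mono[of "hi r" "g r" r] lo hi g \<epsilon> by (force simp: not_le)+
  define gh where "gh \<omega> r = quantile (emp_margin (\<lambda>i. X i \<omega>) n r) q" for \<omega> r
  define S where "S r \<omega> = (\<Sum>i\<in>J. indicat_real {lo r<..hi r} (X i \<omega> $ r))" for r \<omega>
  have Xm[measurable]: "(\<lambda>\<omega>. X i \<omega> $ r) \<in> borel_measurable P" if "i \<in> J" for i r
    using J that by (intro X_meas_nth) auto
  have Sm[measurable]: "S r \<in> borel_measurable P" for r unfolding S_def by measurable
  note [measurable] = emp_margin_measurable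
  \<comment> \<open>On the bad event \<open>?B\<close> some empirical margin is off by at least
    \<open>\<epsilon>\<close> at \<open>lo\<close> or \<open>hi\<close>. Off it, the empirical
    margin is below \<open>q\<close> at \<open>lo\<close> and above \<open>q\<close> at
    \<open>hi\<close>, which traps the empirical quantile between them.\<close>
  let ?E = "\<lambda>r t. {\<omega> \<in> space P. \<bar>emp_margin (\<lambda>i. X i \<omega>) n r t - margin F r t\<bar> \<ge> \<epsilon>}"
  let ?B = "\<Union>r. ?E r (lo r) \<union> ?E r (hi r)"
  have good: "lo r \<le> gh \<omega> r" "gh \<omega> r \<le> hi r" if "\<omega> \<in> space P" "\<omega> \<notin> ?B" for \<omega> r
  proof -
    let ?G = "emp_margin (\<lambda>i. X i \<omega>) n r"
    have "\<not> \<epsilon> \<le> \<bar>?G (lo r) - margin F r (lo r)\<bar>" "\<not> \<epsilon> \<le> \<bar>?G (hi r) - margin F r (hi r)\<bar>"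
      using that by blast+
    then have 1: "?G (lo r) < q" "?G (hi r) > q" unfolding lo hi by linarith+
    show "lo r \<le> gh \<omega> r"
    proof (rule ccontr)
      assume "\<not> ?thesis"
      then obtain t where "t < lo r" "q \<le> ?G t"
        using quantile_emp_margin_less_iff[OF n q(1,2)] unfolding gh_def by (meson not_le)
      then show False using emp_margin_mono[of t "lo r" "\<lambda>i. X i \<omega>" n r] 1 by auto
    qed
    show "gh \<omega> r \<le> hi r"
    \<comment> \<open>The quantile criterion is strict, so it is applied at every \<open>z\<close>
      beyond \<open>hi r\<close>.\<close>
    proof (rule dense_ge)
      fix z assume "hi r < z"
      then show "gh \<omega> r \<le> z"
        using quantile_emp_margin_less_iff[OF n q(1,2), of "\<lambda>i. X i \<omega>" r z] 1 unfolding gh_def by auto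
    qed
  qed
  have cnt: "\<bar>exceed_count (\<lambda>i. X i \<omega>) n J c j - (\<Sum>i\<in>J. indicator (- {..\<chi> r. g r}) (X i \<omega>))\<bar> \<le> (\<Sum>r\<in>UNIV. S r \<omega>)"
    if "\<omega> \<in> space P" "\<omega> \<notin> ?B" for \<omega>
  proof -
    have "\<bar>exceed_count (\<lambda>i. X i \<omega>) n J c j - (\<Sum>i\<in>J. indicator (- {..\<chi> r. g r}) (X i \<omega>))\<bar>
       \<le> (\<Sum>i\<in>J. \<bar>(if \<exists>r. gh \<omega> r < X i \<omega> $ r then 1 else 0) - indicator (- {..\<chi> r. g r}) (X i \<omega>)\<bar>)"
      unfolding exceed_count_eq q_def[symmetric] gh_def[symmetric] sum_subtractf[symmetric] by (rule sum_abs)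
    also have "\<dots> \<le> (\<Sum>i\<in>J. \<Sum>r\<in>UNIV. indicat_real {lo r<..hi r} (X i \<omega> $ r))"
    proof (rule sum_mono)
      fix i assume "i \<in> J"
      let ?s = "\<Sum>r\<in>UNIV. indicat_real {lo r<..hi r} (X i \<omega> $ r)"
      have s0: "?s \<ge> 0" by (intro sum_nonneg) auto
      have s1: "?s \<ge> 1" if "X i \<omega> $ r \<in> {lo r<..hi r}" for r
        using member_le_sum[of r UNIV "\<lambda>r. indicat_real {lo r<..hi r} (X i \<omega> $ r)"] that by simp
      \<comment> \<open>If an observation exceeds one threshold vector but not the other, some
        coordinate lies between the empirical and the true quantile, hence in the slab.\<close>
      have "\<exists>r. X i \<omega> $ r \<in> {lo r<..hi r}" if ne: "(\<exists>r. gh \<omega> r < X i \<omega> $ r) \<noteq> (\<exists>r. g r < X i \<omega> $ r)"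
      proof (cases "\<exists>r. gh \<omega> r < X i \<omega> $ r")
        case True
        then obtain r where "gh \<omega> r < X i \<omega> $ r" by auto
        moreover have "X i \<omega> $ r \<le> g r" using ne True by (auto simp: not_less)
        ultimately show ?thesis using good(1)[OF \<open>\<omega> \<in> space P\<close> \<open>\<omega> \<notin> ?B\<close>, of r] ghi[of r] by (intro exI[of _ r]) auto
      next
        case False
        then obtain r where "g r < X i \<omega> $ r" using ne by auto
        moreover have "X i \<omega> $ r \<le> gh \<omega> r" using False by (auto simp: not_less)
        ultimately show ?thesis using good(2)[OF \<open>\<omega> \<in> space P\<close> \<open>\<omega> \<notin> ?B\<close>, of r] log[of r] by (intro exI[of _ r]) auto
      qed
      moreover have "X i \<omega> \<in> - {..\<chi> r. g r} \<longleftrightarrow> (\<exists>r. g r < X i \<omega> $ r)" by (simp add: less_eq_vec_def not_le)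
      ultimately show "\<bar>(if \<exists>r. gh \<omega> r < X i \<omega> $ r then 1 else 0) - indicator (- {..\<chi> r. g r}) (X i \<omega>)\<bar> \<le> ?s"
        using s0 s1 unfolding indicator_def by (auto split: if_splits)
    qed
    also have "\<dots> = (\<Sum>r\<in>UNIV. S r \<omega>)" unfolding S_def by (rule sum.swap)
    finally show ?thesis .
  qed
  have slab: "prob {\<omega> \<in> space P. X i \<omega> $ r \<in> {lo r<..hi r}} = 2 * \<epsilon>" if "i \<in> J" for i r
  proof -
    have i: "i \<ge> 1" using that J by auto
    have "{\<omega> \<in> space P. X i \<omega> $ r \<in> {lo r<..hi r}} = {\<omega> \<in> space P. X i \<omega> $ r \<le> hi r} - {\<omega> \<in> space P. X i \<omega> $ r \<le> lo r}"
      by auto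
    also have "prob \<dots> = margin F r (hi r) - margin F r (lo r)"
      unfolding margin_eq[OF i] using that log[of r] ghi[of r] by (intro finite_measure_Diff) auto
    finally show ?thesis by (simp add: lo hi)
  qed
  have iS: "integrable P (\<lambda>\<omega>. indicat_real {lo r<..hi r} (X i \<omega> $ r))" if "i \<in> J" for i r
    using that by (intro integrable_const_bound[where B=1]) auto
  have ES: "expectation (\<lambda>\<omega>. \<Sum>r\<in>UNIV. S r \<omega>) = CARD('d) * (card J * (2 * \<epsilon>))"
  proof -
    have "expectation (\<lambda>\<omega>. indicat_real {lo r<..hi r} (X i \<omega> $ r)) = 2 * \<epsilon>" if "i \<in> J" for i r
    proof -
      have "expectation (\<lambda>\<omega>. indicat_real {lo r<..hi r} (X i \<omega> $ r)) = expectation (indicat_real {\<omega> \<in> space P. X i \<omega> $ r \<in> {lo r<..hi r}})"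
        by (intro Bochner_Integration.integral_cong) (auto split: split_indicator)
      then show ?thesis using slab[OF that, of r] that by simp
    qed
    then show ?thesis
      unfolding S_def by (subst Bochner_Integration.integral_sum, force intro: iS, subst Bochner_Integration.integral_sum)
         (auto intro: iS)
  qed
  \<comment> \<open>The tail masses at \<open>lo\<close> and \<open>hi\<close> are
    \<open>1 - q + \<epsilon>\<close> and \<open>1 - q - \<epsilon>\<close>. The
    \<open>\<epsilon>\<close> cancels in their sum, which leaves a multiple of
    \<open>c\<close>.\<close>
  have B1: "prob (?E r (lo r)) + prob (?E r (hi r)) \<le> 4 * c / (n * \<epsilon>\<^sup>2)" for r
  proof -
    have "prob (?E r (lo r)) + prob (?E r (hi r)) \<le> (1 - (q - \<epsilon>)) / (n * \<epsilon>\<^sup>2) + (1 - (q + \<epsilon>)) / (n * \<epsilon>\<^sup>2)"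
      using emp_margin_deviation[OF n \<epsilon>(1), of r "lo r"] emp_margin_deviation[OF n \<epsilon>(1), of r "hi r"] lo[of r] hi[of r]
      by (intro add_mono) auto
    also have "\<dots> = (2 * (1 - q)) / (n * \<epsilon>\<^sup>2)" by (simp flip: add_divide_distrib)
    also have "\<dots> \<le> 4 * c / (n * \<epsilon>\<^sup>2)" using q c by (intro divide_right_mono) auto
    finally show ?thesis .
  qed
  have "prob ?B \<le> (\<Sum>r\<in>UNIV. prob (?E r (lo r) \<union> ?E r (hi r)))"
    by (intro finite_measure_subadditive_finite) auto
  also have "\<dots> \<le> (\<Sum>r\<in>(UNIV::'d set). 4 * c / (n * \<epsilon>\<^sup>2))"
    by (intro sum_mono order.trans[OF measure_Un_le B1]) auto
  finally have PB: "prob ?B \<le> CARD('d) * (4 * c / (n * \<epsilon>\<^sup>2))" by simp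
  have "prob {\<omega> \<in> space P. \<bar>exceed_count (\<lambda>i. X i \<omega>) n J c j - (\<Sum>i\<in>J. indicator (- {..\<chi> r. g r}) (X i \<omega>))\<bar> > a}
     \<le> prob (?B \<union> {\<omega> \<in> space P. (\<Sum>r\<in>UNIV. S r \<omega>) \<ge> a})"
    using cnt by (intro finite_measure_mono) fastforce+
  also have "\<dots> \<le> prob ?B + prob {\<omega> \<in> space P. (\<Sum>r\<in>UNIV. S r \<omega>) \<ge> a}"
    by (intro measure_Un_le) auto
  also have "prob {\<omega> \<in> space P. (\<Sum>r\<in>UNIV. S r \<omega>) \<ge> a} \<le> expectation (\<lambda>\<omega>. \<Sum>r\<in>UNIV. S r \<omega>) / a"
    using a by (intro integral_Markov_inequality_measure[where A="space P"] Bochner_Integration.integrable_sum)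
      (auto simp: S_def intro!: sum_nonneg iS)
  finally show ?thesis using PB by (simp add: g_def q_def ES)
qed

end

section \<open>The test statistic\<close>

text \<open>The copula condition is used along the diagonal. There \<open>u - 1\<close> is a
  multiple of the all-ones vector, so homogeneity of the norm gives the leading term
  \<open>c / j * N 1\<close> and an error of order \<open>c powr (1 + \<delta>)\<close>.\<close>

lemma exceed_probability_expansion:
  fixes F N :: "real ^ 'd \<Rightarrow> real" and c :: "nat \<Rightarrow> real"
  assumes N: "is_norm N"
    and O: "(\<lambda>u. copula_of F u - (1 - N (u - 1))) \<in> O[at 1 within box 0 1](\<lambda>u. N (u - 1) powr (1 + \<delta>))"
    and c: "\<And>n. 0 < c n" "\<And>n. c n < 1" and c0: "c \<longlonglongrightarrow> 0" and j: "j \<ge> 1"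
  shows "\<exists>C. \<forall>\<^sub>F n in sequentially. \<bar>(1 - copula_of F (\<chi> r. 1 - c n / real j)) - c n / real j * N 1\<bar> \<le> C * c n powr (1 + \<delta>)"
proof -
  define u :: "nat \<Rightarrow> real ^ 'd" where "u n = (\<chi> r. 1 - c n / real j)" for n
  have u1: "u n - 1 = (- (c n / j)) *\<^sub>R 1" for n by (simp add: u_def vec_eq_iff)
  have Nu: "N (u n - 1) = c n / j * N 1" for n
  proof -
    have "N ((- (c n / j)) *\<^sub>R 1) = \<bar>- (c n / j)\<bar> * N 1" using N unfolding is_norm_def by blast
    then show ?thesis unfolding u1 using c(1)[of n] by simp
  qed
  have pos: "0 < c n / j" "c n / j < 1" for n
    using c(1)[of n] c(2)[of n] j by (auto simp: divide_less_eq)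
  \<comment> \<open>The condition \<open>0 < c n < 1\<close> keeps \<open>u n\<close> inside the
    open cube, the region in which the limit is taken.\<close>
  have "filterlim u (at 1 within box 0 1) sequentially"
    unfolding filterlim_at
  proof
    have "(\<lambda>n. 1 - c n / real j) \<longlonglongrightarrow> 1 - 0 / real j" using j by (intro tendsto_intros c0) auto
    then have "(\<lambda>n. u n $ r) \<longlonglongrightarrow> 1 $ r" for r by (simp add: u_def)
    then show "u \<longlonglongrightarrow> 1" by (rule vec_tendstoI)
    have "u n \<in> box 0 1 \<and> u n \<noteq> 1" for n
      using pos[of n] j by (auto simp: u_def mem_box_cart vec_eq_iff)
    then show "\<forall>\<^sub>F n in sequentially. u n \<in> box 0 1 \<and> u n \<noteq> 1" by simp
  qed
  moreover obtain C where C: "C > 0" "\<forall>\<^sub>F u in at 1 within box 0 1. norm (copula_of F u - (1 - N (u - 1))) \<le> C * norm (N (u - 1) powr (1 + \<delta>))"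
    using O by (elim landau_o.bigE)
  ultimately have ev: "\<forall>\<^sub>F n in sequentially. norm (copula_of F (u n) - (1 - N (u n - 1))) \<le> C * norm (N (u n - 1) powr (1 + \<delta>))"
    unfolding filterlim_iff by blast
  have pw: "N (u n - 1) powr (1 + \<delta>) = (N 1 / j) powr (1 + \<delta>) * c n powr (1 + \<delta>)" for n
    unfolding Nu using c(1)[of n] N j by (subst powr_mult[symmetric]) (auto simp: is_norm_def mult.commute)
  from ev have "\<forall>\<^sub>F n in sequentially. \<bar>(1 - copula_of F (u n)) - c n / j * N 1\<bar> \<le> (C * (N 1 / j) powr (1 + \<delta>)) * c n powr (1 + \<delta>)"
  proof eventually_elim
    case (elim n)
    have "\<bar>(1 - copula_of F (u n)) - c n / j * N 1\<bar> = norm (copula_of F (u n) - (1 - N (u n - 1)))"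
      unfolding Nu by (simp add: abs_minus_commute algebra_simps)
    with elim show ?case unfolding pw by (simp add: abs_mult mult.assoc)
  qed
  then show ?thesis unfolding u_def by blast
qed

context df_sample
begin

text \<open>A quantile error of order \<open>sqrt (c / n)\<close> on the probability scale moves
  about \<open>m * sqrt (c / n)\<close> observations. Divided by \<open>sqrt (m * c)\<close> this is
  \<open>sqrt (m / n)\<close>, which tends to 0.\<close>

lemma exceed_count_vanishes:
  fixes c :: "nat \<Rightarrow> real"
  assumes I: "\<And>n. I n \<subseteq> {1..n}" and c: "\<And>n. 0 < c n" "\<And>n. c n < 1" and c0: "c \<longlonglongrightarrow> 0"
    and mn: "(\<lambda>n. real (card (I n)) / real n) \<longlonglongrightarrow> 0"
    and mc: "filterlim (\<lambda>n. real (card (I n)) * c n) at_top sequentially" and j: "j \<ge> 1"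
  shows "vanishes_in_prob (\<lambda>n \<omega>. (exceed_count (\<lambda>i. X i \<omega>) n (I n) (c n) j -
      (\<Sum>i\<in>I n. indicator (- {..\<chi> r. quantile (margin F r) (1 - c n / real j)}) (X i \<omega>))) / sqrt (card (I n) * c n))"
    (is "vanishes_in_prob (\<lambda>n \<omega>. ?D n \<omega> / _)")
proof (rule vanishes_in_probI)
  \<comment> \<open>The fourth root of \<open>m / n\<close> balances the two error terms:
    \<open>\<epsilon> = sqrt (c / n) / \<rho>\<close> gives \<open>4 * \<rho>^2\<close> from
    Chebyshev and \<open>2 * \<rho> / a\<close> from Markov, per coordinate.\<close>
  define \<rho> where "\<rho> n = sqrt (sqrt (card (I n) / n))" for n
  have cj: "0 < c n / j" "c n / j < 1" "c n / j \<le> c n" for n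
    using c(1)[of n] c(2)[of n] j by (auto simp: divide_less_eq field_simps)
  show "(\<lambda>\<omega>. ?D n \<omega> / sqrt (card (I n) * c n)) \<in> borel_measurable P" for n
  proof (cases "n = 0")
    case True
    then show ?thesis using I[of n] by (simp add: exceed_count_eq)
  next
    case False
    have m1: "(\<lambda>\<omega>. exceed_count (\<lambda>i. X i \<omega>) n (I n) (c n) j) \<in> borel_measurable P"
      using False cj[of n] by (intro exceed_count_measurable I) auto
    have [measurable]: "X i \<in> borel_measurable P" if "i \<in> I n" for i
      using that I[of n] by (intro X_meas) auto
    have "- {..\<chi> r. quantile (margin F r) (1 - c n / real j)} \<in> sets borel"
      by (intro borel_open open_Compl closed_eucl_atMost)
    then have "(\<lambda>\<omega>. indicat_real (- {..\<chi> r. quantile (margin F r) (1 - c n / real j)}) (X i \<omega>)) \<in> borel_measurable P"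
      if "i \<in> I n" for i using that by measurable
    then show ?thesis using m1 by (intro borel_measurable_divide borel_measurable_diff borel_measurable_sum) auto
  qed
  fix a :: real assume a: "a > 0"
  have \<rho>0: "\<rho> \<longlonglongrightarrow> 0"
    unfolding \<rho>_def using tendsto_real_sqrt[OF tendsto_real_sqrt[OF mn]] by simp
  \<comment> \<open>Since \<open>\<epsilon> = c * \<rho> / sqrt (m * c)\<close>, the bound
    \<open>e1\<close> secures \<open>\<epsilon> < c / j\<close>; together with
    \<open>c < 1 / 2\<close> it also gives \<open>\<epsilon> < 1 - c / j\<close>.\<close>
  have "(\<lambda>n. \<rho> n / sqrt (card (I n) * c n)) \<longlonglongrightarrow> 0"
    using filterlim_compose[OF sqrt_at_top mc] \<rho>0 by (intro real_tendsto_divide_at_top)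
  then have e1: "\<forall>\<^sub>F n in sequentially. \<rho> n / sqrt (card (I n) * c n) < 1 / j"
    using j by (intro order_tendstoD) auto
  have e2: "\<forall>\<^sub>F n in sequentially. c n < 1 / 2" using c0 by (intro order_tendstoD) auto
  have e3: "\<forall>\<^sub>F n in sequentially. card (I n) * c n > 0" using mc by (simp add: filterlim_at_top_dense)
  have "\<forall>\<^sub>F n in sequentially. prob {\<omega> \<in> space P. \<bar>?D n \<omega> / sqrt (card (I n) * c n)\<bar> > a}
     \<le> real CARD('d) * (4 * (\<rho> n)\<^sup>2) + real CARD('d) * (2 * \<rho> n) / a"
    using e1 e2 e3 eventually_ge_at_top[of 1]
  proof eventually_elim
    case (elim n)
    define x where "x = sqrt (card (I n))"
    define y where "y = sqrt n"
    define z where "z = sqrt (c n)"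
    define \<epsilon> where "\<epsilon> = z / (y * \<rho> n)"
    have m0: "card (I n) > 0" using elim(3) c(1)[of n] by (auto simp: zero_less_mult_iff)
    have xyz: "x > 0" "y > 0" "z > 0" "x\<^sup>2 = card (I n)" "y\<^sup>2 = n" "z\<^sup>2 = c n"
      using m0 c(1)[of n] elim(4) by (auto simp: x_def y_def z_def)
    have \<rho>2: "(\<rho> n)\<^sup>2 = x / y" by (simp add: \<rho>_def x_def y_def real_sqrt_divide power_divide)
    have \<rho>p: "\<rho> n > 0" using xyz m0 elim(4) by (simp add: \<rho>_def)
    have xz: "sqrt (card (I n) * c n) = x * z" by (simp add: x_def z_def real_sqrt_mult)
    have y_eq: "y = x / (\<rho> n)\<^sup>2" using \<rho>2 \<rho>p xyz by (simp add: field_simps)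
    have \<epsilon>_eq: "\<epsilon> = z * \<rho> n / x" using \<rho>p xyz by (simp add: \<epsilon>_def y_eq power2_eq_square field_simps)
    have \<epsilon>0: "\<epsilon> > 0" using xyz \<rho>p by (simp add: \<epsilon>_def)
    have \<epsilon>c: "\<epsilon> < c n / j"
    proof -
      have "\<epsilon> = c n * (\<rho> n / (x * z))" using xyz by (simp add: \<epsilon>_eq xyz(6)[symmetric] power2_eq_square)
      also have "\<dots> < c n * (1 / j)" using elim(1) c(1)[of n] unfolding xz by (intro mult_strict_left_mono)
      finally show ?thesis by simp
    qed
    have "\<epsilon> < 1 - c n / j" using \<epsilon>c cj[of n] elim(2) by linarith
    then have "prob {\<omega> \<in> space P. \<bar>?D n \<omega>\<bar> > a * (x * z)}
      \<le> real CARD('d) * (4 * c n / (n * \<epsilon>\<^sup>2)) + real CARD('d) * (card (I n) * (2 * \<epsilon>)) / (a * (x * z))"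
      using elim(4) j c[of n] \<epsilon>0 \<epsilon>c a xyz by (intro exceed_count_deviation I) auto
    also have "4 * c n / (n * \<epsilon>\<^sup>2) = 4 * (\<rho> n)\<^sup>2"
      using xyz \<rho>p by (simp add: \<epsilon>_def xyz(5,6)[symmetric] power_divide power_mult_distrib)
    also have "real CARD('d) * (card (I n) * (2 * \<epsilon>)) / (a * (x * z)) = real CARD('d) * (2 * \<rho> n) / a"
      using xyz a by (simp add: \<epsilon>_eq xyz(4)[symmetric] power2_eq_square field_simps)
    also have "{\<omega> \<in> space P. \<bar>?D n \<omega>\<bar> > a * (x * z)} = {\<omega> \<in> space P. \<bar>?D n \<omega> / sqrt (card (I n) * c n)\<bar> > a}"
      unfolding xz using xyz by (simp add: abs_mult pos_less_divide_eq)
    finally show ?case .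
  qed
  moreover have "(\<lambda>n. real CARD('d) * (4 * (\<rho> n)\<^sup>2) + real CARD('d) * (2 * \<rho> n) / a) \<longlonglongrightarrow> 0"
    using \<rho>0 a by (auto intro!: tendsto_eq_intros)
  ultimately show "\<exists>g. g \<longlonglongrightarrow> 0 \<and> (\<forall>\<^sub>F n in sequentially. prob {\<omega> \<in> space P. \<bar>?D n \<omega> / sqrt (card (I n) * c n)\<bar> > a} \<le> g n)"
    by blast
qed

end

text \<open>On the complement of the constants, the cosine basis diagonalises the covariance \<open>min j l\<close> of
  Brownian motion at times \<open>1, \<dots>, k\<close>.\<close>
lemma quadratic_form_dct:
  fixes g :: "nat \<Rightarrow> real" and k :: nat
  defines "a j \<equiv> \<Sum>i=1..k - 1. g i * dct k i j"
  shows "(\<Sum>j=1..k. \<Sum>l=1..k. a j * a l * real (min j l))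
     = (\<Sum>i=1..k - 1. 1 / (4 * (sin (real i / real k * (pi / 2)))\<^sup>2) * (g i)\<^sup>2)"
proof -
  have "(\<Sum>j=1..k. \<Sum>l=1..k. a j * a l * real (min j l))
     = (\<Sum>j=1..k. \<Sum>l=1..k. \<Sum>i=1..k - 1. \<Sum>i'=1..k - 1. g i * g i' * (dct k i j * dct k i' l * real (min j l)))"
    unfolding a_def sum_product unfolding sum_distrib_right by (intro sum.cong refl) (simp add: mult_ac)
  also have "\<dots> = (\<Sum>j=1..k. \<Sum>i=1..k - 1. \<Sum>l=1..k. \<Sum>i'=1..k - 1. g i * g i' * (dct k i j * dct k i' l * real (min j l)))"
    by (intro sum.cong refl sum.swap)
  also have "\<dots> = (\<Sum>j=1..k. \<Sum>i=1..k - 1. \<Sum>i'=1..k - 1. \<Sum>l=1..k. g i * g i' * (dct k i j * dct k i' l * real (min j l)))"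
    by (intro sum.cong refl sum.swap)
  also have "\<dots> = (\<Sum>i=1..k - 1. \<Sum>j=1..k. \<Sum>i'=1..k - 1. \<Sum>l=1..k. g i * g i' * (dct k i j * dct k i' l * real (min j l)))"
    by (rule sum.swap)
  also have "\<dots> = (\<Sum>i=1..k - 1. \<Sum>i'=1..k - 1. \<Sum>j=1..k. \<Sum>l=1..k. g i * g i' * (dct k i j * dct k i' l * real (min j l)))"
    by (intro sum.cong refl sum.swap)
  also have "\<dots> = (\<Sum>i=1..k - 1. \<Sum>i'=1..k - 1. g i * g i' * (if i = i' then 1 / (4 * (sin (real i / real k * (pi / 2)))\<^sup>2) else 0))"
    by (intro sum.cong refl) (simp only: sum_distrib_left[symmetric] sum_dct_min)
  also have "\<dots> = (\<Sum>i=1..k - 1. 1 / (4 * (sin (real i / real k * (pi / 2)))\<^sup>2) * (g i)\<^sup>2)"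
    by (simp add: if_distrib power2_eq_square mult_ac cong: if_cong)
  finally show ?thesis .
qed

context df_sample
begin

lemma test_stat_weak_conv:
  fixes N :: "real ^ 'd \<Rightarrow> real" and Q :: "'b measure" and \<xi> :: "nat \<Rightarrow> 'b \<Rightarrow> real"
  assumes N: "is_norm N"
    and O: "(\<lambda>u. copula_of F u - (1 - N (u - 1))) \<in> O[at 1 within box 0 1](\<lambda>u. N (u - 1) powr (1 + \<delta>))"
    and \<delta>: "\<delta> > 0" and k: "k \<ge> 2"
    and I: "\<And>n. I n \<subseteq> {1..n}" and c: "\<And>n. 0 < c n" "\<And>n. c n < 1" and c0: "c \<longlonglongrightarrow> 0"
    and mn: "(\<lambda>n. real (card (I n)) / real n) \<longlonglongrightarrow> 0"
    and mc: "filterlim (\<lambda>n. real (card (I n)) * c n) at_top sequentially"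
    and mc': "(\<lambda>n. real (card (I n)) * c n powr (1 + 2 * \<delta>)) \<longlonglongrightarrow> 0"
    and Q: "prob_space Q" and \<xi>ind: "prob_space.indep_vars Q (\<lambda>_. borel) \<xi> {1..k - 1}"
    and \<xi>: "\<And>i. i \<in> {1..k - 1} \<Longrightarrow> distributed Q lborel (\<xi> i) std_normal_density"
  shows "weak_conv_m (\<lambda>n. distr P borel (\<lambda>\<omega>. test_stat k (\<lambda>i. X i \<omega>) n (I n) (c n)))
    (distr Q borel (\<lambda>\<omega>. \<Sum>i=1..k - 1. 1 / (4 * (sin (real i / real k * (pi / 2)))\<^sup>2) * (\<xi> i \<omega>)\<^sup>2))"
proof -

  \<comment> \<open>Normalised counts and auxiliary quantities\<close>
  define \<kappa> where "\<kappa> = N 1"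
  have \<kappa>: "\<kappa> > 0"
  proof -
    have "(1::real^'d) \<noteq> 0" by (simp add: vec_eq_iff)
    then show ?thesis using N unfolding \<kappa>_def is_norm_def by (metis less_le)
  qed
  define m where "m n = real (card (I n))" for n
  \<comment> \<open>\<open>(b n)\<^sup>2 = m * c * N 1\<close> is the common leading term of the
    means \<open>j * m * p n j\<close>, so one centring constant serves all
    \<open>j\<close>.\<close>
  define b where "b n = sqrt (m n * (\<kappa> * c n))" for n
  define A where "A n j = - {..\<chi> r. quantile (margin F r) (1 - c n / real j)}" for n and j :: nat
  define p where "p n j = 1 - copula_of F (\<chi> r. 1 - c n / real j)" for n and j :: nat
  define Eh where "Eh n j \<omega> = exceed_count (\<lambda>i. X i \<omega>) n (I n) (c n) j" for n j \<omega>
  define E where "E n j \<omega> = (\<Sum>i\<in>I n. indicat_real (A n j) (X i \<omega>))" for n j \<omega>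
  \<comment> \<open>\<open>Zh\<close> centres the observed counts at \<open>(b n)\<^sup>2\<close>,
    \<open>Z\<close> the counts with true quantiles at their exact means. Their difference consists
    of the threshold error and the bias.\<close>
  define Zh where "Zh n j \<omega> = (real j * Eh n j \<omega> - (b n)\<^sup>2) / b n" for n j \<omega>
  define Z where "Z n j \<omega> = real j * (E n j \<omega> - m n * p n j) / b n" for n j \<omega>
  \<comment> \<open>Up to the factor \<open>(b n)\<^sup>2\<close>, this is the denominator of the
    statistic.\<close>
  define D where "D n \<omega> = 1 + (\<Sum>l=1..k. Zh n l \<omega>) / k / b n" for n \<omega>
  define v where "v n j \<omega> = Z n j \<omega> - (\<Sum>l=1..k. Z n l \<omega>) / k" for n j \<omega>
  define vh where "vh n j \<omega> = Zh n j \<omega> - (\<Sum>l=1..k. Zh n l \<omega>) / k" for n j \<omega>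
  define T where "T n \<omega> = test_stat k (\<lambda>i. X i \<omega>) n (I n) (c n)" for n \<omega>
  define S where "S n \<omega> = (\<Sum>j=1..k. (v n j \<omega>)\<^sup>2)" for n \<omega>

  \<comment> \<open>Measurability, signs and growth of the normalisation\<close>
  have fin: "finite (I n)" for n using I[of n] finite_subset by blast
  have I1: "i \<ge> 1" if "i \<in> I n" for i n using that I[of n] by auto
  have m0: "m n \<ge> 0" for n by (simp add: m_def)
  have b2: "(b n)\<^sup>2 = m n * (\<kappa> * c n)" for n unfolding b_def using m0[of n] \<kappa> c(1)[of n] by simp
  \<comment> \<open>In this degenerate case all counts are 0 and every quotient by
    \<open>b n\<close> is 0 by convention, so the identities below persist.\<close>
  have I_empty: "I n = {}" if "b n = 0" for n
    using that \<kappa> c(1)[of n] fin[of n] by (simp add: b_def m_def)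
  have \<kappa>mc: "filterlim (\<lambda>n. m n * (\<kappa> * c n)) at_top sequentially"
    using filterlim_tendsto_pos_mult_at_top[OF tendsto_const \<kappa> mc] by (simp add: m_def mult_ac)
  have b_top: "filterlim b at_top sequentially"
    unfolding b_def by (rule filterlim_compose[OF sqrt_at_top \<kappa>mc])
  have ev_b: "\<forall>\<^sub>F n in sequentially. b n > 0" using b_top by (simp add: filterlim_at_top_dense)
  have inv_b: "(\<lambda>n. 1 / b n) \<longlonglongrightarrow> 0" by (rule real_tendsto_divide_at_top[OF tendsto_const b_top])

  have cj: "0 < 1 - c n / j" "1 - c n / j < 1" if "j \<ge> 1" for n and j :: nat
    using c(1)[of n] c(2)[of n] that by (auto simp: divide_less_eq)
  have A_meas[measurable]: "A n j \<in> sets borel" for n j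
    unfolding A_def by (intro borel_open open_Compl closed_eucl_atMost)
  have X_m[measurable]: "X i \<in> borel_measurable P" if "i \<in> I n" for i n using I1[OF that] by (rule X_meas)
  have E_m[measurable]: "E n j \<in> borel_measurable P" for n j unfolding E_def by measurable
  have Z_m[measurable]: "Z n j \<in> borel_measurable P" for n j unfolding Z_def by measurable
  have Eh_m: "Eh n j \<in> borel_measurable P" if "j \<in> {1..k}" for n j
  \<comment> \<open>At \<open>n = 0\<close> the empirical quantiles are meaningless, but the index
    set is empty and the count is constant.\<close>
  proof (cases "n = 0")
    case True
    then show ?thesis using I[of n] by (simp add: Eh_def[abs_def] exceed_count_eq)
  next
    case False
    then show ?thesis unfolding Eh_def using that cj[of j n] by (intro exceed_count_measurable I) auto
  qed
  have T_eq: "T n \<omega> = (\<Sum>j=1..k. (real j * Eh n j \<omega> - (\<Sum>l=1..k. real l * Eh n l \<omega>) / k)\<^sup>2) / ((\<Sum>l=1..k. real l * Eh n l \<omega>) / k)" for n \<omega>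
    by (simp add: T_def test_stat_def Let_def Eh_def)
  have T_m[measurable]: "T n \<in> borel_measurable P" for n
    unfolding T_eq[abs_def] using Eh_m
    by (intro borel_measurable_divide borel_measurable_sum borel_measurable_power borel_measurable_diff borel_measurable_times) auto
  have S_m[measurable]: "S n \<in> borel_measurable P" for n unfolding S_def v_def by measurable
  have T0: "T n \<omega> \<ge> 0" for n \<omega>
    unfolding T_eq Eh_def by (intro divide_nonneg_nonneg sum_nonneg mult_nonneg_nonneg exceed_count_nonneg) auto
  have S0: "S n \<omega> \<ge> 0" for n \<omega> unfolding S_def by (intro sum_nonneg) auto

  \<comment> \<open>Exceedance probabilities and bias\<close>
  have pA: "prob {\<omega> \<in> space P. X i \<omega> \<in> A n j} = p n j" if "i \<in> I n" for n i j
    using prob_not_le_quantiles[OF I1[OF that], of "\<chi> r. 1 - c n / real j"] by (simp add: A_def p_def)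
  have p01: "0 \<le> p n j" "p n j \<le> 1" if "I n \<noteq> {}" for n j
    using that pA[of _ n j] by (metis all_not_in_conv measure_nonneg, metis all_not_in_conv prob_le_1)

  have p_exp: "\<exists>C. \<forall>\<^sub>F n in sequentially. \<bar>p n j - c n / j * \<kappa>\<bar> \<le> C * c n powr (1 + \<delta>)" if "j \<in> {1..k}" for j
    using exceed_probability_expansion[OF N O c c0, of j] that unfolding p_def \<kappa>_def by auto
  have p_lim: "(\<lambda>n. p n j / (\<kappa> * c n)) \<longlonglongrightarrow> 1 / j" if j: "j \<in> {1..k}" for j
  proof -
    obtain C where C: "\<forall>\<^sub>F n in sequentially. \<bar>p n j - c n / j * \<kappa>\<bar> \<le> C * c n powr (1 + \<delta>)" using p_exp[OF j] by blast
    have "(\<lambda>n. c n powr \<delta>) \<longlonglongrightarrow> 0"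
      using c(1) by (intro tendsto_zero_powrI[OF c0 tendsto_const _ \<delta>]) (simp add: less_imp_le)
    then have "(\<lambda>n. C / \<kappa> * c n powr \<delta>) \<longlonglongrightarrow> 0" by (rule tendsto_mult_right_zero)
    moreover have "\<forall>\<^sub>F n in sequentially. norm (p n j / (\<kappa> * c n) - 1 / j) \<le> C / \<kappa> * c n powr \<delta>"
      using C
    proof eventually_elim
      case (elim n)
      have "p n j / (\<kappa> * c n) - 1 / j = (p n j - c n / j * \<kappa>) / (\<kappa> * c n)"
        using \<kappa> c(1)[of n] j by (simp add: field_simps)
      then have "norm (p n j / (\<kappa> * c n) - 1 / j) = \<bar>p n j - c n / j * \<kappa>\<bar> / (\<kappa> * c n)"
        using \<kappa> c(1)[of n] by (simp add: abs_mult)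
      also have "\<dots> \<le> C * c n powr (1 + \<delta>) / (\<kappa> * c n)"
        using \<kappa> c(1)[of n] elim by (intro divide_right_mono) auto
      also have "\<dots> = C / \<kappa> * c n powr \<delta>" using c(1)[of n] by (simp add: powr_add)
      finally show ?case .
    qed
    ultimately have "(\<lambda>n. p n j / (\<kappa> * c n) - 1 / j) \<longlonglongrightarrow> 0"
      by (rule Lim_null_comparison[rotated])
    then show ?thesis by (rule LIM_zero_cancel)
  qed
  \<comment> \<open>The bias is of order \<open>m * c powr (1 + \<delta>) / sqrt (m * c)\<close>,
    which is \<open>sqrt (m * c powr (1 + 2 * \<delta>))\<close>.\<close>
  have bias: "(\<lambda>n. (real j * (m n * p n j) - (b n)\<^sup>2) / b n) \<longlonglongrightarrow> 0" if j: "j \<in> {1..k}" for j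
  proof -
    obtain C where C: "\<forall>\<^sub>F n in sequentially. \<bar>p n j - c n / j * \<kappa>\<bar> \<le> C * c n powr (1 + \<delta>)" using p_exp[OF j] by blast
    have "(\<lambda>n. sqrt (m n * c n powr (1 + 2 * \<delta>))) \<longlonglongrightarrow> 0"
      using tendsto_real_sqrt[OF mc'] by (simp add: m_def)
    then have "(\<lambda>n. real j * C / sqrt \<kappa> * sqrt (m n * c n powr (1 + 2 * \<delta>))) \<longlonglongrightarrow> 0"
      by (rule tendsto_mult_right_zero)
    moreover have "\<forall>\<^sub>F n in sequentially. norm ((real j * (m n * p n j) - (b n)\<^sup>2) / b n) \<le> real j * C / sqrt \<kappa> * sqrt (m n * c n powr (1 + 2 * \<delta>))"
      using C ev_b
    proof eventually_elim
      case (elim n)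
      have mp: "m n > 0" using elim(2) m0[of n] by (cases "m n = 0") (auto simp: b_def)
      have "real j * (m n * p n j) - (b n)\<^sup>2 = real j * m n * (p n j - c n / j * \<kappa>)"
        unfolding b2 using j by (simp add: field_simps)
      then have "norm ((real j * (m n * p n j) - (b n)\<^sup>2) / b n) = real j * m n * \<bar>p n j - c n / j * \<kappa>\<bar> / b n"
        using elim m0[of n] by (simp add: abs_mult)
      also have "\<dots> \<le> real j * m n * (C * c n powr (1 + \<delta>)) / b n"
        using elim m0[of n] by (intro divide_right_mono mult_left_mono) auto
      also have "\<dots> = real j * C / sqrt \<kappa> * (m n * c n powr (1 + \<delta>) / sqrt (m n * c n))"
        by (simp add: b_def real_sqrt_mult mult_ac)
      also have "m n * c n powr (1 + \<delta>) / sqrt (m n * c n) = sqrt (m n * c n powr (1 + 2 * \<delta>))"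
      proof -
        have "c n powr (1 + \<delta>) = sqrt (c n) * c n powr (1 / 2 + \<delta>)"
          using c(1)[of n] by (simp add: powr_half_sqrt[symmetric] flip: powr_add)
        moreover have "sqrt (c n powr (1 + 2 * \<delta>)) = c n powr (1 / 2 + \<delta>)"
          using c(1)[of n] by (simp add: powr_half_sqrt[symmetric] powr_powr add_divide_distrib)
        moreover have "m n = sqrt (m n) * sqrt (m n)" using mp by simp
        ultimately show ?thesis using mp c(1)[of n] by (simp add: real_sqrt_mult field_simps)
      qed
      finally show ?case .
    qed
    ultimately show ?thesis by (rule Lim_null_comparison[rotated])
  qed

  \<comment> \<open>Threshold error and tightness\<close>
  have R_van: "vanishes_in_prob (\<lambda>n \<omega>. Zh n j \<omega> - Z n j \<omega>)" if j: "j \<in> {1..k}" for j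
  proof -
    have "vanishes_in_prob (\<lambda>n \<omega>. (Eh n j \<omega> - E n j \<omega>) / sqrt (m n * c n))"
      unfolding Eh_def E_def A_def m_def using j by (intro exceed_count_vanishes I c c0 mn mc) auto
    then have "vanishes_in_prob (\<lambda>n \<omega>. real j / sqrt \<kappa> * ((Eh n j \<omega> - E n j \<omega>) / sqrt (m n * c n))
        + (real j * (m n * p n j) - (b n)\<^sup>2) / b n)"
      by (intro vanishes_in_prob_add vanishes_in_prob_cmult vanishes_in_prob_const bias j)
    moreover have "real j / sqrt \<kappa> * ((Eh n j \<omega> - E n j \<omega>) / sqrt (m n * c n)) + (real j * (m n * p n j) - (b n)\<^sup>2) / b n
        = Zh n j \<omega> - Z n j \<omega>" for n \<omega>
    proof -
      have bs: "sqrt \<kappa> * sqrt (m n * c n) = b n" by (simp add: b_def real_sqrt_mult)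
      have "real j / sqrt \<kappa> * ((Eh n j \<omega> - E n j \<omega>) / sqrt (m n * c n)) = real j * (Eh n j \<omega> - E n j \<omega>) / b n"
        unfolding times_divide_times_eq bs ..
      then show ?thesis
        unfolding Zh_def Z_def by (simp only: add_divide_distrib[symmetric] diff_divide_distrib[symmetric])
          (simp add: algebra_simps)
    qed
    ultimately show ?thesis by simp
  qed

  have Z_tight: "tight_seq (\<lambda>n \<omega>. Z n j \<omega>)" if j: "j \<in> {1..k}" for j
    unfolding tight_seq_def
  proof (intro conjI allI impI)
    fix \<epsilon> :: real assume \<epsilon>: "\<epsilon> > 0"
    \<comment> \<open>Chebyshev's bound for \<open>Z\<close> is at most \<open>j^2 / K^2\<close>
      times \<open>p n j / (\<kappa> * c n)\<close>. That ratio tends to \<open>1 / j\<close>, so it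
      is eventually below 2, and this \<open>K\<close> makes the bound at most
      \<open>\<epsilon>\<close>.\<close>
    define K where "K = sqrt (2 * (real j)\<^sup>2 / \<epsilon>)"
    have K: "K > 0" "K\<^sup>2 = 2 * (real j)\<^sup>2 / \<epsilon>" using \<epsilon> j by (auto simp: K_def)
    have "\<forall>\<^sub>F n in sequentially. p n j / (\<kappa> * c n) < 2"
      using p_lim[OF j] j by (intro order_tendstoD(2)) (auto simp: divide_less_eq)
    then have "\<forall>\<^sub>F n in sequentially. prob {\<omega> \<in> space P. \<bar>Z n j \<omega>\<bar> > K} \<le> \<epsilon>"
      using ev_b
    proof eventually_elim
      case (elim n)
      have ne: "I n \<noteq> {}" using elim(2) by (auto simp: b_def m_def)
      have mp: "m n > 0" using ne fin[of n] by (simp add: m_def card_gt_0_iff)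
      have "prob {\<omega> \<in> space P. \<bar>Z n j \<omega>\<bar> > K} \<le> prob {\<omega> \<in> space P. \<bar>E n j \<omega> - card (I n) * p n j\<bar> \<ge> K * b n / j}"
      proof (intro finite_measure_mono subsetI)
        fix \<omega> assume \<omega>: "\<omega> \<in> {\<omega> \<in> space P. \<bar>Z n j \<omega>\<bar> > K}"
        define y where "y = \<bar>E n j \<omega> - card (I n) * p n j\<bar>"
        have "\<bar>Z n j \<omega>\<bar> = j * y / b n" using elim(2) by (simp add: Z_def y_def m_def abs_mult)
        moreover have "K < \<bar>Z n j \<omega>\<bar>" using \<omega> by simp
        ultimately have "K < j * y / b n" by simp
        then have "K * b n / j < y" using elim(2) j by (simp add: field_simps)
        then show "\<omega> \<in> {\<omega> \<in> space P. \<bar>E n j \<omega> - card (I n) * p n j\<bar> \<ge> K * b n / j}"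
          using \<omega> by (simp add: y_def)
      qed measurable
      also have "\<dots> \<le> card (I n) * (p n j * (1 - p n j)) / (K * b n / j)\<^sup>2"
        unfolding E_def using elim(2) K j I1
        by (intro binomial_deviation indep_vars_subset[OF ind] fin A_meas pA) auto
      also have "\<dots> \<le> card (I n) * (p n j * 1) / (K * b n / j)\<^sup>2"
        using p01[OF ne] by (intro divide_right_mono mult_left_mono) auto
      also have "\<dots> = \<epsilon> / 2 * (p n j / (\<kappa> * c n))"
        using mp \<epsilon> j by (simp add: power_mult_distrib power_divide K b2 m_def)
      also have "\<dots> \<le> \<epsilon> / 2 * 2" using elim(1) \<epsilon> by (intro mult_left_mono) auto
      finally show ?case by simp
    qed
    then show "\<exists>K. \<forall>\<^sub>F n in sequentially. prob {\<omega> \<in> space P. \<bar>Z n j \<omega>\<bar> > K} \<le> \<epsilon>" by blast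
  qed measurable
  have Zh_tight: "tight_seq (\<lambda>n \<omega>. Zh n j \<omega>)" if "j \<in> {1..k}" for j
    using tight_seq_add[OF Z_tight[OF that] vanishes_in_prob_imp_tight_seq[OF R_van[OF that]]] by simp

  \<comment> \<open>Reduction of the statistic to the sum of squared deviations of
    \<open>Z\<close>\<close>
  have D_van: "vanishes_in_prob (\<lambda>n \<omega>. D n \<omega> - 1)"
  proof -
    have "vanishes_in_prob (\<lambda>n \<omega>. (\<Sum>l=1..k. Zh n l \<omega>) * (1 / k * (1 / b n)))"
      using inv_b by (intro tight_seq_mult_vanishes tight_seq_sum tight_seq_const Zh_tight vanishes_in_prob_const)
    then show ?thesis by (simp add: D_def)
  qed
  have v_tight: "tight_seq (\<lambda>n \<omega>. v n j \<omega>)" if "j \<in> {1..k}" for j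
  proof -
    have "tight_seq (\<lambda>n \<omega>. Z n j \<omega> + (- 1 / k) * (\<Sum>l=1..k. Z n l \<omega>))"
      using that by (intro tight_seq_add tight_seq_mult tight_seq_const tight_seq_sum Z_tight) auto
    then show ?thesis by (simp add: v_def)
  qed
  have r_van: "vanishes_in_prob (\<lambda>n \<omega>. vh n j \<omega> - v n j \<omega>)" if "j \<in> {1..k}" for j
  proof -
    have "vanishes_in_prob (\<lambda>n \<omega>. (Zh n j \<omega> - Z n j \<omega>) + (- 1 / k) * (\<Sum>l=1..k. Zh n l \<omega> - Z n l \<omega>))"
      using that by (intro vanishes_in_prob_add vanishes_in_prob_cmult vanishes_in_prob_sum R_van) auto
    then show ?thesis by (simp add: v_def vh_def sum_subtractf diff_divide_distrib algebra_simps)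
  qed
  have TS: "vanishes_in_prob (\<lambda>n \<omega>. T n \<omega> - S n \<omega>)"
  proof (rule vanishes_in_prob_dominated[where h="\<lambda>n \<omega>. D n \<omega> - 1" and a="1 / 2"])
    have S_tight: "tight_seq (\<lambda>n \<omega>. S n \<omega>)"
      unfolding S_def power2_eq_square by (intro tight_seq_sum tight_seq_mult v_tight)
    \<comment> \<open>Each summand is \<open>vh^2 - v^2\<close> factorised as
      \<open>(vh + v) * (vh - v)\<close>, with \<open>vh + v\<close> written as
      \<open>(vh - v) + 2 * v\<close>: tight times vanishing.\<close>
    have "vanishes_in_prob (\<lambda>n \<omega>. \<Sum>j=1..k. ((vh n j \<omega> - v n j \<omega>) + (v n j \<omega> + v n j \<omega>)) * (vh n j \<omega> - v n j \<omega>))"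
      by (intro vanishes_in_prob_sum tight_seq_mult_vanishes tight_seq_add vanishes_in_prob_imp_tight_seq r_van v_tight)
    then have *: "vanishes_in_prob (\<lambda>n \<omega>. (\<Sum>j=1..k. (vh n j \<omega>)\<^sup>2) - S n \<omega>)"
      by (simp add: S_def sum_subtractf[symmetric] power2_eq_square algebra_simps)
    \<comment> \<open>Writing \<open>V\<close> for the sum of the \<open>vh^2\<close>, one has
      \<open>T - S = (V - S - S * (D - 1)) / D\<close>. The factor 2 bounds \<open>1 / D\<close>
      where \<open>D \<ge> 1 / 2\<close>.\<close>
    show "vanishes_in_prob (\<lambda>n \<omega>. 2 * (((\<Sum>j=1..k. (vh n j \<omega>)\<^sup>2) - S n \<omega>) + (- 1) * (S n \<omega> * (D n \<omega> - 1))))"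
      by (intro vanishes_in_prob_cmult vanishes_in_prob_add * tight_seq_mult_vanishes S_tight D_van)
    show "vanishes_in_prob (\<lambda>n \<omega>. D n \<omega> - 1)" by (rule D_van)
    show "(\<lambda>\<omega>. T n \<omega> - S n \<omega>) \<in> borel_measurable P" for n by measurable
    fix n \<omega> assume D: "\<bar>D n \<omega> - 1\<bar> \<le> 1 / 2"
    \<comment> \<open>From \<open>j * Eh = b^2 + b * Zh\<close> the average is
      \<open>b^2 * D\<close> and each deviation from it is \<open>b * vh\<close>, so
      \<open>b^2\<close> cancels in the quotient.\<close>
    have T_D: "T n \<omega> = (\<Sum>j=1..k. (vh n j \<omega>)\<^sup>2) / D n \<omega>"
    proof (cases "b n = 0")
      case True
      then have "Eh n j \<omega> = 0" for j using I_empty by (simp add: Eh_def exceed_count_eq)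
      then show ?thesis using True by (simp add: T_eq vh_def Zh_def)
    next
      case False
      have jE: "real j * Eh n j \<omega> = (b n)\<^sup>2 + b n * Zh n j \<omega>" for j
        using False by (simp add: Zh_def)
      have avg: "(\<Sum>l=1..k. real l * Eh n l \<omega>) / k = (b n)\<^sup>2 + b n * ((\<Sum>l=1..k. Zh n l \<omega>) / k)"
        unfolding jE using k by (simp add: sum.distrib add_divide_distrib flip: sum_distrib_left)
      have "(b n)\<^sup>2 + b n * ((\<Sum>l=1..k. Zh n l \<omega>) / k) = (b n)\<^sup>2 * D n \<omega>"
        using False by (simp add: D_def power2_eq_square algebra_simps)
      moreover have "(b n)\<^sup>2 + b n * Zh n j \<omega> - ((b n)\<^sup>2 + b n * ((\<Sum>l=1..k. Zh n l \<omega>) / k)) = b n * vh n j \<omega>" for j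
        by (simp add: vh_def algebra_simps)
      ultimately have "T n \<omega> = (\<Sum>j=1..k. (b n * vh n j \<omega>)\<^sup>2) / ((b n)\<^sup>2 * D n \<omega>)"
        unfolding T_eq avg unfolding jE by simp
      then show ?thesis using False by (simp add: power_mult_distrib flip: sum_distrib_left)
    qed
    have "D n \<omega> \<ge> 1 / 2" using D unfolding abs_le_iff by linarith
    then have Dp: "2 * D n \<omega> \<ge> 1" "D n \<omega> > 0" by auto
    define G where "G = ((\<Sum>j=1..k. (vh n j \<omega>)\<^sup>2) - S n \<omega>) + (- 1) * (S n \<omega> * (D n \<omega> - 1))"
    have "T n \<omega> - S n \<omega> = G / D n \<omega>" unfolding T_D G_def using Dp by (simp add: field_simps)
    then have "\<bar>T n \<omega> - S n \<omega>\<bar> = \<bar>2 * G\<bar> / (2 * D n \<omega>)" using Dp by (simp add: abs_mult)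
    also have "\<dots> \<le> \<bar>2 * G\<bar> / 1" using Dp by (intro divide_left_mono) auto
    finally show "\<bar>T n \<omega> - S n \<omega>\<bar> \<le> \<bar>2 * (((\<Sum>j=1..k. (vh n j \<omega>)\<^sup>2) - S n \<omega>) + (- 1) * (S n \<omega> * (D n \<omega> - 1)))\<bar>"
      by (simp only: G_def div_by_1)
  qed simp

  \<comment> \<open>Cosine coordinates and their limit law\<close>
  define W where "W n i \<omega> = (\<Sum>j=1..k. dct k i j * Z n j \<omega>)" for n i \<omega>
  have S_W: "S n \<omega> = (\<Sum>i=1..k - 1. (W n i \<omega>)\<^sup>2)" for n \<omega>
    unfolding S_def v_def W_def using k by (intro sum_squares_dct) auto
  define lam where "lam i = 1 / (4 * (sin (real i / real k * (pi / 2)))\<^sup>2)" for i :: nat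
  have Laplace_S: "(\<lambda>n. \<integral>\<omega>. exp (- s * S n \<omega>) \<partial>P) \<longlonglongrightarrow> (\<integral>\<omega>. exp (- s * (\<Sum>i=1..k - 1. lam i * (\<xi> i \<omega>)\<^sup>2)) \<partial>Q)"
    if s: "s \<ge> 0" for s
    unfolding S_W
  proof (rule Laplace_sum_squares_tendsto[OF prob_space_axioms Q _ \<xi>ind \<xi> _ _ _ s])
    show "W n i \<in> borel_measurable P" for n i unfolding W_def by measurable
    show "lam i \<ge> 0" for i by (simp add: lam_def)
    fix g :: "nat \<Rightarrow> real"
    \<comment> \<open>A linear form in the coordinates \<open>W\<close> is a linear form in
      \<open>Z\<close> with these coefficients; \<open>quadratic_form_dct\<close> then diagonalises
      the limiting exponent.\<close>
    let ?a = "\<lambda>j. \<Sum>i=1..k - 1. g i * dct k i j"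
    \<comment> \<open>Distinct levels have correspondingly ordered quantiles: a reversed order
      would, by monotonicity of the margin and \<open>margin_quantile\<close>, reverse the
      levels.\<close>
    have nested: "A n l \<subseteq> A n j" if "1 \<le> j" "j \<le> l" "l \<le> k" for n j l
    proof -
      have "c n / l \<le> c n / j" using that c(1)[of n] by (intro divide_left_mono) auto
      then have "quantile (margin F r) (1 - c n / j) \<le> quantile (margin F r) (1 - c n / l)" for r
        using margin_quantile[of "1 - c n / j" r] margin_quantile[of "1 - c n / l" r] cj[of j n] cj[of l n] that
          margin_mono[of "quantile (margin F r) (1 - c n / l)" "quantile (margin F r) (1 - c n / j)" r]
        by (cases "c n / l = c n / j") (auto simp: not_less[symmetric])
      then show ?thesis unfolding A_def
        by (auto simp: less_eq_vec_def intro: order.trans)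
    qed
    \<comment> \<open>The limit theorem for nested counts is applied with
      \<open>\<kappa> * c n\<close> as its scale, because \<open>p n j\<close> is asymptotically
      \<open>\<kappa> * c n / j\<close>.\<close>
    have "(\<lambda>n. CLINT \<omega>|P. iexp (\<Sum>j=1..k. ?a j * (j * ((\<Sum>i\<in>I n. indicator (A n j) (X i \<omega>)) - card (I n) * p n j)
        / sqrt (card (I n) * (\<kappa> * c n)))))
      \<longlonglongrightarrow> complex_of_real (exp (- (\<Sum>j=1..k. \<Sum>l=1..k. ?a j * ?a l * real (min j l)) / 2))"
    proof (rule char_nested_counts_tendsto[OF _ fin A_meas nested pA _ p_lim])
      show "indep_vars (\<lambda>_. borel) X (I n)" for n
        using I1 by (intro indep_vars_subset[OF ind]) auto
      show "(\<lambda>n. \<kappa> * c n) \<longlonglongrightarrow> 0" using c0 by (auto intro!: tendsto_eq_intros)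
      show "filterlim (\<lambda>n. real (card (I n)) * (\<kappa> * c n)) at_top sequentially" using \<kappa>mc by (simp add: m_def)
    qed
    moreover have "(\<Sum>j=1..k. ?a j * (j * ((\<Sum>i\<in>I n. indicator (A n j) (X i \<omega>)) - card (I n) * p n j) / sqrt (card (I n) * (\<kappa> * c n))))
       = (\<Sum>i=1..k - 1. g i * W n i \<omega>)" for n \<omega>
    proof -
      have "(\<Sum>j=1..k. ?a j * (j * ((\<Sum>i\<in>I n. indicator (A n j) (X i \<omega>)) - card (I n) * p n j) / sqrt (card (I n) * (\<kappa> * c n))))
        = (\<Sum>j=1..k. ?a j * Z n j \<omega>)" by (simp add: Z_def E_def b_def m_def)
      also have "\<dots> = (\<Sum>j=1..k. \<Sum>i=1..k - 1. g i * (dct k i j * Z n j \<omega>))"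
        by (simp add: sum_distrib_right mult.assoc)
      also have "\<dots> = (\<Sum>i=1..k - 1. \<Sum>j=1..k. g i * (dct k i j * Z n j \<omega>))" by (rule sum.swap)
      finally show ?thesis by (simp add: W_def sum_distrib_left)
    qed
    ultimately show "(\<lambda>n. CLINT \<omega>|P. iexp (\<Sum>i=1..k - 1. g i * W n i \<omega>)) \<longlonglongrightarrow> complex_of_real (exp (- (\<Sum>i=1..k - 1. lam i * (g i)\<^sup>2) / 2))"
      by (simp only: quadratic_form_dct lam_def)
  qed simp
  have \<xi>m: "\<xi> i \<in> borel_measurable Q" if "i \<in> {1..k - 1}" for i
    using \<xi>[OF that] by (auto simp: distributed_def)
  have "weak_conv_m (\<lambda>n. distr P borel (T n)) (distr Q borel (\<lambda>\<omega>. \<Sum>i=1..k - 1. lam i * (\<xi> i \<omega>)\<^sup>2))"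
  proof (rule weak_conv_m_of_Laplace[OF prob_space_axioms Q])
    show "(\<lambda>\<omega>. \<Sum>i=1..k - 1. lam i * (\<xi> i \<omega>)\<^sup>2) \<in> borel_measurable Q"
      using \<xi>m by (intro borel_measurable_sum borel_measurable_times borel_measurable_power) auto
    show "(\<Sum>i=1..k - 1. lam i * (\<xi> i \<omega>)\<^sup>2) \<ge> 0" for \<omega> by (intro sum_nonneg) (simp add: lam_def)
    show "(\<lambda>n. \<integral>\<omega>. exp (- s * T n \<omega>) \<partial>P) \<longlonglongrightarrow> (\<integral>\<omega>. exp (- s * (\<Sum>i=1..k - 1. lam i * (\<xi> i \<omega>)\<^sup>2)) \<partial>Q)"
      if "s \<ge> 0" for s
      by (rule Laplace_tendsto_of_vanishes[OF TS T_m S_m T0 S0 that Laplace_S[OF that]])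
  qed (auto simp: T0)
  then show ?thesis unfolding T_def lam_def .
qed

end

theorem theorem4p4:
  fixes P :: "'a measure"
    and X :: "nat \<Rightarrow> 'a \<Rightarrow> real ^ 'd"
    and F :: "real ^ 'd \<Rightarrow> real"
    and N :: "real ^ 'd \<Rightarrow> real"
    and \<delta> :: real
    and k :: nat
    and I :: "nat \<Rightarrow> nat set"
    and c :: "nat \<Rightarrow> real"
    and Q :: "'b measure"
    and \<xi> :: "nat \<Rightarrow> 'b \<Rightarrow> real"
  assumes "prob_space P"
    and "prob_space.indep_vars P (\<lambda>_. borel) X {1..}"
    and "\<And>i. i \<ge> 1 \<Longrightarrow> mcdf (distr P borel (X i)) = F"
    and "continuous_on UNIV F"
    and "\<delta> > 0"
    and "D_norm N"
    and "(\<lambda>u. copula_of F u - (1 - N (u - 1)))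
           \<in> O[at 1 within box 0 1](\<lambda>u. N (u - 1) powr (1 + \<delta>))"
    and "k \<ge> 2"
    and "\<And>n. I n \<subseteq> {1..n}"
    and "filterlim (\<lambda>n. card (I n)) at_top sequentially"
    and "(\<lambda>n. real (card (I n)) * ln (real (card (I n))) / real n) \<longlonglongrightarrow> 0"
    and "\<And>n. n \<ge> 1 \<Longrightarrow> 0 < c n \<and> c n < 1"
    and "c \<longlonglongrightarrow> 0"
    and "filterlim (\<lambda>n. real (card (I n)) * c n) at_top sequentially"
    and "(\<lambda>n. real (card (I n)) * c n powr (1 + 2 * \<delta>)) \<longlonglongrightarrow> 0"
    and "prob_space Q"
    and "prob_space.indep_vars Q (\<lambda>_. borel) \<xi> {1..k - 1}"
    and "\<And>i. i \<in> {1..k - 1} \<Longrightarrow> distributed Q lborel (\<xi> i) std_normal_density"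
  shows "weak_conv_m
           (\<lambda>n. distr P borel (\<lambda>\<omega>. test_stat k (\<lambda>i. X i \<omega>) n (I n) (c n)))
           (distr Q borel
              (\<lambda>\<omega>. \<Sum>i=1..k - 1. 1 / (4 * (sin (real i / real k * (pi / 2)))\<^sup>2) * (\<xi> i \<omega>)\<^sup>2))"
proof -
  interpret df_sample P X F
    using assms(1-4) by (auto simp: df_sample_def df_sample_axioms_def)
  \<comment> \<open>\<open>c 0\<close> is unconstrained, but \<open>I 0\<close> is empty, so its value does not matter.\<close>
  define c' where "c' n = (if n = 0 then 1 / 2 else c n)" for n
  have ev: "\<forall>\<^sub>F n in sequentially. c' n = c n"
    using eventually_ge_at_top[of 1] by eventually_elim (simp add: c'_def)
  have "(\<lambda>\<omega>. test_stat k (\<lambda>i. X i \<omega>) n (I n) (c' n)) = (\<lambda>\<omega>. test_stat k (\<lambda>i. X i \<omega>) n (I n) (c n))" for n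
    using assms(9)[of n] by (cases "n = 0") (auto simp: c'_def test_stat_def exceed_count_def)
  moreover have "weak_conv_m (\<lambda>n. distr P borel (\<lambda>\<omega>. test_stat k (\<lambda>i. X i \<omega>) n (I n) (c' n)))
    (distr Q borel (\<lambda>\<omega>. \<Sum>i=1..k - 1. 1 / (4 * (sin (real i / real k * (pi / 2)))\<^sup>2) * (\<xi> i \<omega>)\<^sup>2))"
  proof (rule test_stat_weak_conv[where N=N and \<delta>=\<delta>])
    show "is_norm N" using assms(6) by (simp add: D_norm_def)
    show "0 < c' n" "c' n < 1" for n using assms(12)[of n] by (auto simp: c'_def)
    show "c' \<longlonglongrightarrow> 0" using assms(13) ev by (simp cong: tendsto_cong)
    show "filterlim (\<lambda>n. real (card (I n)) * c' n) at_top sequentially"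
      using assms(14) ev by (subst filterlim_cong[OF refl refl, where g="\<lambda>n. real (card (I n)) * c n"]) (auto elim: eventually_mono)
    show "(\<lambda>n. real (card (I n)) * c' n powr (1 + 2 * \<delta>)) \<longlonglongrightarrow> 0"
      using assms(15) ev by (subst tendsto_cong[where g="\<lambda>n. real (card (I n)) * c n powr (1 + 2 * \<delta>)"]) (auto elim: eventually_mono)
    \<comment> \<open>Since 3 exceeds \<open>exp 1\<close>, the logarithm is at least 1 from here
      on, and \<open>m / n\<close> is dominated by \<open>m * ln m / n\<close>.\<close>
    have "\<forall>\<^sub>F n in sequentially. card (I n) \<ge> 3" using assms(10) by (simp add: filterlim_at_top)
    then have "\<forall>\<^sub>F n in sequentially. norm (real (card (I n)) / real n) \<le> real (card (I n)) * ln (real (card (I n))) / real n"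
    proof eventually_elim
      case (elim n)
      have "ln (real (card (I n))) \<ge> ln (exp 1)"
        using elim exp_le by (subst ln_le_cancel_iff) auto
      then have "real (card (I n)) * 1 \<le> real (card (I n)) * ln (real (card (I n)))"
        by (intro mult_left_mono) auto
      then show ?case by (simp add: divide_right_mono)
    qed
    then show "(\<lambda>n. real (card (I n)) / real n) \<longlonglongrightarrow> 0"
      using assms(11) by (rule Lim_null_comparison)
  qed (use assms in auto)
  ultimately show ?thesis by simp
qed

end
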